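(* Let $\mathbb{K}$ be a field and let $X \subset \mathbb{V} = \mathbb{P}^{n_1} \times \dots \times \mathbb{P}^{n_q}$ be a zero-dimensional subscheme over $\mathbb{K}$. Then $\operatorname{rin}(X) \le |\operatorname{rem}(X)|$, and the Hilbert-Poincaré polynomial $\mathcal{P}_X(d)$ has dominant term $\operatorname{length}(X)\, d^{q-1}/(q-1)!$.
   Context: Let $q, n_1, \dots, n_q$ be positive integers. The coordinate ring of $\mathbb{V}$ is $\mathbb{S} = \mathbb{K}[x_{ij} \mid 1 \le i \le q,\ 0 \le j \le n_i]$, $\mathbb{Z}^q$-graded by $\deg(x_{ij}) = e_i$, the $i$-th standard basis element of $\mathbb{Z}^q$. For a zero-dimensional subscheme $X \subset \mathbb{V}$, $I(X) \subset \mathbb{S}$ is the ideal generated by the $\mathbb{Z}^q$-homogeneous forms vanishing on $X$, and $\mathcal{H}_X(a) = \dim_{\mathbb{K}} (\mathbb{S}/I(X))_a$, $a \in \mathbb{Z}^q$; $\operatorname{length}(X) = \dim_{\mathbb{K}} H^0(\mathcal{O}_X)$. For $a \in \mathbb{Z}^q$, $|a| = a_1 + \dots + a_q$. Regard $\mathbb{S}/I(X)$ as a $\mathbb{Z}$-graded module over $\mathbb{S}$ with the standard grading by total degree. Its Hilbert function is $\overline{\mathcal{H}}_X(d) = \sum_{|a| = d} \mathcal{H}_X(a)$, $d \in \mathbb{Z}$. The Hilbert-Poincaré polynomial $\mathcal{P}_X$ is the polynomial in one variable with rational coefficients such that $\overline{\mathcal{H}}_X(d) = \mathcal{P}_X(d)$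 for $d$ sufficiently large. The regularity index $\operatorname{rin}(X)$ for $X \subset \mathbb{V}$ is the smallest integer such that $\overline{\mathcal{H}}_X = \mathcal{P}_X$ on $[\operatorname{rin}(X), \infty)$. The projection $Z_i$ of $X$ onto $\mathbb{P}^{n_i}$ is the zero-dimensional subscheme of $\mathbb{P}^{n_i}$ defined by $I(Z_i) = I(X) \cap \mathbb{K}[x_{ij} \mid 0 \le j \le n_i]$. For a zero-dimensional subscheme $Z$ of a single projective space $\mathbb{P}^n$, $\operatorname{rin}(Z)$ is the integer $r \ge 0$ such that $\mathcal{H}_Z$ is strictly increasing on $[0,r]$ and constant on $[r, \infty)$. The regularity multiindex of $X$ is $\operatorname{rem}(X) = (\operatorname{rin}(Z_1), \dots, \operatorname{rin}(Z_q))$. *)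

theory Defs
  imports
    "HOL-Library.FuncSet"
    "HOL-Library.Poly_Mapping"
    "HOL-Library.Function_Algebras"
    "HOL-Computational_Algebra.Polynomial"
begin

section \<open>Dimension of a quotient space\<close>

text \<open>
  For subspaces \<open>W \<subseteq> V\<close>: the residue classes of the \<open>m\<close> elements of \<open>B \<subseteq> V\<close> form a
  basis of \<open>V / W\<close>.
\<close>

definition has_quot_dim ::
  "('k::field \<Rightarrow> 'v::ab_group_add \<Rightarrow> 'v) \<Rightarrow> 'v set \<Rightarrow> 'v set \<Rightarrow> nat \<Rightarrow> bool" where
  "has_quot_dim scale V W m \<longleftrightarrow>
     (\<exists>B. finite B \<and> card B = m \<and> B \<subseteq> V \<and>
       (\<forall>c. (\<Sum>b\<in>B. scale (c b) b) \<in> W \<longrightarrow> (\<forall>b\<in>B. c b = 0)) \<and>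
       (\<forall>v\<in>V. \<exists>c. v - (\<Sum>b\<in>B. scale (c b) b) \<in> W))"

definition quot_dim ::
  "('k::field \<Rightarrow> 'v::ab_group_add \<Rightarrow> 'v) \<Rightarrow> 'v set \<Rightarrow> 'v set \<Rightarrow> nat" where
  "quot_dim scale V W = (THE m. has_quot_dim scale V W m)"


section \<open>Polynomial rings and their localizations\<close>

text \<open>
  All rings below are subrings of one ring of Laurent polynomials in the variables
  \<open>x\<^sub>i\<^sub>j\<close>, indexed by pairs \<open>(i, j)\<close>: a Laurent monomial is a finitely supported integer
  exponent vector. Localizations of a polynomial ring at monomials are then honest subrings.
\<close>

type_synonym 'k laurent = "(nat \<times> nat \<Rightarrow>\<^sub>0 int) \<Rightarrow>\<^sub>0 'k"

definition laurent_scale :: "'k::field \<Rightarrow> 'k laurent \<Rightarrow> 'k laurent" where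
  "laurent_scale c f = Poly_Mapping.single 0 c * f"

text \<open>\<open>laurent_ring U T\<close> is \<open>\<K>[x\<^sub>v | v \<in> U]\<close> with the variables in \<open>T\<close> inverted (\<open>T \<subseteq> U\<close>).\<close>

definition laurent_ring :: "(nat \<times> nat) set \<Rightarrow> (nat \<times> nat) set \<Rightarrow> 'k::field laurent set" where
  "laurent_ring U T =
     {f. \<forall>m\<in>Poly_Mapping.keys f. Poly_Mapping.keys m \<subseteq> U \<and>
           (\<forall>v. v \<notin> T \<longrightarrow> Poly_Mapping.lookup m v \<ge> 0)}"

definition is_ideal :: "'r::comm_ring_1 set \<Rightarrow> 'r set \<Rightarrow> bool" where
  "is_ideal A I \<longleftrightarrow> I \<subseteq> A \<and> 0 \<in> I \<and> (\<forall>x\<in>I. \<forall>y\<in>I. x + y \<in> I) \<and> (\<forall>r\<in>A. \<forall>x\<in>I. r * x \<in> I)"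

definition is_prime_ideal :: "'r::comm_ring_1 set \<Rightarrow> 'r set \<Rightarrow> bool" where
  "is_prime_ideal A P \<longleftrightarrow>
     is_ideal A P \<and> P \<noteq> A \<and> (\<forall>x\<in>A. \<forall>y\<in>A. x * y \<in> P \<longrightarrow> x \<in> P \<or> y \<in> P)"

definition ideal_generated :: "'r::comm_ring_1 set \<Rightarrow> 'r set \<Rightarrow> 'r set" where
  "ideal_generated A G = is_ideal A hull G"


section \<open>The coordinate ring of a product of projective spaces\<close>

text \<open>Below, \<open>q\<close> is the number of factors and \<open>n i\<close> the dimension of the \<open>i\<close>-th one.\<close>

definition vars :: "nat \<Rightarrow> (nat \<Rightarrow> nat) \<Rightarrow> (nat \<times> nat) set" where
  "vars q n = (SIGMA i:{1..q}. {0..n i})"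

definition coord_ring :: "nat \<Rightarrow> (nat \<Rightarrow> nat) \<Rightarrow> 'k::field laurent set" where
  "coord_ring q n = laurent_ring (vars q n) {}"

definition multidegrees :: "nat \<Rightarrow> (nat \<Rightarrow> int) set" where
  "multidegrees q = ({1..q} \<rightarrow>\<^sub>E UNIV)"

definition homogeneous_of :: "nat \<Rightarrow> (nat \<Rightarrow> nat) \<Rightarrow> (nat \<Rightarrow> int) \<Rightarrow> 'k::field laurent \<Rightarrow> bool" where
  "homogeneous_of q n a f \<longleftrightarrow>
     (\<forall>m\<in>Poly_Mapping.keys f. \<forall>i\<in>{1..q}. (\<Sum>j=0..n i. Poly_Mapping.lookup m (i, j)) = a i)"

definition forms :: "nat \<Rightarrow> (nat \<Rightarrow> nat) \<Rightarrow> (nat \<Rightarrow> int) \<Rightarrow> 'k::field laurent set" where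
  "forms q n a = {f \<in> coord_ring q n. homogeneous_of q n a f}"


section \<open>Closed subschemes\<close>

text \<open>
  A chart \<open>c\<close> picks one variable \<open>x\<^sub>i\<^sub>,\<^sub>c\<^sub>i\<close> from each group and stands for the standard affine
  open set where none of them vanishes.
\<close>

definition charts :: "nat \<Rightarrow> (nat \<Rightarrow> nat) \<Rightarrow> (nat \<Rightarrow> nat) set" where
  "charts q n = (\<Pi>\<^sub>E i\<in>{1..q}. {0..n i})"

definition chart_vars :: "nat \<Rightarrow> (nat \<Rightarrow> nat) \<Rightarrow> (nat \<times> nat) set" where
  "chart_vars q c = (\<lambda>i. (i, c i)) ` {1..q}"

text \<open>
  The coordinate ring of the open set where no variable in \<open>T\<close> vanishes, for \<open>T\<close> containing
  a variable from each group: the part of multidegree zero of the localized coordinate ring.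
\<close>

definition affine_ring :: "nat \<Rightarrow> (nat \<Rightarrow> nat) \<Rightarrow> (nat \<times> nat) set \<Rightarrow> 'k::field laurent set" where
  "affine_ring q n T = {f \<in> laurent_ring (vars q n) T. homogeneous_of q n (\<lambda>_. 0) f}"

abbreviation chart_ring :: "nat \<Rightarrow> (nat \<Rightarrow> nat) \<Rightarrow> (nat \<Rightarrow> nat) \<Rightarrow> 'k::field laurent set" where
  "chart_ring q n c \<equiv> affine_ring q n (chart_vars q c)"

abbreviation overlap_ring ::
  "nat \<Rightarrow> (nat \<Rightarrow> nat) \<Rightarrow> (nat \<Rightarrow> nat) \<Rightarrow> (nat \<Rightarrow> nat) \<Rightarrow> 'k::field laurent set" where
  "overlap_ring q n c d \<equiv> affine_ring q n (chart_vars q c \<union> chart_vars q d)"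

text \<open>
  A closed subscheme is given by its quasi-coherent ideal sheaf, that is, by one ideal \<open>X c\<close>
  for each chart such that any two of them have the same extension to the overlap.
\<close>

type_synonym 'k ideal_sheaf = "(nat \<Rightarrow> nat) \<Rightarrow> 'k laurent set"

definition closed_subscheme :: "nat \<Rightarrow> (nat \<Rightarrow> nat) \<Rightarrow> 'k::field ideal_sheaf \<Rightarrow> bool" where
  "closed_subscheme q n X \<longleftrightarrow>
     (\<forall>c\<in>charts q n. is_ideal (chart_ring q n c) (X c)) \<and>
     (\<forall>c\<in>charts q n. \<forall>d\<in>charts q n.
        ideal_generated (overlap_ring q n c d) (X c) =
        ideal_generated (overlap_ring q n c d) (X d))"

text \<open>
  Krull dimension zero: \<open>X\<close> is nonempty, and no chart ring modulo the ideal of \<open>X\<close> has a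
  chain of primes of length one.
\<close>

definition zero_dimensional :: "nat \<Rightarrow> (nat \<Rightarrow> nat) \<Rightarrow> 'k::field ideal_sheaf \<Rightarrow> bool" where
  "zero_dimensional q n X \<longleftrightarrow>
     (\<exists>c\<in>charts q n. X c \<noteq> chart_ring q n c) \<and>
     (\<forall>c\<in>charts q n. \<not> (\<exists>P Q. is_prime_ideal (chart_ring q n c) P \<and>
        is_prime_ideal (chart_ring q n c) Q \<and> X c \<subseteq> P \<and> P \<subset> Q))"

text \<open>
  \<open>H\<^sup>0(\<O>\<^sub>X)\<close> is \<open>section_reps q n X\<close> modulo \<open>null_section_reps q n X\<close>: families of local
  functions that agree on overlaps modulo the ideal of \<open>X\<close>, up to families of elements of that
  ideal. Families vanish outside the index set of charts.
\<close>

definition section_reps ::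
  "nat \<Rightarrow> (nat \<Rightarrow> nat) \<Rightarrow> 'k::field ideal_sheaf \<Rightarrow> ((nat \<Rightarrow> nat) \<Rightarrow> 'k laurent) set" where
  "section_reps q n X =
     {s. (\<forall>c\<in>charts q n. s c \<in> chart_ring q n c) \<and> (\<forall>c. c \<notin> charts q n \<longrightarrow> s c = 0) \<and>
         (\<forall>c\<in>charts q n. \<forall>d\<in>charts q n.
            s c - s d \<in> ideal_generated (overlap_ring q n c d) (X c))}"

definition null_section_reps ::
  "nat \<Rightarrow> (nat \<Rightarrow> nat) \<Rightarrow> 'k::field ideal_sheaf \<Rightarrow> ((nat \<Rightarrow> nat) \<Rightarrow> 'k laurent) set" where
  "null_section_reps q n X = {s \<in> section_reps q n X. \<forall>c\<in>charts q n. s c \<in> X c}"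

definition scheme_length :: "nat \<Rightarrow> (nat \<Rightarrow> nat) \<Rightarrow> 'k::field ideal_sheaf \<Rightarrow> nat" where
  "scheme_length q n X =
     quot_dim (\<lambda>(k::'k) s c. laurent_scale k (s c)) (section_reps q n X) (null_section_reps q n X)"


section \<open>The ideal and the Hilbert functions\<close>

text \<open>
  A form \<open>f\<close> of multidegree \<open>a\<close> is a section of a line bundle, trivialized on the chart \<open>c\<close> by
  dividing by \<open>\<Prod>\<^sub>i x\<^sub>i\<^sub>,\<^sub>c\<^sub>i ^ a\<^sub>i\<close>.
\<close>

definition dehomogenize ::
  "nat \<Rightarrow> (nat \<Rightarrow> int) \<Rightarrow> (nat \<Rightarrow> nat) \<Rightarrow> 'k::field laurent \<Rightarrow> 'k laurent" where
  "dehomogenize q a c f =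
     Poly_Mapping.single (\<Sum>i=1..q. Poly_Mapping.single (i, c i) (- a i)) 1 * f"

definition vanishing_forms ::
  "nat \<Rightarrow> (nat \<Rightarrow> nat) \<Rightarrow> 'k::field ideal_sheaf \<Rightarrow> (nat \<Rightarrow> int) \<Rightarrow> 'k laurent set" where
  "vanishing_forms q n X a = {f \<in> forms q n a. \<forall>c\<in>charts q n. dehomogenize q a c f \<in> X c}"

definition ideal_of :: "nat \<Rightarrow> (nat \<Rightarrow> nat) \<Rightarrow> 'k::field ideal_sheaf \<Rightarrow> 'k laurent set" where
  "ideal_of q n X =
     ideal_generated (coord_ring q n) (\<Union>a\<in>multidegrees q. vanishing_forms q n X a)"

definition hilbert_fun ::
  "nat \<Rightarrow> (nat \<Rightarrow> nat) \<Rightarrow> 'k::field ideal_sheaf \<Rightarrow> (nat \<Rightarrow> int) \<Rightarrow> nat" where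
  "hilbert_fun q n X a = quot_dim laurent_scale (forms q n a) (ideal_of q n X \<inter> forms q n a)"

text \<open>
  There are infinitely many integer multidegrees of a given total degree (if \<open>q \<ge> 2\<close>), so the
  sum has to be restricted to the finitely many nonzero summands.
\<close>

definition total_hilbert_fun :: "nat \<Rightarrow> (nat \<Rightarrow> nat) \<Rightarrow> 'k::field ideal_sheaf \<Rightarrow> int \<Rightarrow> nat" where
  "total_hilbert_fun q n X d =
     (\<Sum>a | a \<in> multidegrees q \<and> (\<Sum>i=1..q. a i) = d \<and> hilbert_fun q n X a \<noteq> 0. hilbert_fun q n X a)"

definition hilbert_poly :: "nat \<Rightarrow> (nat \<Rightarrow> nat) \<Rightarrow> 'k::field ideal_sheaf \<Rightarrow> rat poly" where
  "hilbert_poly q n X =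
     (THE P. \<exists>d\<^sub>0. \<forall>d\<ge>d\<^sub>0. of_nat (total_hilbert_fun q n X d) = poly P (of_int d))"

definition regularity_index :: "nat \<Rightarrow> (nat \<Rightarrow> nat) \<Rightarrow> 'k::field ideal_sheaf \<Rightarrow> int" where
  "regularity_index q n X =
     (LEAST r. \<forall>d\<ge>r. of_nat (total_hilbert_fun q n X d) = poly (hilbert_poly q n X) (of_int d))"


section \<open>Projections to the factors\<close>

definition factor_ring :: "(nat \<Rightarrow> nat) \<Rightarrow> nat \<Rightarrow> 'k::field laurent set" where
  "factor_ring n i = laurent_ring ({i} \<times> {0..n i}) {}"

definition factor_forms :: "(nat \<Rightarrow> nat) \<Rightarrow> nat \<Rightarrow> int \<Rightarrow> 'k::field laurent set" where
  "factor_forms n i d =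
     {f \<in> factor_ring n i.
        \<forall>m\<in>Poly_Mapping.keys f. (\<Sum>j=0..n i. Poly_Mapping.lookup m (i, j)) = d}"

text \<open>The homogeneous ideal defining the projection of \<open>X\<close> to the \<open>i\<close>-th factor.\<close>

definition projection_ideal ::
  "nat \<Rightarrow> (nat \<Rightarrow> nat) \<Rightarrow> 'k::field ideal_sheaf \<Rightarrow> nat \<Rightarrow> 'k laurent set" where
  "projection_ideal q n X i = ideal_of q n X \<inter> factor_ring n i"

definition projection_hilbert_fun ::
  "nat \<Rightarrow> (nat \<Rightarrow> nat) \<Rightarrow> 'k::field ideal_sheaf \<Rightarrow> nat \<Rightarrow> int \<Rightarrow> nat" where
  "projection_hilbert_fun q n X i d =
     quot_dim laurent_scale (factor_forms n i d) (projection_ideal q n X i \<inter> factor_forms n i d)"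

definition regularity_multiindex ::
  "nat \<Rightarrow> (nat \<Rightarrow> nat) \<Rightarrow> 'k::field ideal_sheaf \<Rightarrow> nat \<Rightarrow> int" where
  "regularity_multiindex q n X i =
     (THE r. r \<ge> 0 \<and> strict_mono_on {0..r} (projection_hilbert_fun q n X i) \<and>
        (\<forall>d\<ge>r. projection_hilbert_fun q n X i d = projection_hilbert_fun q n X i r))"

end

theory Submission
  imports Defs
begin

text \<open>
  Dehomogenizing in all charts at once embeds the forms of multidegree \<open>a\<close> modulo the vanishing ones into
  the algebra \<open>E\<close> that is the product, over all charts \<open>c\<close>, of the chart rings modulo \<open>X c\<close>. Let \<open>G a\<close> be
  the image. The Hilbert function is \<open>H a = dim (G a)\<close>, and everything takes place inside \<open>E\<close>.

  The algebra \<open>E\<close> is finite-dimensional (\<open>chart_ring_finite\<close>). Otherwise a coordinate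
  \<open>x\<^sub>i\<^sub>j / x\<^sub>i\<^sub>,\<^sub>c\<^sub>i\<close> of some chart would be transcendental modulo \<open>X c\<close>. A positive-dimensional closed
  subset of \<open>X\<close> on which this coordinate is not constant meets the hyperplane at infinity, and at
  such a point another chart shows a chain of two primes (\<open>coordinate_algebraic\<close>).

  If a linear form \<open>l\<^sub>i\<close> in the \<open>i\<close>-th group of variables has no zero on \<open>X\<close>, multiplication by it is
  injective on \<open>E\<close>. So \<open>H a \<le> H (a + e\<^sub>i)\<close>; and if equality holds at \<open>a\<close>, then \<open>G (a + e\<^sub>i) = l\<^sub>i G a\<close>,
  and multiplying by all forms of multidegree \<open>b\<close> gives equality at \<open>a + b\<close>. Over a finite field such a form
  need not exist. It is replaced by the form \<open>\<Sum>\<^sub>j t ^ j * x\<^sub>i\<^sub>j\<close> with an indeterminate \<open>t\<close>, which is a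
  nonzerodivisor in \<open>E[t]\<close> by McCoy's argument; the two statements then follow by comparing the
  dimensions of spaces of polynomials in \<open>t\<close> of bounded degree (\<open>rk_le_of_regular\<close>, \<open>rk_le_of_stable\<close>).
  Along the \<open>i\<close>-th axis this shows that the Hilbert function of the projection \<open>Z\<^sub>i\<close> increases strictly up
  to \<open>rin Z\<^sub>i\<close> and is constant from there on. Off the axis it shows \<open>H a = H (a + e\<^sub>i)\<close> whenever
  \<open>a\<^sub>i \<ge> rin Z\<^sub>i\<close>. Hence \<open>H a = H (min a (rem X))\<close> for all \<open>a \<ge> 0\<close> (\<open>rk_G_min\<close>).

  The value at \<open>rem X\<close> is the length (\<open>rk_G_rem\<close>). Multiplication by a generic form \<open>f\<close> of
  large multidegree turns functions on \<open>X\<close> into forms, because this clears the denominators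
  (\<open>rk_compat_le\<close>). Conversely \<open>f\<close> has an inverse in \<open>E[t]\<close> up to a polynomial in \<open>t\<close> with scalar
  coefficients, and multiplication by this inverse turns forms into functions (\<open>rk_G_le_compat\<close>).

  It remains to sum over all \<open>a \<ge> 0\<close> of total degree \<open>d\<close> a function that depends on \<open>min a r\<close> only. For
  \<open>d \<ge> |r|\<close> the sum is a polynomial in \<open>d\<close> with dominant term \<open>H r * d ^ (q - 1) / (q - 1)!\<close>
  (\<open>sum_compositions_polynomial\<close>).
\<close>

section \<open>Dimensions of quotient spaces\<close>

context vector_space
begin

definition fin_dim :: "'b set \<Rightarrow> bool" where
  "fin_dim S \<longleftrightarrow> (\<exists>F. finite F \<and> S \<subseteq> span F)"

lemma fin_dim_subset: "local.fin_dim T \<Longrightarrow> S \<subseteq> T \<Longrightarrow> local.fin_dim S"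
  unfolding fin_dim_def by blast

lemma fin_dim_basis:
  assumes "local.fin_dim S"
  obtains B where "finite B" "local.independent B" "B \<subseteq> S" "S \<subseteq> span B" "card B = local.dim S"
proof -
  obtain F where F: "finite F" "S \<subseteq> span F" using assms by (auto simp: fin_dim_def)
  obtain B where B: "B \<subseteq> S" "local.independent B" "S \<subseteq> span B" "card B = local.dim S"
    using basis_exists by blast
  have "finite B" using independent_span_bound[OF F(1) B(2)] B(1) F(2) by blast
  thus ?thesis using B that by blast
qed

lemma dim_mono_fin:
  assumes "S \<subseteq> span T" "local.fin_dim T" shows "local.dim S \<le> local.dim T"
proof -
  obtain B where B: "finite B" "T \<subseteq> span B" "card B = local.dim T" using fin_dim_basis[OF assms(2)] by metis
  have "span T \<subseteq> span B" using B(2) by (simp add: span_minimal)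
  hence "S \<subseteq> span B" using assms(1) by blast
  thus ?thesis using dim_le_card[of S B] B by simp
qed

lemma dim_le_span_Un:
  assumes "local.fin_dim S" "finite F" "T \<subseteq> span (S \<union> F)"
  shows "local.dim T \<le> local.dim S + card F"
proof -
  obtain B where B: "finite B" "S \<subseteq> span B" "card B = local.dim S" using fin_dim_basis[OF assms(1)] by metis
  have "S \<union> F \<subseteq> span (B \<union> F)"
    using B(2) span_mono[of B "B \<union> F"] span_superset[of "B \<union> F"] by blast
  hence "span (S \<union> F) \<subseteq> span (B \<union> F)" by (simp add: span_minimal)
  hence "local.dim T \<le> card (B \<union> F)" using assms B(1) by (intro dim_le_card) auto
  also have "\<dots> \<le> local.dim S + card F" using card_Un_le[of B F] B(3) by simp
  finally show ?thesis .
qed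

lemma complement_basis_exists:
  assumes "S \<subseteq> T" "local.fin_dim T"
  obtains F where "finite F" "F \<subseteq> T" "card F + local.dim S = local.dim T" "T \<subseteq> span (S \<union> F)"
proof -
  obtain B where B: "finite B" "local.independent B" "B \<subseteq> S" "S \<subseteq> span B" "card B = local.dim S"
    using fin_dim_basis[OF fin_dim_subset[OF assms(2,1)]] by metis
  obtain C where C: "B \<subseteq> C" "C \<subseteq> T" "local.independent C" "T \<subseteq> span C"
    using maximal_independent_subset_extend[of B T] B assms(1) by (metis subset_trans)
  obtain F0 where F0: "finite F0" "T \<subseteq> span F0" using assms(2) by (auto simp: fin_dim_def)
  have "finite C" using independent_span_bound[OF F0(1) C(3)] C(2) F0(2) by blast
  moreover have "card C = local.dim T" using basis_card_eq_dim C by blast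
  moreover have "span C \<subseteq> span (S \<union> (C - B))" using B(3) by (intro span_mono) auto
  moreover have "card (C - B) + card B = card C"
    using \<open>finite C\<close> B(1) C(1) by (simp add: card_Diff_subset card_mono)
  ultimately show ?thesis
    using that[of "C - B"] C B(5) by auto
qed

text \<open>
  Modulo a subspace \<open>W\<close> means: after applying \<open>\<pi>\<close>. This turns dimensions of quotients by \<open>W\<close>
  into dimensions of subspaces.
\<close>

lemma projection_along:
  assumes "subspace W"
  obtains \<pi> where "Vector_Spaces.linear scale scale \<pi>" "\<And>x. \<pi> x - x \<in> W" "\<And>x. \<pi> x = 0 \<longleftrightarrow> x \<in> W"
proof -
  interpret vector_space_pair scale scale by unfold_locales
  obtain g where g: "g ` UNIV \<subseteq> W" "Vector_Spaces.linear scale scale g" "\<forall>v\<in>W. g (id v) = v"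
    using linear_exists_left_inverse_on[OF linear_id assms] by auto
  let ?p = "\<lambda>x. x - g x"
  have "Vector_Spaces.linear scale scale ?p"
    using module_hom_sub[OF module_hom_ident] g(2) by (simp add: module_hom_iff_linear)
  moreover have "?p x - x \<in> W" for x using g(1) subspace_neg[OF assms] by auto
  moreover have "?p x = 0 \<longleftrightarrow> x \<in> W" for x using g(1,3) by auto
  ultimately show ?thesis using that by blast
qed

lemma dependent_sequence:
  fixes v :: "nat \<Rightarrow> 'b"
  assumes "\<And>l. l \<le> D \<Longrightarrow> v l \<in> span F" "finite F" "card F \<le> D"
  obtains c where "\<exists>l\<le>D. c l \<noteq> 0" "(\<Sum>l\<le>D. scale (c l) (v l)) = 0"
proof (cases "inj_on v {..D}")
  case True
  have "local.dependent (v ` {..D})"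
  proof (rule ccontr)
    assume "local.independent (v ` {..D})"
    hence "card (v ` {..D}) \<le> card F"
      using independent_span_bound[OF assms(2), of "v ` {..D}"] assms(1) by auto
    thus False using True assms(3) by (simp add: card_image)
  qed
  then obtain u where u: "\<exists>w\<in>v ` {..D}. u w \<noteq> 0" "(\<Sum>w\<in>v ` {..D}. scale (u w) w) = 0"
    using dependent_finite[of "v ` {..D}"] by auto
  have "(\<Sum>l\<le>D. scale (u (v l)) (v l)) = 0"
    using u(2) True by (simp add: sum.reindex)
  thus ?thesis using that[of "u \<circ> v"] u(1) by auto
next
  case False
  then obtain a b where ab: "a \<le> D" "b \<le> D" "a \<noteq> b" "v a = v b" by (auto simp: inj_on_def)
  let ?c = "\<lambda>l. if l = a then (1::'a) else if l = b then -1 else 0"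
  have "(\<Sum>l\<le>D. scale (?c l) (v l)) = (\<Sum>l\<in>{a,b}. scale (?c l) (v l))"
    using ab by (intro sum.mono_neutral_right) auto
  also have "\<dots> = 0" using ab by simp
  finally have "(\<Sum>l\<le>D. scale (?c l) (v l)) = 0" .
  moreover have "\<exists>l\<le>D. ?c l \<noteq> 0" using ab(1) by (intro exI[of _ a]) simp
  ultimately show ?thesis using that[of ?c] by blast
qed

end

context vector_space_pair
begin

text \<open>
  The preimages of a basis of \<open>\<pi> ` V\<close> are a basis of \<open>V\<close> modulo \<open>W\<close>, and conversely. In
  particular all bases modulo \<open>W\<close> have the same size, so that \<open>quot_dim\<close> is meaningful, and two
  linear maps with the same kernel on \<open>V\<close> have images of equal dimension.
\<close>

lemma quot_dim_eq_dim_image: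
  assumes lin: "Vector_Spaces.linear s1 s2 \<pi>" and V: "vs1.subspace V" and WV: "W \<subseteq> V"
    and ker: "\<And>v. v \<in> V \<Longrightarrow> \<pi> v = 0 \<longleftrightarrow> v \<in> W" and fin: "vs2.fin_dim (\<pi> ` V)"
  shows "quot_dim s1 V W = vs2.dim (\<pi> ` V)"
proof -
  interpret \<pi>: Vector_Spaces.linear s1 s2 \<pi> by (rule lin)
  have lc: "\<pi> (\<Sum>b\<in>B. s1 (c b) b) = (\<Sum>b\<in>B. s2 (c b) (\<pi> b))" for B c
    by (simp add: \<pi>.sum \<pi>.scale)
  have inV: "B \<subseteq> V \<Longrightarrow> (\<Sum>b\<in>B. s1 (c b) b) \<in> V" for B c
    by (intro vs1.subspace_sum[OF V] vs1.subspace_scale[OF V]) auto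
  have "has_quot_dim s1 V W m \<longleftrightarrow> m = vs2.dim (\<pi> ` V)" for m
  proof
    assume "m = vs2.dim (\<pi> ` V)"
    then obtain C where C: "finite C" "vs2.independent C" "C \<subseteq> \<pi> ` V" "\<pi> ` V \<subseteq> vs2.span C" "card C = m"
      using vs2.fin_dim_basis[OF fin] by metis
    have "\<forall>c\<in>C. \<exists>v. v \<in> V \<and> \<pi> v = c" using C(3) by auto
    then obtain g where g: "\<And>c. c \<in> C \<Longrightarrow> g c \<in> V \<and> \<pi> (g c) = c" by metis
    have inj: "inj_on g C" by (metis g inj_onI)
    have B: "g ` C \<subseteq> V" using g by auto
    have im: "\<pi> (\<Sum>b\<in>g ` C. s1 (u b) b) = (\<Sum>c\<in>C. s2 (u (g c)) c)" for u
      unfolding lc using inj g by (simp add: sum.reindex)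
    show "has_quot_dim s1 V W m"
      unfolding has_quot_dim_def
    proof (intro exI[of _ "g ` C"] conjI allI impI ballI)
      show "card (g ` C) = m" using inj C(5) by (simp add: card_image)
      fix u b assume u: "(\<Sum>b\<in>g ` C. s1 (u b) b) \<in> W" and "b \<in> g ` C"
      then obtain c where c: "c \<in> C" "b = g c" by auto
      have "(\<Sum>c\<in>C. s2 (u (g c)) c) = 0" using im[of u] ker[OF inV[OF B], of u] u by simp
      thus "u b = 0" using vs2.independentD[OF C(2,1) subset_refl, of "u \<circ> g" c] c by auto
    next
      fix v assume v: "v \<in> V"
      hence "\<pi> v \<in> vs2.span C" using C(4) by auto
      then obtain w where w: "\<pi> v = (\<Sum>c\<in>C. s2 (w c) c)"
        unfolding vs2.span_finite[OF C(1)] by auto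
      define u where "u b = w (\<pi> b)" for b
      have "\<pi> (\<Sum>b\<in>g ` C. s1 (u b) b) = \<pi> v"
        unfolding im w u_def using g by simp
      hence "\<pi> (v - (\<Sum>b\<in>g ` C. s1 (u b) b)) = 0" by (simp add: \<pi>.diff)
      thus "\<exists>c. v - (\<Sum>b\<in>g ` C. s1 (c b) b) \<in> W"
        using ker inV[OF B] vs1.subspace_diff[OF V v] by blast
    qed (use C B in auto)
  next
    assume "has_quot_dim s1 V W m"
    then obtain B where B: "finite B" "card B = m" "B \<subseteq> V"
      "\<And>c b. (\<Sum>b\<in>B. s1 (c b) b) \<in> W \<Longrightarrow> b \<in> B \<Longrightarrow> c b = 0"
      "\<And>v. v \<in> V \<Longrightarrow> \<exists>c. v - (\<Sum>b\<in>B. s1 (c b) b) \<in> W"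
      unfolding has_quot_dim_def by metis
    have inj: "inj_on \<pi> B"
    proof (rule inj_onI, rule ccontr)
      fix a b assume ab: "a \<in> B" "b \<in> B" "\<pi> a = \<pi> b" "a \<noteq> b"
      let ?c = "\<lambda>x. if x = a then 1 else if x = b then - 1 else 0"
      have "(\<Sum>x\<in>B. s1 (?c x) x) = (\<Sum>x\<in>{a,b}. s1 (?c x) x)"
        using ab B(1) by (intro sum.mono_neutral_right) auto
      also have "\<dots> = a - b" using ab(4) by simp
      finally have "(\<Sum>x\<in>B. s1 (?c x) x) \<in> W"
        using ker[of "a - b"] ab B(3) vs1.subspace_diff[OF V, of a b] by (auto simp: \<pi>.diff)
      from B(4)[OF this ab(1)] show False by simp
    qed
    have "vs2.independent (\<pi> ` B)"
    proof
      assume "vs2.dependent (\<pi> ` B)"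
      then obtain u where u: "\<exists>w\<in>\<pi> ` B. u w \<noteq> 0" "(\<Sum>w\<in>\<pi> ` B. s2 (u w) w) = 0"
        using vs2.dependent_finite[of "\<pi> ` B"] B(1) by auto
      have "\<pi> (\<Sum>b\<in>B. s1 (u (\<pi> b)) b) = 0"
        using u(2) inj by (simp add: lc sum.reindex)
      hence "(\<Sum>b\<in>B. s1 ((u \<circ> \<pi>) b) b) \<in> W" using ker inV[OF B(3)] by simp
      from B(4)[OF this] u(1) show False by auto
    qed
    moreover have "\<pi> ` V \<subseteq> vs2.span (\<pi> ` B)"
    proof
      fix y assume "y \<in> \<pi> ` V"
      then obtain v where v: "v \<in> V" "y = \<pi> v" by auto
      obtain c where c: "v - (\<Sum>b\<in>B. s1 (c b) b) \<in> W" using B(5)[OF v(1)] by auto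
      have "\<pi> (v - (\<Sum>b\<in>B. s1 (c b) b)) = 0" using ker c WV by blast
      hence "y = (\<Sum>b\<in>B. s2 (c b) (\<pi> b))" using v by (simp add: \<pi>.diff lc)
      thus "y \<in> vs2.span (\<pi> ` B)" by (simp, intro vs2.span_sum vs2.span_scale vs2.span_base) auto
    qed
    ultimately have "vs2.dim (\<pi> ` V) = card (\<pi> ` B)"
      using vs2.basis_card_eq_dim[OF image_mono[OF B(3)]] by metis
    thus "m = vs2.dim (\<pi> ` V)" using inj B(2) by (simp add: card_image)
  qed
  thus ?thesis unfolding quot_dim_def by (intro the_equality) simp_all
qed

end

section \<open>Finite-dimensional quotient algebras and polynomials over them\<close>

text \<open>
  The quotient algebra \<open>A / N\<close> is finite-dimensional. It is not formed as a type: its elements are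
  represented by the normal forms \<open>proj x\<close>, and polynomials over it by polynomials with coefficients
  in \<open>A\<close>.
\<close>

locale algebra_mod_ideal = vector_space scale
  for scale :: "'k::field \<Rightarrow> 'r::comm_ring_1 \<Rightarrow> 'r" (infixr "*s" 75) +
  fixes A N :: "'r set"
  assumes scale_mult_left: "c *s (x * y) = (c *s x) * y"
    and A_subspace: "subspace A" and A_one: "1 \<in> A"
    and A_mult: "x \<in> A \<Longrightarrow> y \<in> A \<Longrightarrow> x * y \<in> A"
    and N_subspace: "subspace N" and N_subset: "N \<subseteq> A"
    and N_mult: "x \<in> A \<Longrightarrow> y \<in> N \<Longrightarrow> x * y \<in> N"
    and A_fin: "\<exists>F. finite F \<and> A \<subseteq> span (F \<union> N)"
begin

definition proj :: "'r \<Rightarrow> 'r" where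
  "proj = (SOME \<pi>. Vector_Spaces.linear scale scale \<pi> \<and> (\<forall>x. \<pi> x - x \<in> N) \<and> (\<forall>x. \<pi> x = 0 \<longleftrightarrow> x \<in> N))"

lemma proj: "Vector_Spaces.linear scale scale proj" "proj x - x \<in> N" "proj x = 0 \<longleftrightarrow> x \<in> N"
proof -
  have "\<exists>\<pi>. Vector_Spaces.linear scale scale \<pi> \<and> (\<forall>x. \<pi> x - x \<in> N) \<and> (\<forall>x. \<pi> x = 0 \<longleftrightarrow> x \<in> N)"
    using projection_along[OF N_subspace] by metis
  from someI_ex[OF this, folded proj_def]
  show "Vector_Spaces.linear scale scale proj" "proj x - x \<in> N" "proj x = 0 \<longleftrightarrow> x \<in> N" by auto
qed

text \<open>
  The dimension of \<open>(G + N) / N\<close>.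
\<close>

definition rk :: "'r set \<Rightarrow> nat" where "rk G = dim (proj ` G)"

definition polys_over :: "'r set \<Rightarrow> 'r poly set" where
  "polys_over G = {p. \<forall>k. coeff p k \<in> G}"

definition polys_upto :: "nat \<Rightarrow> 'r set \<Rightarrow> 'r poly set" where
  "polys_upto n G = {p. degree p \<le> n \<and> (\<forall>k. coeff p k \<in> G)}"

text \<open>
  The nonzerodivisors of \<open>(A / N)[t]\<close>.
\<close>

definition regular :: "'r poly \<Rightarrow> bool" where
  "regular f \<longleftrightarrow> f \<in> polys_over A \<and> (\<forall>g\<in>polys_over A. f * g \<in> polys_over N \<longrightarrow> g \<in> polys_over N)"

sublocale proj: Vector_Spaces.linear scale scale proj by (rule proj(1))

lemma proj_idem: "proj (proj x) = proj x"
  using proj(2)[of x] proj(3)[of "proj x - x"] by (simp add: proj.diff)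

lemma proj_eq_iff: "proj x = proj y \<longleftrightarrow> x - y \<in> N"
  using proj(3)[of "x - y"] by (simp add: proj.diff)

lemma proj_mult_proj: "x \<in> A \<Longrightarrow> proj (x * proj y) = proj (x * y)"
  unfolding proj_eq_iff right_diff_distrib[symmetric] using N_mult[OF _ proj(2)] by blast

lemma fin_dim_proj_A: "fin_dim (proj ` A)"
proof -
  obtain F where F: "finite F" "A \<subseteq> span (F \<union> N)" using A_fin by auto
  have "proj ` A \<subseteq> span (proj ` (F \<union> N))" using F(2) proj.spans_image by blast
  also have "\<dots> \<subseteq> span (proj ` F)"
    by (intro span_minimal) (auto intro: span_base simp: proj(3)[THEN iffD2] span_zero)
  finally show ?thesis using F(1) unfolding fin_dim_def by blast
qed

lemma fin_dim_proj: "G \<subseteq> A \<Longrightarrow> fin_dim (proj ` G)"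
  using fin_dim_subset[OF fin_dim_proj_A] by blast

lemma rk_mono: "G' \<subseteq> A \<Longrightarrow> G \<subseteq> G' \<Longrightarrow> rk G \<le> rk G'"
  unfolding rk_def by (intro dim_mono_fin fin_dim_proj) (auto intro: span_base)

text \<open>
  Polynomials over the algebra form a vector space over the ground field; \<open>c *s 1\<close> is the constant
  \<open>c\<close> of the algebra.
\<close>

definition pscale :: "'k \<Rightarrow> 'r poly \<Rightarrow> 'r poly" where "pscale c p = smult (c *s 1) p"

lemma coeff_pscale: "coeff (pscale c p) k = c *s coeff p k"
  unfolding pscale_def by (simp flip: scale_mult_left)

lemma degree_pscale: "degree (pscale c p) \<le> degree p"
  unfolding pscale_def by (rule degree_smult_le)

sublocale P: vector_space pscale
  by unfold_locales (auto simp: poly_eq_iff coeff_pscale algebra_simps)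

sublocale SP: vector_space_pair scale pscale by unfold_locales
sublocale PP: vector_space_pair pscale pscale by unfold_locales

definition pproj :: "'r poly \<Rightarrow> 'r poly" where "pproj = map_poly proj"

lemma coeff_pproj: "coeff (pproj p) k = proj (coeff p k)"
  by (simp add: pproj_def coeff_map_poly proj.zero)

lemma pproj_linear: "Vector_Spaces.linear pscale pscale pproj"
  by (auto simp: Vector_Spaces.linear_iff P.vector_space_axioms poly_eq_iff coeff_pproj coeff_pscale proj.add proj.scale)

lemma pproj_eq_0: "pproj p = 0 \<longleftrightarrow> p \<in> polys_over N"
  by (simp add: poly_eq_iff coeff_pproj polys_over_def proj)

lemma degree_pproj: "degree (pproj p) \<le> degree p"
  by (rule degree_le) (simp add: coeff_pproj coeff_eq_0 proj.zero)

lemma polys_upto_subspace: "subspace G \<Longrightarrow> P.subspace (polys_upto n G)"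
  unfolding polys_upto_def
  by (rule P.subspaceI)
     (auto simp: coeff_pscale subspace_0 subspace_add subspace_scale
           intro: degree_add_le order.trans[OF degree_pscale])

lemma dim_polys_upto:
  assumes G: "subspace G" "fin_dim G"
  shows "P.fin_dim (polys_upto n G)" "P.dim (polys_upto n G) = (n + 1) * dim G"
proof -
  obtain B where B: "finite B" "independent B" "B \<subseteq> G" "G \<subseteq> span B" "card B = dim G"
    using fin_dim_basis[OF G(2)] by metis
  define h where "h = (\<lambda>(b::'r, k::nat). monom b k)"
  define C where "C = h ` (B \<times> {..n})"
  have B0: "b \<noteq> 0" if "b \<in> B" for b using that B(2) dependent_zero by blast
  have inj: "inj_on h (B \<times> {..n})"
  proof (rule inj_onI, clarify)
    fix a k b l assume *: "a \<in> B" "b \<in> B" "h (a, k) = h (b, l)"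
    hence "monom a k = monom b l" by (simp add: h_def)
    hence "coeff (monom a k) k = coeff (monom b l) k" by simp
    with B0[OF *(1)] show "a = b \<and> k = l" by (auto split: if_splits)
  qed
  have fC: "finite C" using B(1) by (simp add: C_def)
  have cC: "card C = (n + 1) * dim G"
    unfolding C_def card_image[OF inj] using B(5) by (simp add: card_cartesian_product)
  have sub: "C \<subseteq> polys_upto n G"
  proof
    fix x assume "x \<in> C"
    then obtain b k where "b \<in> B" "k \<le> n" "x = monom b k" by (auto simp: C_def h_def)
    thus "x \<in> polys_upto n G"
      using B(3) subspace_0[OF G(1)] degree_monom_le[of b k] by (auto simp: polys_upto_def)
  qed
  have mono: "monom x k \<in> P.span C" if "x \<in> span B" "k \<le> n" for x k
    using that(1)
  proof (induction rule: span_induct_alt)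
    case base thus ?case by (simp add: P.span_zero)
  next
    case (step c b y)
    have "monom b k \<in> C" using step(1) that(2) by (auto simp: C_def h_def image_iff)
    moreover have "monom (c *s b + y) k = pscale c (monom b k) + monom y k"
      by (auto simp: poly_eq_iff coeff_pscale)
    ultimately show ?case using step(2) by (simp add: P.span_add P.span_scale P.span_base)
  qed
  have span: "polys_upto n G \<subseteq> P.span C"
  proof
    fix p assume p: "p \<in> polys_upto n G"
    have "p = (\<Sum>k\<le>n. monom (coeff p k) k)"
      using poly_as_sum_of_monoms'[of p n] p by (simp add: polys_upto_def)
    moreover have "\<dots> \<in> P.span C"
      using p B(4) by (intro P.span_sum mono) (auto simp: polys_upto_def)
    ultimately show "p \<in> P.span C" by simp
  qed
  have "P.independent C"
  proof (rule P.independent_if_scalars_zero[OF fC])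
    fix u x assume u: "(\<Sum>x\<in>C. pscale (u x) x) = 0" and "x \<in> C"
    then obtain b k where bk: "b \<in> B" "k \<le> n" "x = monom b k" by (auto simp: C_def h_def)
    have "0 = coeff (\<Sum>x\<in>C. pscale (u x) x) k" using u by simp
    also have "\<dots> = (\<Sum>y\<in>B \<times> {..n}. coeff (pscale (u (h y)) (h y)) k)"
      unfolding C_def using inj by (simp add: sum.reindex coeff_sum)
    also have "\<dots> = (\<Sum>b\<in>B. \<Sum>l\<le>n. if l = k then u (monom b k) *s b else 0)"
      unfolding sum.cartesian_product by (intro sum.cong) (auto simp: h_def coeff_pscale)
    also have "\<dots> = (\<Sum>b\<in>B. u (monom b k) *s b)" using bk(2) by simp
    finally show "u x = 0"
      using independentD[OF B(2,1) subset_refl, of "\<lambda>b. u (monom b k)" b] bk by simp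
  qed
  thus "P.dim (polys_upto n G) = (n + 1) * dim G"
    using P.basis_card_eq_dim[OF sub span] cC by simp
  show "P.fin_dim (polys_upto n G)" unfolding P.fin_dim_def using fC span by blast
qed

lemma pproj_image_polys_upto: 
  assumes G: "0 \<in> G" shows "pproj ` polys_upto n G = polys_upto n (proj ` G)"
proof (intro subset_antisym subsetI)
  fix p assume p: "p \<in> polys_upto n (proj ` G)"
  hence "\<forall>k. \<exists>x. x \<in> G \<and> coeff p k = proj x" by (auto simp: polys_upto_def)
  then obtain g where g: "\<And>k. g k \<in> G" "\<And>k. coeff p k = proj (g k)" by metis
  let ?q = "\<Sum>k\<le>n. monom (g k) k"
  have c: "coeff ?q k = (if k \<le> n then g k else 0)" for k
    by (simp add: coeff_sum)
  have "degree ?q \<le> n" by (intro degree_le) (simp add: c)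
  hence "?q \<in> polys_upto n G" using g(1) G by (simp add: polys_upto_def c)
  moreover have "pproj ?q = p"
  proof (rule poly_eqI)
    fix k show "coeff (pproj ?q) k = coeff p k"
    proof (cases "k \<le> n")
      case False
      hence "coeff p k = 0" using p by (intro coeff_eq_0) (auto simp: polys_upto_def)
      thus ?thesis using False by (simp add: coeff_pproj c proj.zero)
    qed (simp add: coeff_pproj c g(2))
  qed
  ultimately show "p \<in> pproj ` polys_upto n G" by blast
next
  fix x assume "x \<in> pproj ` polys_upto n G"
  then obtain p where x: "x = pproj p" and p: "p \<in> polys_upto n G" by blast
  have "degree x \<le> n" using degree_pproj[of p] p by (simp add: x polys_upto_def)
  moreover have "coeff x k \<in> proj ` G" for k using p by (simp add: x coeff_pproj polys_upto_def)
  ultimately show "x \<in> polys_upto n (proj ` G)" by (simp add: polys_upto_def)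
qed

lemma polys_over_mult: "p \<in> polys_over A \<Longrightarrow> q \<in> polys_over A \<Longrightarrow> p * q \<in> polys_over A"
  by (simp add: polys_over_def coeff_mult subspace_sum[OF A_subspace] A_mult)

lemma polys_over_N_mult: "p \<in> polys_over A \<Longrightarrow> q \<in> polys_over N \<Longrightarrow> p * q \<in> polys_over N"
  by (simp add: polys_over_def coeff_mult subspace_sum[OF N_subspace] N_mult)

lemma polys_over_add: "subspace G \<Longrightarrow> p \<in> polys_over G \<Longrightarrow> q \<in> polys_over G \<Longrightarrow> p + q \<in> polys_over G"
  by (auto simp: polys_over_def subspace_add)

lemma polys_over_diff: "subspace G \<Longrightarrow> p \<in> polys_over G \<Longrightarrow> q \<in> polys_over G \<Longrightarrow> p - q \<in> polys_over G"
  by (auto simp: polys_over_def subspace_diff)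

lemma regular_1: "regular 1"
  using A_one subspace_0[OF A_subspace] by (auto simp: regular_def polys_over_def)

lemma regular_mult: "regular f \<Longrightarrow> regular g \<Longrightarrow> regular (f * g)"
  unfolding regular_def by (metis mult.assoc polys_over_mult)


lemma proj_in_A: "x \<in> A \<Longrightarrow> proj x \<in> A"
  using subspace_add[OF A_subspace, of x "proj x - x"] proj(2) N_subset by auto

lemma pproj_diff: "pproj p - p \<in> polys_over N"
  by (simp add: polys_over_def coeff_pproj proj(2))

lemma pproj_over_A: "p \<in> polys_over A \<Longrightarrow> pproj p \<in> polys_over A"
  by (simp add: polys_over_def coeff_pproj proj_in_A)

text \<open>
  McCoy's argument: if some polynomial outside \<open>N[t]\<close> kills \<open>f\<close> modulo \<open>N\<close>, then one of least degree
  is killed by every coefficient of \<open>f\<close>, since otherwise multiplying it by the highest coefficient that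
  does not kill it would lower its degree. Coefficients that generate the unit ideal kill nothing.
\<close>

lemma regular_of_unit_content:
  assumes f: "f \<in> polys_over A" and z: "\<And>k. z k \<in> A"
    and unit: "(\<Sum>k\<le>degree f. z k * coeff f k) - 1 \<in> N"
  shows "regular f"
proof -
  have fA: "coeff f k \<in> A" for k using f by (simp add: polys_over_def)
  have key: "g = 0" if "g \<in> polys_over A" "pproj g = g" "f * g \<in> polys_over N" for g
    using that
  proof (induction "degree g" arbitrary: g rule: less_induct)
    case less
    show ?case
    proof (rule ccontr)
      assume "g \<noteq> 0"
      have gA: "coeff g k \<in> A" for k using less.prems(1) by (simp add: polys_over_def)
      let ?h = "\<lambda>k. pproj (smult (coeff f k) g)"
      have h0: "?h k = 0" for k
      proof (rule ccontr)
        assume "?h k \<noteq> 0"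
        \<comment> \<open>The maximum of \<open>K\<close> is the index of the highest coefficient of \<open>f\<close> that does not kill \<open>g\<close>.\<close>
        define K where "K = {k. ?h k \<noteq> 0}"
        have "K \<subseteq> {..degree f}"
        proof
          fix k assume "k \<in> K"
          hence "coeff f k \<noteq> 0" by (auto simp: K_def pproj_def)
          thus "k \<in> {..degree f}" by (simp add: le_degree)
        qed
        hence "finite K" "K \<noteq> {}" using \<open>?h k \<noteq> 0\<close> finite_subset by (auto simp: K_def)
        then obtain m where m: "?h m \<noteq> 0" "\<And>i. ?h i \<noteq> 0 \<Longrightarrow> i \<le> m"
          using Max_in[of K] Max_ge[of K] by (auto simp: K_def)
        let ?e = "degree g"
        have big: "coeff f i * coeff g j \<in> N" if "i > m" for i j
        proof -
          have "?h i = 0" using m(2) that by fastforce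
          hence "coeff (?h i) j = 0" by simp
          thus ?thesis by (simp add: coeff_pproj proj(3))
        qed
        have "(\<Sum>i\<le>m + ?e. coeff f i * coeff g (m + ?e - i)) \<in> N"
          using less.prems(3) by (simp add: polys_over_def flip: coeff_mult)
        also have "(\<Sum>i\<le>m + ?e. coeff f i * coeff g (m + ?e - i))
          = coeff f m * coeff g ?e + (\<Sum>i\<in>{..m + ?e} - {m}. coeff f i * coeff g (m + ?e - i))"
          by (subst sum.remove[of _ m]) auto
        finally have top: "coeff f m * coeff g ?e + (\<Sum>i\<in>{..m + ?e} - {m}. coeff f i * coeff g (m + ?e - i)) \<in> N" .
        \<comment> \<open>Terms with \<open>i < m\<close> are zero for degree reasons, those with \<open>i > m\<close> lie in \<open>N\<close> by the choice of \<open>m\<close>.\<close>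
        have "(\<Sum>i\<in>{..m + ?e} - {m}. coeff f i * coeff g (m + ?e - i)) \<in> N"
        proof (rule subspace_sum[OF N_subspace])
          fix i assume i: "i \<in> {..m + ?e} - {m}"
          show "coeff f i * coeff g (m + ?e - i) \<in> N"
          proof (cases "i > m")
            case False
            hence "degree g < m + ?e - i" using i by auto
            thus ?thesis using subspace_0[OF N_subspace] by (simp add: coeff_eq_0)
          qed (rule big)
        qed
        from subspace_diff[OF N_subspace top this] have c: "coeff f m * coeff g ?e \<in> N" by simp
        have ce: "coeff (?h m) ?e = 0" using c by (simp add: coeff_pproj proj(3))
        have "degree (?h m) \<le> ?e"
          using degree_pproj degree_smult_le order.trans by blast
        moreover have "degree (?h m) \<noteq> ?e"
          using ce m(1) by (metis leading_coeff_0_iff)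
        ultimately have "degree (?h m) < ?e" by simp
        moreover have "?h m \<in> polys_over A"
          using fA gA by (intro pproj_over_A) (simp add: polys_over_def A_mult)
        moreover have "pproj (?h m) = ?h m" by (simp add: poly_eq_iff coeff_pproj proj_idem)
        moreover have "f * ?h m \<in> polys_over N"
        proof -
          have "f * ?h m = f * (?h m - smult (coeff f m) g) + smult (coeff f m) (f * g)"
            by (simp add: algebra_simps)
          moreover have "smult (coeff f m) (f * g) \<in> polys_over N"
            using less.prems(3) fA by (simp add: polys_over_def N_mult)
          ultimately show ?thesis
            using polys_over_add[OF N_subspace polys_over_N_mult[OF f pproj_diff]] by simp
        qed
        ultimately have "?h m = 0" using less.hyps by blast
        with m(1) show False by simp
      qed
      have fg: "coeff f k * coeff g j \<in> N" for k j
      proof -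
        have "coeff (?h k) j = 0" using h0[of k] by simp
        thus ?thesis by (simp add: coeff_pproj proj(3))
      qed
      have "coeff g j = 0" for j
      proof -
        let ?u = "(\<Sum>k\<le>degree f. z k * coeff f k) - 1"
        have "coeff g j = (\<Sum>k\<le>degree f. z k * (coeff f k * coeff g j)) - coeff g j * ?u"
          by (simp add: algebra_simps sum_distrib_left)
        also have "\<dots> \<in> N"
          by (intro subspace_diff[OF N_subspace] subspace_sum[OF N_subspace] N_mult[OF z fg] N_mult[OF gA unit])
        finally have "proj (coeff g j) = 0" by (simp add: proj(3))
        thus ?thesis using less.prems(2) by (metis coeff_pproj)
      qed
      thus False using \<open>g \<noteq> 0\<close> by (simp add: poly_eq_iff)
    qed
  qed
  have "g \<in> polys_over N" if g: "g \<in> polys_over A" "f * g \<in> polys_over N" for g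
  proof -
    have "f * pproj g = f * (pproj g - g) + f * g" by (simp add: algebra_simps)
    hence "f * pproj g \<in> polys_over N"
      using polys_over_add[OF N_subspace polys_over_N_mult[OF f pproj_diff] g(2)] by simp
    hence "pproj g = 0"
      using key[of "pproj g"] pproj_over_A[OF g(1)] by (simp add: poly_eq_iff coeff_pproj proj_idem)
    thus ?thesis by (simp add: pproj_eq_0)
  qed
  thus ?thesis using f by (auto simp: regular_def)
qed

definition mulmap :: "'r poly \<Rightarrow> 'r poly \<Rightarrow> 'r poly" where
  "mulmap f p = pproj (f * p)"

lemma mulmap_linear: "Vector_Spaces.linear pscale pscale (mulmap f)"
proof -
  interpret pp: Vector_Spaces.linear pscale pscale pproj by (rule pproj_linear)
  have "f * pscale c p = pscale c (f * p)" for c p by (simp add: pscale_def)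
  thus ?thesis
    by (simp add: Vector_Spaces.linear_iff P.vector_space_axioms mulmap_def distrib_left pp.add pp.scale)
qed

lemma mulmap_kernel:
  "regular f \<Longrightarrow> p \<in> polys_over A \<Longrightarrow> mulmap f p = 0 \<longleftrightarrow> p \<in> polys_over N"
  unfolding mulmap_def pproj_eq_0 regular_def using polys_over_N_mult by blast

lemma dim_pproj_polys_upto:
  assumes "subspace G" "G \<subseteq> A"
  shows "P.fin_dim (pproj ` polys_upto n G)" "P.dim (pproj ` polys_upto n G) = (n + 1) * rk G"
  using dim_polys_upto[OF proj.subspace_image[OF assms(1)] fin_dim_proj[OF assms(2)], of n]
    pproj_image_polys_upto[OF subspace_0[OF assms(1)], of n]
  by (simp_all add: rk_def)

lemma mulmap_image_subset:
  assumes "subspace G'" and fG: "\<And>g k. g \<in> G \<Longrightarrow> proj (coeff f k * g) \<in> proj ` G'"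
  shows "mulmap f ` polys_upto n G \<subseteq> pproj ` polys_upto (n + degree f) G'"
proof
  fix x assume "x \<in> mulmap f ` polys_upto n G"
  then obtain p where p: "p \<in> polys_upto n G" "x = pproj (f * p)" by (auto simp: mulmap_def)
  have "degree x \<le> n + degree f"
    using degree_pproj[of "f * p"] degree_mult_le[of f p] p by (simp add: polys_upto_def)
  moreover have "coeff x k \<in> proj ` G'" for k
  proof -
    have "coeff x k = (\<Sum>i\<le>k. proj (coeff f i * coeff p (k - i)))"
      by (simp add: p coeff_pproj coeff_mult proj.sum)
    also have "\<dots> \<in> proj ` G'"
      using p(1) by (intro subspace_sum[OF proj.subspace_image[OF assms(1)]] fG) (simp add: polys_upto_def)
    finally show ?thesis .
  qed
  ultimately show "x \<in> pproj ` polys_upto (n + degree f) G'"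
    unfolding pproj_image_polys_upto[OF subspace_0[OF assms(1)]] by (simp add: polys_upto_def)
qed

lemma dim_mulmap_image:
  assumes f: "regular f" and G: "subspace G" "G \<subseteq> A"
    and fin: "P.fin_dim (mulmap f ` polys_upto n G)"
  shows "P.dim (mulmap f ` polys_upto n G) = (n + 1) * rk G"
proof -
  let ?V = "polys_upto n G"
  have VA: "?V \<subseteq> polys_over A" using G(2) by (auto simp: polys_upto_def polys_over_def)
  have "quot_dim pscale ?V (?V \<inter> polys_over N) = P.dim (mulmap f ` ?V)"
    using VA mulmap_kernel[OF f]
    by (intro PP.quot_dim_eq_dim_image[OF mulmap_linear polys_upto_subspace[OF G(1)] _ _ fin]) auto
  moreover have "quot_dim pscale ?V (?V \<inter> polys_over N) = P.dim (pproj ` ?V)"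
    using pproj_eq_0
    by (intro PP.quot_dim_eq_dim_image[OF pproj_linear polys_upto_subspace[OF G(1)] _ _ dim_pproj_polys_upto(1)[OF G]]) auto
  ultimately show ?thesis using dim_pproj_polys_upto(2)[OF G] by simp
qed

lemma growth_bound:
  fixes d d' m c :: nat
  assumes "\<And>n. (n + 1) * d \<le> (n + 1) * d' + c"
  shows "d \<le> d'"
proof (rule ccontr)
  assume "\<not> d \<le> d'"
  hence "(c + 1) * (d' + 1) \<le> (c + 1) * d" by (intro mult_left_mono) auto
  with assms[of c] show False by (simp add: algebra_simps)
qed

text \<open>
  Multiplication by \<open>f\<close> embeds the polynomials of degree at most \<open>k\<close> with coefficients in \<open>G\<close> into
  those of degree at most \<open>k + degree f\<close> with coefficients in \<open>G'\<close>. So \<open>(k + 1) * rk G\<close> is at most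
  \<open>(k + degree f + 1) * rk G'\<close>, and \<open>k\<close> is arbitrary. Over a finite field
  there need not be a single regular element that carries \<open>G\<close> into \<open>G'\<close>.
\<close>

lemma rk_le_of_regular:
  assumes f: "regular f" and G: "subspace G" "G \<subseteq> A" and G': "subspace G'" "G' \<subseteq> A"
    and fG: "\<And>g k. g \<in> G \<Longrightarrow> proj (coeff f k * g) \<in> proj ` G'"
  shows "rk G \<le> rk G'"
proof (rule growth_bound)
  fix n
  let ?I = "mulmap f ` polys_upto n G" and ?T = "pproj ` polys_upto (n + degree f) G'"
  have sub: "?I \<subseteq> ?T" by (rule mulmap_image_subset[OF G'(1) fG])
  note T = dim_pproj_polys_upto[OF G', of "n + degree f"]
  have "(n + 1) * rk G = P.dim ?I"
    using dim_mulmap_image[OF f G P.fin_dim_subset[OF T(1) sub]] by simp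
  also have "\<dots> \<le> P.dim ?T"
    using P.span_superset sub by (intro P.dim_mono_fin T(1)) blast
  finally show "(n + 1) * rk G \<le> (n + 1) * rk G' + degree f * rk G'"
    using T(2) by (simp add: algebra_simps)
qed

text \<open>
  If the ranks agree, the cokernel of multiplication by \<open>f\<close> has a dimension that does not grow with
  the degree bound.
\<close>

lemma mulmap_cokernel:
  assumes f: "regular f" and G: "subspace G" "G \<subseteq> A" and G': "subspace G'" "G' \<subseteq> A"
    and fG: "\<And>g k. g \<in> G \<Longrightarrow> proj (coeff f k * g) \<in> proj ` G'" and rk: "rk G = rk G'"
  obtains F where "finite F" "card F = degree f * rk G'"
    "pproj ` polys_upto (n + degree f) G' \<subseteq> P.span (mulmap f ` polys_upto n G \<union> F)"
proof -
  let ?I = "mulmap f ` polys_upto n G" and ?T = "pproj ` polys_upto (n + degree f) G'"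
  have sub: "?I \<subseteq> ?T" by (rule mulmap_image_subset[OF G'(1) fG])
  note T = dim_pproj_polys_upto[OF G', of "n + degree f"]
  obtain F where F: "finite F" "card F + P.dim ?I = P.dim ?T" "?T \<subseteq> P.span (?I \<union> F)"
    using P.complement_basis_exists[OF sub T(1)] by metis
  moreover have "P.dim ?I = (n + 1) * rk G'"
    using dim_mulmap_image[OF f G P.fin_dim_subset[OF T(1) sub]] rk by simp
  ultimately show ?thesis using that[of F] T(2) by (simp add: algebra_simps)
qed

text \<open>
  Multiplying generators of the cokernel of \<open>f\<close> from \<open>G[t]\<close> to \<open>G'[t]\<close> by the elements of \<open>B\<close>
  gives generators of the cokernel of \<open>f\<close> from \<open>H[t]\<close> to \<open>H'[t]\<close>. So the latter cokernel has bounded dimension as well,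
  whereas it would grow linearly with the degree bound if \<open>rk H'\<close> were larger than \<open>rk H\<close>.
\<close>

lemma rk_le_of_stable:
  assumes f: "regular f" and G: "subspace G" "G \<subseteq> A" and G': "subspace G'" "G' \<subseteq> A"
    and fG: "\<And>g k. g \<in> G \<Longrightarrow> proj (coeff f k * g) \<in> proj ` G'" and rk: "rk G = rk G'"
    and B: "finite B" "B \<subseteq> A" and H: "subspace H" "H \<subseteq> A" and H': "subspace H'" "H' \<subseteq> A"
    and BG: "\<And>b g. b \<in> B \<Longrightarrow> g \<in> G \<Longrightarrow> b * g \<in> H"
    and H'B: "H' \<subseteq> span {b * g |b g. b \<in> B \<and> g \<in> G'}"
    and fH: "\<And>h k. h \<in> H \<Longrightarrow> proj (coeff f k * h) \<in> proj ` H'"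
  shows "rk H' \<le> rk H"
proof (rule growth_bound)
  fix n
  let ?J = "mulmap f ` polys_upto n H" and ?T' = "pproj ` polys_upto (n + degree f) H'"
  obtain F where F: "finite F" "card F = degree f * rk G'"
    "pproj ` polys_upto (n + degree f) G' \<subseteq> P.span (mulmap f ` polys_upto n G \<union> F)"
    using mulmap_cokernel[OF f G G' fG rk] by metis
  let ?E = "\<Union>b\<in>B. mulmap [:b:] ` F"
  have fin: "P.fin_dim ?J"
    using P.fin_dim_subset[OF dim_pproj_polys_upto(1)[OF H'] mulmap_image_subset[OF H'(1) fH]] .
  have sub: "?T' \<subseteq> P.span (?J \<union> ?E)"
  proof
    fix x assume "x \<in> ?T'"
    then obtain p where p: "p \<in> polys_upto (n + degree f) H'" "x = pproj p" by auto
    have gen: "monom (proj y) k \<in> P.span (?J \<union> ?E)"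
      if "y \<in> span {b * g |b g. b \<in> B \<and> g \<in> G'}" "k \<le> n + degree f" for y k
      using that(1)
    proof (induction rule: span_induct_alt)
      case base thus ?case by (simp add: P.span_zero proj.zero)
    next
      case (step c y0 y)
      then obtain b g where bg: "y0 = b * g" "b \<in> B" "g \<in> G'" by auto
      interpret mb: Vector_Spaces.linear pscale pscale "mulmap [:b:]" by (rule mulmap_linear)
      have bA: "b \<in> A" using bg(2) B(2) by blast
      have "monom g k \<in> polys_upto (n + degree f) G'"
        using bg(3) that(2) degree_monom_le[of g k] subspace_0[OF G'(1)] by (auto simp: polys_upto_def)
      hence "pproj (monom g k) \<in> P.span (mulmap f ` polys_upto n G \<union> F)" using F(3) by blast
      hence "mulmap [:b:] (pproj (monom g k)) \<in> P.span (mulmap [:b:] ` (mulmap f ` polys_upto n G \<union> F))"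
        using mb.span_image by blast
      moreover have "mulmap [:b:] (pproj (monom g k)) = monom (proj y0) k"
        using proj_mult_proj[OF bA] by (simp add: poly_eq_iff mulmap_def coeff_pproj bg(1) proj.zero)
      moreover have "mulmap [:b:] ` (mulmap f ` polys_upto n G \<union> F) \<subseteq> ?J \<union> ?E"
      proof
        fix w assume "w \<in> mulmap [:b:] ` (mulmap f ` polys_upto n G \<union> F)"
        then consider v where "v \<in> F" "w = mulmap [:b:] v"
          | r where "r \<in> polys_upto n G" "w = mulmap [:b:] (mulmap f r)" by auto
        thus "w \<in> ?J \<union> ?E"
        proof cases
          case 2
          have "w = mulmap f (smult b r)"
            by (simp add: 2 poly_eq_iff mulmap_def coeff_pproj proj_mult_proj[OF bA])
          moreover have "smult b r \<in> polys_upto n H"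
            using 2(1) BG[OF bg(2)] degree_smult_le[of b r] by (auto simp: polys_upto_def)
          ultimately show ?thesis by blast
        qed (use bg(2) in blast)
      qed
      ultimately have "monom (proj y0) k \<in> P.span (?J \<union> ?E)"
        using P.span_mono by (metis (no_types, lifting) subsetD)
      moreover have "monom (proj (c *s y0 + y)) k = pscale c (monom (proj y0) k) + monom (proj y) k"
        by (auto simp: poly_eq_iff coeff_pscale proj.add proj.scale)
      ultimately show ?case using step(2) by (simp add: P.span_add P.span_scale)
    qed
    have "degree x \<le> n + degree f"
      using degree_pproj[of p] p by (simp add: polys_upto_def)
    hence "x = (\<Sum>k\<le>n + degree f. monom (coeff x k) k)"
      by (simp add: poly_as_sum_of_monoms')
    also have "\<dots> = (\<Sum>k\<le>n + degree f. monom (proj (coeff p k)) k)" by (simp add: p coeff_pproj)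
    also have "\<dots> \<in> P.span (?J \<union> ?E)"
      using p(1) H'B by (intro P.span_sum gen) (auto simp: polys_upto_def)
    finally show "x \<in> P.span (?J \<union> ?E)" .
  qed
  have "card ?E \<le> (\<Sum>b\<in>B. card (mulmap [:b:] ` F))" by (rule card_UN_le[OF B(1)])
  also have "\<dots> \<le> (\<Sum>b\<in>B. card F)" by (intro sum_mono card_image_le F(1))
  finally have E: "card ?E \<le> card B * (degree f * rk G')" by (simp add: F(2))
  have "(n + degree f + 1) * rk H' = P.dim ?T'" using dim_pproj_polys_upto(2)[OF H'] by simp
  also have "\<dots> \<le> P.dim ?J + card ?E"
    using F(1) B(1) by (intro P.dim_le_span_Un fin sub) auto
  also have "\<dots> \<le> (n + 1) * rk H + card B * (degree f * rk G')"
    using E dim_mulmap_image[OF f H fin] by simp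
  finally show "(n + 1) * rk H' \<le> (n + 1) * rk H + card B * (degree f * rk G')"
    by (simp add: algebra_simps)
qed

text \<open>
  The multiples of \<open>f\<close> of bounded degree have a codimension independent of the bound, so
  sufficiently many powers of \<open>t\<close> are dependent modulo them. In other words \<open>f\<close> becomes invertible
  over the field of rational functions in \<open>t\<close>.
\<close>

lemma regular_divides_scalar_poly:
  assumes f: "regular f"
  obtains u p where "u \<in> polys_over A" "p \<noteq> 0"
    "f * u - map_poly (\<lambda>c. c *s 1) p \<in> polys_over N"
proof -
  let ?M = "degree f * rk A"
  let ?S = "P.span (mulmap f ` polys_upto ?M A)"
  have "proj (coeff f k * g) \<in> proj ` A" if "g \<in> A" for g k
    using that f by (auto simp: regular_def polys_over_def A_mult)
  from mulmap_cokernel[OF f A_subspace subset_refl A_subspace subset_refl this refl, of "?M"]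
  obtain F where F: "finite F" "card F = ?M"
    "pproj ` polys_upto (?M + degree f) A \<subseteq> P.span (mulmap f ` polys_upto ?M A \<union> F)" by metis
  \<comment> \<open>Only the part spanned by \<open>F\<close> survives modulo the multiples of \<open>f\<close>, and that has dimension at most \<open>?M\<close>.\<close>
  obtain \<kappa> where k: "Vector_Spaces.linear pscale pscale \<kappa>" "\<And>x. \<kappa> x = 0 \<longleftrightarrow> x \<in> ?S"
    using P.projection_along[OF P.subspace_span] by metis
  interpret k: Vector_Spaces.linear pscale pscale \<kappa> by (rule k(1))
  define v where "v l = \<kappa> (monom (proj 1) l)" for l
  have vF: "v l \<in> P.span (\<kappa> ` F)" if "l \<le> ?M" for l
  proof -
    have "monom 1 l \<in> polys_upto (?M + degree f) A"
      using that A_one subspace_0[OF A_subspace] degree_monom_le[of "1::'r" l] by (auto simp: polys_upto_def)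
    moreover have "pproj (monom 1 l) = monom (proj 1) l"
      by (simp add: poly_eq_iff coeff_pproj proj.zero)
    ultimately have "monom (proj 1) l \<in> P.span (mulmap f ` polys_upto ?M A \<union> F)"
      using F(3) by (metis image_subset_iff)
    hence "v l \<in> P.span (\<kappa> ` (mulmap f ` polys_upto ?M A \<union> F))"
      unfolding v_def using k.span_image by blast
    also have "\<dots> \<subseteq> P.span (\<kappa> ` F)"
      using P.span_base by (intro P.span_minimal) (auto simp: k(2)[THEN iffD2] P.span_zero)
    finally show ?thesis .
  qed
  have "card (\<kappa> ` F) \<le> ?M" using card_image_le[OF F(1), of \<kappa>] F(2) by simp
  then obtain c where c: "\<exists>l\<le>?M. c l \<noteq> 0" "(\<Sum>l\<le>?M. pscale (c l) (v l)) = 0"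
    using P.dependent_sequence[of ?M v "\<kappa> ` F"] vF F(1) by blast
  define p where "p = (\<Sum>l\<le>?M. monom (c l) l)"
  have cp: "coeff p l = (if l \<le> ?M then c l else 0)" for l by (simp add: p_def coeff_sum)
  have "p \<noteq> 0" using c(1) cp by (metis coeff_0)
  have "\<kappa> (\<Sum>l\<le>?M. pscale (c l) (monom (proj 1) l)) = 0"
    using c(2) by (simp add: k.sum k.scale v_def)
  moreover have "(\<Sum>l\<le>?M. pscale (c l) (monom (proj 1) l)) = pproj (map_poly (\<lambda>c. c *s 1) p)"
    by (simp add: poly_eq_iff coeff_sum coeff_pscale coeff_pproj coeff_map_poly cp proj.scale if_distrib[of "\<lambda>x. _ *s x"]
        proj.zero if_distrib[of proj] cong: if_cong)
  ultimately have "pproj (map_poly (\<lambda>c. c *s 1) p) \<in> ?S" using k(2) by simp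
  moreover have "P.subspace (mulmap f ` polys_upto ?M A)"
    using module_hom.subspace_image mulmap_linear polys_upto_subspace[OF A_subspace]
    by (metis Vector_Spaces.linear.axioms(1) linear_iff_module_hom)
  ultimately obtain u where u: "u \<in> polys_upto ?M A" "pproj (map_poly (\<lambda>c. c *s 1) p) = pproj (f * u)"
    by (auto simp: P.span_eq_iff[THEN iffD2] mulmap_def)
  have "f * u - map_poly (\<lambda>c. c *s 1) p \<in> polys_over N"
    using u(2) by (simp add: polys_over_def poly_eq_iff coeff_pproj proj_eq_iff[symmetric] del: coeff_mult)
  moreover have "u \<in> polys_over A" using u(1) by (auto simp: polys_upto_def polys_over_def)
  ultimately show ?thesis using that \<open>p \<noteq> 0\<close> by blast
qed

lemma regular_scalar_poly:
  assumes "p \<noteq> 0" shows "regular (map_poly (\<lambda>c. c *s 1) p)" (is "regular ?p")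
proof -
  have cp: "coeff ?p k = coeff p k *s 1" for k by (simp add: coeff_map_poly)
  have deg: "degree ?p \<le> degree p" by (rule degree_le) (simp add: cp coeff_eq_0)
  have A: "?p \<in> polys_over A"
    using A_one subspace_scale[OF A_subspace] by (simp add: polys_over_def cp)
  define z where "z k = (if k = degree p then inverse (lead_coeff p) *s 1 else 0)" for k
  show ?thesis
  proof (cases "degree ?p = degree p")
    case True
    have "(\<Sum>k\<le>degree ?p. z k * coeff ?p k) = (\<Sum>k\<le>degree p. if k = degree p then 1 else 0)"
      unfolding True
      using assms by (intro sum.cong) (auto simp: z_def cp simp flip: scale_mult_left)
    hence "(\<Sum>k\<le>degree ?p. z k * coeff ?p k) = 1" by simp
    thus ?thesis
      using A A_one subspace_scale[OF A_subspace] subspace_0[OF A_subspace] subspace_0[OF N_subspace]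
      by (intro regular_of_unit_content[of _ z]) (auto simp: z_def)
  next
    case False
    hence "lead_coeff p *s 1 = 0" using deg by (simp add: coeff_eq_0 flip: cp)
    \<comment> \<open>The degree can only drop if the algebra is trivial.\<close>
    hence "(1::'r) = 0" using assms by simp
    hence "x = 0" for x :: 'r using mult_1_left[of x] by simp
    hence "coeff g k = 0" for g :: "'r poly" and k by blast
    hence "g \<in> polys_over N" for g using subspace_0[OF N_subspace] by (simp add: polys_over_def)
    thus ?thesis using A by (simp add: regular_def)
  qed
qed

end

section \<open>Laurent monomials and forms\<close>

abbreviation "lookup \<equiv> Poly_Mapping.lookup"
abbreviation "keys \<equiv> Poly_Mapping.keys"
abbreviation "single \<equiv> Poly_Mapping.single"

lemma lookup_laurent_scale: "lookup (laurent_scale c f) m = c * lookup f m"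
  unfolding laurent_scale_def mult_map_scale_conv_mult[symmetric]
  by (simp add: Poly_Mapping.map.rep_eq when_def)

global_interpretation L: vector_space "laurent_scale :: 'k::field \<Rightarrow> 'k laurent \<Rightarrow> 'k laurent"
  by unfold_locales (auto intro!: poly_mapping_eqI simp: lookup_laurent_scale lookup_add algebra_simps)

lemma laurent_scale_mult_left: "laurent_scale c (f * g) = laurent_scale c f * g"
  by (simp add: laurent_scale_def mult.assoc)

lemma laurent_scale_mult_right: "laurent_scale c (f * g) = f * laurent_scale c g"
  by (simp add: laurent_scale_def ac_simps)

abbreviation xmon :: "(nat \<times> nat \<Rightarrow>\<^sub>0 int) \<Rightarrow> 'k::field laurent" where
  "xmon m \<equiv> single m 1"

lemma xmon_mult: "xmon m * xmon m' = xmon (m + m')" by (simp add: mult_single)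

lemma laurent_as_sum: "f = (\<Sum>m\<in>keys f. laurent_scale (lookup f m) (xmon m))"
  by (rule poly_mapping_eqI)
     (simp add: lookup_sum lookup_laurent_scale lookup_single in_keys_iff when_def
        if_distrib[of "\<lambda>x. _ * x"] cong: if_cong)

lemma keys_xmon_mult: "keys (xmon e * f) \<subseteq> (+) e ` keys f"
  using keys_mult[of "xmon e" f] by auto

lemma lookup_xmon_mult: "lookup (xmon e * f) (e + m) = lookup f m"
proof -
  have "xmon e * f = (\<Sum>m\<in>keys f. single (e + m) (lookup f m))"
    by (subst laurent_as_sum[of f]) (simp add: sum_distrib_left laurent_scale_def mult_single)
  also have "lookup \<dots> (e + m) = lookup f m"
    by (simp add: lookup_sum lookup_single in_keys_iff when_def)
  finally show ?thesis .
qed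

definition gdeg :: "(nat \<Rightarrow> nat) \<Rightarrow> (nat \<times> nat \<Rightarrow>\<^sub>0 int) \<Rightarrow> nat \<Rightarrow> int" where
  "gdeg n m i = (\<Sum>j=0..n i. lookup m (i, j))"

text \<open>
  The exponents of the monomials of multidegree \<open>a\<close> in which only the variables in \<open>T\<close> may occur
  with negative exponents.
\<close>

definition exps :: "nat \<Rightarrow> (nat \<Rightarrow> nat) \<Rightarrow> (nat \<times> nat) set \<Rightarrow> (nat \<Rightarrow> int) \<Rightarrow> (nat \<times> nat \<Rightarrow>\<^sub>0 int) set" where
  "exps q n T a = {m. keys m \<subseteq> vars q n \<and> (\<forall>v. v \<notin> T \<longrightarrow> lookup m v \<ge> 0) \<and>
     (\<forall>i\<in>{1..q}. gdeg n m i = a i)}"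

text \<open>
  Forms (\<open>T = {}\<close>) and the elements of the chart rings (\<open>a = 0\<close>) are both instances, which allows
  one multiplication rule for all of them.
\<close>

definition lforms :: "nat \<Rightarrow> (nat \<Rightarrow> nat) \<Rightarrow> (nat \<times> nat) set \<Rightarrow> (nat \<Rightarrow> int) \<Rightarrow> 'k::field laurent set" where
  "lforms q n T a = {f. keys f \<subseteq> exps q n T a}"

lemma forms_eq_lforms: "forms q n a = lforms q n {} a"
  by (auto simp: forms_def coord_ring_def laurent_ring_def homogeneous_of_def lforms_def exps_def gdeg_def)

lemma affine_ring_eq_lforms: "affine_ring q n T = lforms q n T (\<lambda>_. 0)"
  by (auto simp: affine_ring_def laurent_ring_def homogeneous_of_def lforms_def exps_def gdeg_def)

lemma gdeg_add: "gdeg n (m + m') i = gdeg n m i + gdeg n m' i"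
  by (simp add: gdeg_def lookup_add sum.distrib)

lemma gdeg_diff: "gdeg n (m - m') i = gdeg n m i - gdeg n m' i"
  by (simp add: gdeg_def lookup_minus sum_subtractf)

lemma exps_add:
  assumes "m \<in> exps q n T a" "m' \<in> exps q n T' b" shows "m + m' \<in> exps q n (T \<union> T') (a + b)"
proof -
  have "keys (m + m') \<subseteq> vars q n"
    using keys_add[of m m'] assms by (auto simp: exps_def)
  thus ?thesis using assms unfolding exps_def by (simp add: lookup_add gdeg_add)
qed

lemma exps_cong: "\<lbrakk>m \<in> exps q n T a; T \<subseteq> T'; \<And>i. i \<in> {1..q} \<Longrightarrow> a i = b i\<rbrakk> \<Longrightarrow> m \<in> exps q n T' b"
  unfolding exps_def by simp blast

lemma lforms_cong: "\<lbrakk>f \<in> lforms q n T a; T \<subseteq> T'; \<And>i. i \<in> {1..q} \<Longrightarrow> a i = b i\<rbrakk> \<Longrightarrow> f \<in> lforms q n T' b"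
  using exps_cong[of _ q n T a T' b] by (simp add: lforms_def subset_iff)

lemma lforms_mult:
  "f \<in> lforms q n T a \<Longrightarrow> g \<in> lforms q n T' b \<Longrightarrow> f * g \<in> lforms q n (T \<union> T') (a + b)"
  using keys_mult[of f g] exps_add[of _ q n T a _ T' b] unfolding lforms_def by fast

lemma lforms_mult_cong:
  assumes "f \<in> lforms q n T a" "g \<in> lforms q n T' b" "T \<union> T' \<subseteq> T''" "\<And>i. i \<in> {1..q} \<Longrightarrow> a i + b i = c i"
  shows "f * g \<in> lforms q n T'' c"
  using lforms_cong[OF lforms_mult[OF assms(1,2)] assms(3)] assms(4) by simp

lemma lforms_subspace: "L.subspace (lforms q n T a :: 'k::field laurent set)"
proof (rule L.subspaceI)
  fix f g :: "'k laurent" assume "f \<in> lforms q n T a" "g \<in> lforms q n T a"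
  thus "f + g \<in> lforms q n T a" using keys_add[of f g] by (auto simp: lforms_def)
next
  fix c and f :: "'k laurent" assume "f \<in> lforms q n T a"
  moreover have "keys (laurent_scale c f) \<subseteq> keys f"
    by (auto simp: in_keys_iff lookup_laurent_scale)
  ultimately show "laurent_scale c f \<in> lforms q n T a" by (auto simp: lforms_def)
qed (simp add: lforms_def)

lemmas lforms_add = L.subspace_add[OF lforms_subspace]
  and lforms_scale = L.subspace_scale[OF lforms_subspace]
  and lforms_zero = L.subspace_0[OF lforms_subspace]
  and lforms_diff = L.subspace_diff[OF lforms_subspace]
  and lforms_sum = L.subspace_sum[OF lforms_subspace]

lemma xmon_in_lforms: "xmon m \<in> lforms q n T a \<longleftrightarrow> m \<in> exps q n T a"
  by (simp add: lforms_def)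

lemma lforms_subset_span: "(lforms q n T a :: 'k::field laurent set) \<subseteq> L.span (xmon ` exps q n T a)"
proof
  fix f :: "'k laurent" assume f: "f \<in> lforms q n T a"
  have "(\<Sum>m\<in>keys f. laurent_scale (lookup f m) (xmon m)) \<in> L.span (xmon ` exps q n T a)"
    using f by (intro L.span_sum L.span_scale L.span_base) (auto simp: lforms_def)
  thus "f \<in> L.span (xmon ` exps q n T a)" using laurent_as_sum[of f] by simp
qed

lemma one_in_lforms: "1 \<in> lforms q n T (\<lambda>_. 0)"
  by (simp add: lforms_def exps_def gdeg_def)

lemma const_in_lforms: "single 0 c \<in> lforms q n T (\<lambda>_. 0)"
  by (simp add: lforms_def exps_def gdeg_def)

text \<open>
  The exponent of the monomial that is the product of the powers \<open>x\<^sub>i\<^sub>,\<^sub>c\<^sub>i ^ a\<^sub>i\<close>.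
\<close>

definition cvec :: "nat \<Rightarrow> (nat \<Rightarrow> nat) \<Rightarrow> (nat \<Rightarrow> int) \<Rightarrow> (nat \<times> nat \<Rightarrow>\<^sub>0 int)" where
  "cvec q c a = (\<Sum>i=1..q. single (i, c i) (a i))"

lemma lookup_cvec: "lookup (cvec q c a) (i, j) = (if i \<in> {1..q} \<and> j = c i then a i else 0)"
proof -
  have "lookup (cvec q c a) (i, j) = (\<Sum>k=1..q. if k = i then (if j = c i then a i else 0) else 0)"
    unfolding cvec_def lookup_sum by (intro sum.cong) (auto simp: lookup_single when_def)
  thus ?thesis by (simp add: sum.delta)
qed

lemma cvec_add: "cvec q c a + cvec q c b = cvec q c (a + b)"
  by (rule poly_mapping_eqI) (auto simp: lookup_add lookup_cvec)

lemma cvec_cong: "(\<And>i. i \<in> {1..q} \<Longrightarrow> a i = b i) \<Longrightarrow> cvec q c a = cvec q c b"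
  unfolding cvec_def by (intro sum.cong) auto

lemma cvec_zero: "(\<And>i. i \<in> {1..q} \<Longrightarrow> a i = 0) \<Longrightarrow> cvec q c a = 0"
  unfolding cvec_def by (intro sum.neutral) auto

lemma dehomogenize_eq: "dehomogenize q a c f = xmon (cvec q c (\<lambda>i. - a i)) * f"
  by (simp add: dehomogenize_def cvec_def)

lemma gdeg_cvec: "c \<in> charts q n \<Longrightarrow> i \<in> {1..q} \<Longrightarrow> gdeg n (cvec q c a) i = a i"
  unfolding gdeg_def lookup_cvec by (auto simp: charts_def PiE_iff)

lemma keys_cvec: "c \<in> charts q n \<Longrightarrow> keys (cvec q c a) \<subseteq> vars q n \<inter> chart_vars q c"
  by (auto simp: in_keys_iff lookup_cvec vars_def chart_vars_def charts_def PiE_iff split: if_splits)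

lemma cvec_exps: "c \<in> charts q n \<Longrightarrow> cvec q c a \<in> exps q n (chart_vars q c) a"
  using keys_cvec[of c q n a] by (auto simp: exps_def gdeg_cvec lookup_cvec chart_vars_def)

lemma cvec_exps_nonneg:
  "c \<in> charts q n \<Longrightarrow> (\<And>i. i \<in> {1..q} \<Longrightarrow> 0 \<le> a i) \<Longrightarrow> cvec q c a \<in> exps q n T a"
  using keys_cvec[of c q n a] by (auto simp: exps_def gdeg_cvec lookup_cvec)

text \<open>
  The \<open>i\<close>-th standard basis vector of the group of multidegrees.
\<close>

definition udeg :: "nat \<Rightarrow> nat \<Rightarrow> int" where "udeg i = (\<lambda>k. if k = i then 1 else 0)"

lemma var_exps: "i \<in> {1..q} \<Longrightarrow> j \<le> n i \<Longrightarrow> single (i, j) 1 \<in> exps q n T (udeg i)"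
  by (auto simp: exps_def udeg_def gdeg_def vars_def lookup_single when_def)

lemma dehomogenize_in:
  "c \<in> charts q n \<Longrightarrow> f \<in> lforms q n T a \<Longrightarrow> dehomogenize q a c f \<in> lforms q n (T \<union> chart_vars q c) (\<lambda>_. 0)"
  unfolding dehomogenize_eq
  by (rule lforms_mult_cong[where a = "\<lambda>i. - a i" and b = a and T = "chart_vars q c" and T' = T])
     (auto simp: xmon_in_lforms cvec_exps)

lemma finite_exps: "finite (exps q n {} a)"
proof -
  let ?V = "vars q n"
  let ?r = "\<lambda>m. restrict (lookup m) ?V"
  have V: "finite ?V" by (simp add: vars_def)
  define M where "M = (\<Sum>i=1..q. \<bar>a i\<bar>)"
  have inj: "inj_on ?r (exps q n {} a)"
  proof (rule inj_onI)
    fix m m' assume m: "m \<in> exps q n {} a" "m' \<in> exps q n {} a" "?r m = ?r m'"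
    show "m = m'"
    proof (rule poly_mapping_eqI)
      fix v show "lookup m v = lookup m' v"
      proof (cases "v \<in> ?V")
        case True thus ?thesis using fun_cong[OF m(3), of v] by simp
      next
        case False
        hence "v \<notin> keys m" "v \<notin> keys m'" using m by (auto simp: exps_def)
        thus ?thesis by (simp add: in_keys_iff)
      qed
    qed
  qed
  have "lookup m v \<in> {0..M}" if m: "m \<in> exps q n {} a" and v: "v \<in> ?V" for m v
  proof -
    obtain i j where ij: "v = (i, j)" "i \<in> {1..q}" "j \<le> n i" using v by (auto simp: vars_def)
    have "lookup m v \<le> (\<Sum>j=0..n i. lookup m (i, j))"
      unfolding ij(1) using m ij(3) by (intro member_le_sum) (auto simp: exps_def)
    also have "\<dots> = a i" using m ij(2) by (auto simp: exps_def gdeg_def)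
    also have "\<dots> \<le> \<bar>a i\<bar>" by simp
    also have "\<dots> \<le> M" unfolding M_def using ij(2) by (intro member_le_sum) auto
    finally show ?thesis using m by (auto simp: exps_def ij(1))
  qed
  hence "?r ` exps q n {} a \<subseteq> PiE ?V (\<lambda>_. {0..M})" by auto
  moreover have "finite (PiE ?V (\<lambda>_. {0..M}))" by (intro finite_PiE V) auto
  ultimately show ?thesis using inj finite_imageD finite_subset by blast
qed

text \<open>
  Only the values on \<open>{1..q}\<close> of a multidegree matter, hence the case \<open>cong\<close>.
\<close>

lemma multidegree_induct [consumes 1, case_names cong zero step]:
  assumes nonneg: "\<forall>i\<in>{1..q}. 0 \<le> a i"
    and cong: "\<And>a b. \<forall>i\<in>{1..q}. a i = b i \<Longrightarrow> P a \<Longrightarrow> P b"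
    and zero: "P (\<lambda>_. 0)"
    and step: "\<And>a i. \<forall>k\<in>{1..q}. 0 \<le> a k \<Longrightarrow> i \<in> {1..q} \<Longrightarrow> P a \<Longrightarrow> P (a + udeg i)"
  shows "P (a :: nat \<Rightarrow> int)"
  using nonneg
proof (induction "nat (\<Sum>i=1..q. a i)" arbitrary: a)
  case 0
  hence "(\<Sum>i=1..q. a i) = 0" using sum_nonneg[of "{1..q}" a] by simp
  hence "\<forall>i\<in>{1..q}. a i = 0" using 0(2) sum_nonneg_eq_0_iff[of "{1..q}" a] by simp
  thus ?case using cong[OF _ zero] by simp
next
  case (Suc k)
  hence "(\<Sum>i=1..q. a i) \<noteq> 0" by auto
  then obtain i where i: "i \<in> {1..q}" "a i \<noteq> 0" by (meson sum.neutral)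
  hence ai: "a i \<ge> 1" using bspec[OF Suc(3) i(1)] by linarith
  let ?b = "a - udeg i"
  have nn: "0 \<le> ?b k" if "k \<in> {1..q}" for k using bspec[OF Suc(3) that] ai by (simp add: udeg_def)
  have "(\<Sum>k=1..q. ?b k) = (\<Sum>k=1..q. a k) - (\<Sum>k=1..q. if k = i then 1 else 0)"
    by (simp add: udeg_def sum_subtractf)
  also have "\<dots> = (\<Sum>k=1..q. a k) - 1" using i(1) by (simp add: sum.delta)
  finally have "P ?b" using Suc(2) nn by (intro Suc(1)) auto
  with step[of ?b i] nn i(1) show ?case by simp
qed

lemma exps_split_var:
  assumes m: "m \<in> exps q n {} (a + udeg i)" and i: "i \<in> {1..q}" and a: "0 \<le> a i"
  obtains j where "j \<le> n i" "m - single (i, j) 1 \<in> exps q n {} a"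
proof -
  have "(\<Sum>j=0..n i. lookup m (i, j)) > 0"
    using m i a by (auto simp: exps_def gdeg_def udeg_def)
  then obtain j where j: "j \<in> {0..n i}" "lookup m (i, j) > 0"
    by (meson not_less sum_nonpos)
  have "keys (m - single (i, j) 1) \<subseteq> vars q n"
    using keys_diff[of m "single (i, j) 1"] m i j(1) by (auto simp: exps_def vars_def split: if_splits)
  moreover have "single (i, j) 1 \<in> exps q n {} (udeg i)" using var_exps[OF i] j by simp
  hence "gdeg n (m - single (i, j) 1) k = a k" if "k \<in> {1..q}" for k
    using m that by (auto simp: exps_def gdeg_diff)
  ultimately have "m - single (i, j) 1 \<in> exps q n {} a"
    using m j by (auto simp: exps_def lookup_minus lookup_single when_def)
  thus ?thesis using that j(1) by simp
qed

text \<open>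
  A monomial of multidegree \<open>a + b\<close> is a product of monomials of multidegrees \<open>a\<close> and \<open>b\<close>: take away
  one variable at a time.
\<close>

lemma exps_split:
  assumes "m \<in> exps q n {} (a + b)" "\<And>i. i \<in> {1..q} \<Longrightarrow> 0 \<le> a i" "\<And>i. i \<in> {1..q} \<Longrightarrow> 0 \<le> b i"
  obtains m1 m2 where "m1 \<in> exps q n {} a" "m2 \<in> exps q n {} b" "m = m1 + m2"
proof -
  have b: "\<forall>i\<in>{1..q}. 0 \<le> b i" using assms(3) by blast
  have "\<forall>m\<in>exps q n {} (a + b). \<exists>m1\<in>exps q n {} a. m - m1 \<in> exps q n {} b"
    using b
  proof (induction b rule: multidegree_induct)
    case (cong b b')
    show ?case
    proof
      fix m assume "m \<in> exps q n {} (a + b')"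
      hence "m \<in> exps q n {} (a + b)" using exps_cong[of m q n "{}" "a + b'" "{}" "a + b"] cong(1) by simp
      then obtain m1 where "m1 \<in> exps q n {} a" "m - m1 \<in> exps q n {} b" using cong(2) by blast
      thus "\<exists>m1\<in>exps q n {} a. m - m1 \<in> exps q n {} b'"
        using exps_cong[of "m - m1" q n "{}" b "{}" b'] cong(1) by auto
    qed
  next
    case zero
    show ?case
    proof
      fix m assume "m \<in> exps q n {} (a + (\<lambda>_. 0))"
      hence "m \<in> exps q n {} a" by (rule exps_cong) auto
      moreover have "m - m \<in> exps q n {} (\<lambda>_. 0)" by (simp add: exps_def gdeg_def)
      ultimately show "\<exists>m1\<in>exps q n {} a. m - m1 \<in> exps q n {} (\<lambda>_. 0)" by blast
    qed
  next
    case (step b i)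
    show ?case
    proof
      fix m assume "m \<in> exps q n {} (a + (b + udeg i))"
      hence m: "m \<in> exps q n {} (a + b + udeg i)" by (simp add: add.assoc)
      have "0 \<le> (a + b) i" using step assms(2) by simp
      then obtain j where j: "j \<le> n i" "m - single (i, j) 1 \<in> exps q n {} (a + b)"
        using exps_split_var[OF m step(2)] by metis
      then obtain m1 where m1: "m1 \<in> exps q n {} a" "m - single (i, j) 1 - m1 \<in> exps q n {} b"
        using step(3) by blast
      have "m - single (i, j) 1 - m1 + single (i, j) 1 \<in> exps q n ({} \<union> {}) (b + udeg i)"
        by (intro exps_add m1 var_exps step j)
      hence "m - m1 \<in> exps q n {} (b + udeg i)" by (simp add: algebra_simps)
      thus "\<exists>m1\<in>exps q n {} a. m - m1 \<in> exps q n {} (b + udeg i)" using m1(1) by blast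
    qed
  qed
  then obtain m1 where "m1 \<in> exps q n {} a" "m - m1 \<in> exps q n {} b" using assms(1) by blast
  thus ?thesis using that[of m1 "m - m1"] by simp
qed

lemma clear_denominators:
  assumes f: "f \<in> lforms q n (T \<union> chart_vars q d) a" and d: "d \<in> charts q n"
  obtains K where "\<And>k. k \<ge> K \<Longrightarrow> xmon (cvec q d (\<lambda>_. int k)) * f \<in> lforms q n T (\<lambda>i. a i + int k)"
proof -
  \<comment> \<open>Any common bound for the finitely many negative exponents will do.\<close>
  define K where "K = (\<Sum>m\<in>keys f. \<Sum>i=1..q. nat (- lookup m (i, d i)))"
  have K: "- lookup m (i, d i) \<le> int K" if m: "m \<in> keys f" and i: "i \<in> {1..q}" for m i
  proof -
    have "nat (- lookup m (i, d i)) \<le> (\<Sum>i=1..q. nat (- lookup m (i, d i)))"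
      using i by (intro member_le_sum) auto
    also have "\<dots> \<le> K" unfolding K_def using m by (intro member_le_sum[where f = "\<lambda>m. \<Sum>i=1..q. nat (- lookup m (i, d i))"]) auto
    finally show ?thesis by linarith
  qed
  show ?thesis
  proof (rule that)
    fix k assume k: "k \<ge> K"
    let ?c = "cvec q d (\<lambda>_. int k)"
    have "?c + m \<in> exps q n T (\<lambda>i. a i + int k)" if m: "m \<in> keys f" for m
    proof -
      have mE: "m \<in> exps q n (T \<union> chart_vars q d) a" using f m by (auto simp: lforms_def)
      have "?c + m \<in> exps q n (chart_vars q d \<union> (T \<union> chart_vars q d)) ((\<lambda>_. int k) + a)"
        by (intro exps_add cvec_exps d mE)
      moreover have "lookup (?c + m) v \<ge> 0" if v: "v \<notin> T" for v
      proof (cases "v \<in> chart_vars q d")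
        case True
        then obtain i where i: "i \<in> {1..q}" "v = (i, d i)" by (auto simp: chart_vars_def)
        thus ?thesis using K[OF m i(1)] k by (simp add: lookup_add lookup_cvec)
      next
        case False
        hence "lookup m v \<ge> 0" using mE v unfolding exps_def by blast
        thus ?thesis by (cases v) (auto simp: lookup_add lookup_cvec)
      qed
      ultimately show ?thesis by (auto simp: exps_def)
    qed
    thus "xmon ?c * f \<in> lforms q n T (\<lambda>i. a i + int k)"
      using keys_xmon_mult[of ?c f] by (auto simp: lforms_def)
  qed
qed

section \<open>Ideal sheaves and vanishing forms\<close>

text \<open>
  The \<open>k\<close>-th power of the function \<open>x\<^sub>d / x\<^sub>c\<close> on the chart \<open>c\<close>, where \<open>x\<^sub>c\<close> is the product of the
  variables of that chart. The overlap with the chart \<open>d\<close> is the locus where it does not vanish.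
\<close>

definition ratio :: "nat \<Rightarrow> (nat \<Rightarrow> nat) \<Rightarrow> (nat \<Rightarrow> nat) \<Rightarrow> nat \<Rightarrow> 'k::field laurent" where
  "ratio q d c k = xmon (cvec q d (\<lambda>_. int k) + cvec q c (\<lambda>_. - int k))"

lemma ratio_mult: "ratio q d c k * ratio q d c l = ratio q d c (k + l)"
proof -
  have "cvec q d (\<lambda>_. int k) + cvec q c (\<lambda>_. - int k) + (cvec q d (\<lambda>_. int l) + cvec q c (\<lambda>_. - int l))
    = (cvec q d (\<lambda>_. int k) + cvec q d (\<lambda>_. int l)) + (cvec q c (\<lambda>_. - int k) + cvec q c (\<lambda>_. - int l))"
    by (simp add: algebra_simps)
  also have "\<dots> = cvec q d (\<lambda>_. int (k + l)) + cvec q c (\<lambda>_. - int (k + l))"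
    unfolding cvec_add by (intro arg_cong2[where f = "(+)"] cvec_cong) auto
  finally show ?thesis by (simp add: ratio_def xmon_mult)
qed

lemma ratio_in_chart_ring:
  "c \<in> charts q n \<Longrightarrow> d \<in> charts q n \<Longrightarrow> ratio q d c k \<in> chart_ring q n c"
  unfolding ratio_def affine_ring_eq_lforms xmon_in_lforms
  by (rule exps_cong[OF exps_add[OF cvec_exps_nonneg[where T = "{}"] cvec_exps]]) auto

lemma ideal_generated_is_ideal:
  assumes A: "is_ideal A A" and G: "G \<subseteq> A"
  shows "is_ideal A (ideal_generated A G)"
proof -
  have "ideal_generated A G \<subseteq> A"
    unfolding ideal_generated_def using hull_minimal[of G A "is_ideal A"] G A by simp
  thus ?thesis
    unfolding ideal_generated_def hull_def is_ideal_def by auto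
qed

lemma is_ideal_affine_ring: "is_ideal (affine_ring q n T) (affine_ring q n T)"
  unfolding is_ideal_def affine_ring_eq_lforms
  by (auto simp: lforms_zero lforms_add intro!: lforms_mult_cong[of _ q n T _ _ T])

lemma finite_charts: "finite (charts q n)"
  unfolding charts_def by (intro finite_PiE) auto

lemma homogeneous_degree_unique:
  "f \<noteq> 0 \<Longrightarrow> f \<in> lforms q n T a \<Longrightarrow> f \<in> lforms q n T' b \<Longrightarrow> i \<in> {1..q} \<Longrightarrow> a i = b i"
proof -
  assume *: "f \<noteq> 0" "f \<in> lforms q n T a" "f \<in> lforms q n T' b" "i \<in> {1..q}"
  then obtain m where m: "m \<in> keys f" by fastforce
  hence "m \<in> exps q n T a" "m \<in> exps q n T' b" using * by (auto simp: lforms_def)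
  thus "a i = b i" using *(4) by (simp add: exps_def)
qed

locale subscheme =
  fixes q :: nat and n :: "nat \<Rightarrow> nat" and X :: "'k::field ideal_sheaf"
  assumes closed: "closed_subscheme q n X"
begin

abbreviation R :: "(nat \<Rightarrow> nat) \<Rightarrow> 'k laurent set" where "R c \<equiv> chart_ring q n c"
abbreviation V :: "(nat \<Rightarrow> int) \<Rightarrow> 'k laurent set" where "V a \<equiv> vanishing_forms q n X a"

lemma X_ideal: "c \<in> charts q n \<Longrightarrow> is_ideal (R c) (X c)"
  using closed by (simp add: closed_subscheme_def)

lemma X_subset: "c \<in> charts q n \<Longrightarrow> X c \<subseteq> R c"
  and X_mult: "c \<in> charts q n \<Longrightarrow> r \<in> R c \<Longrightarrow> x \<in> X c \<Longrightarrow> r * x \<in> X c"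
  and X_zero: "c \<in> charts q n \<Longrightarrow> 0 \<in> X c"
  and X_add: "c \<in> charts q n \<Longrightarrow> x \<in> X c \<Longrightarrow> y \<in> X c \<Longrightarrow> x + y \<in> X c"
  using X_ideal by (auto simp: is_ideal_def)

lemma R_mult: "r \<in> R c \<Longrightarrow> s \<in> R c \<Longrightarrow> r * s \<in> R c"
  unfolding affine_ring_eq_lforms by (erule lforms_mult_cong) auto

lemma R_subspace: "L.subspace (R c)" unfolding affine_ring_eq_lforms by (rule lforms_subspace)

lemma R_const: "single 0 k \<in> R c"
  unfolding affine_ring_eq_lforms by (rule const_in_lforms)

lemma R_one: "1 \<in> R c" using R_const[of 1] by simp

lemma X_subspace: "c \<in> charts q n \<Longrightarrow> L.subspace (X c)"
  by (rule L.subspaceI) (auto simp: X_zero X_add laurent_scale_def X_mult R_const)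

lemma overlap_X:
  assumes "c \<in> charts q n" "d \<in> charts q n"
  shows "is_ideal (overlap_ring q n c d) (ideal_generated (overlap_ring q n c d) (X c))"
proof (rule ideal_generated_is_ideal[OF is_ideal_affine_ring])
  have "R c \<subseteq> overlap_ring q n c d"
    unfolding affine_ring_eq_lforms by (auto elim!: lforms_cong)
  thus "X c \<subseteq> overlap_ring q n c d" using X_subset[OF assms(1)] by blast
qed

lemma overlap_X_sym:
  "c \<in> charts q n \<Longrightarrow> d \<in> charts q n \<Longrightarrow>
    ideal_generated (overlap_ring q n c d) (X c) = ideal_generated (overlap_ring q n c d) (X d)"
  using closed unfolding closed_subscheme_def by blast

lemma X_subset_overlap_X: "X c \<subseteq> ideal_generated A (X c)"
  unfolding ideal_generated_def by (rule hull_subset)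

text \<open>
  The extension of \<open>X c\<close> to the overlap is a localization: the elements that a power of
  \<open>x\<^sub>d / x\<^sub>c\<close> carries into \<open>X c\<close> form an ideal of the overlap ring.
\<close>

lemma overlap_X_clear:
  assumes c: "c \<in> charts q n" and d: "d \<in> charts q n"
    and g: "g \<in> ideal_generated (overlap_ring q n c d) (X c)"
  shows "\<exists>K. \<forall>k\<ge>K. ratio q d c k * g \<in> X c"
proof -
  let ?O = "overlap_ring q n c d" and ?u = "ratio q d c :: nat \<Rightarrow> 'k laurent"
  let ?J = "{g \<in> ?O. \<exists>K. \<forall>k\<ge>K. ?u k * g \<in> X c}"
  have "is_ideal ?O ?J"
    unfolding is_ideal_def
  proof (intro conjI ballI)
    show "0 \<in> ?J" using X_zero[OF c] lforms_zero by (auto simp: affine_ring_eq_lforms)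
  next
    fix x y assume x: "x \<in> ?J" and y: "y \<in> ?J"
    then obtain K K' where K: "\<forall>k\<ge>K. ?u k * x \<in> X c" "\<forall>k\<ge>K'. ?u k * y \<in> X c" by auto
    have "\<forall>k\<ge>max K K'. ?u k * (x + y) \<in> X c"
      using K by (auto simp: distrib_left intro!: X_add[OF c])
    moreover have "x + y \<in> ?O" using x y is_ideal_affine_ring unfolding is_ideal_def by blast
    ultimately show "x + y \<in> ?J" by blast
  next
    fix r x :: "'k laurent" assume r: "r \<in> ?O" and x: "x \<in> ?J"
    then obtain K where K: "\<And>k. k \<ge> K \<Longrightarrow> ?u k * x \<in> X c" by auto
    obtain K' where K': "\<And>k. k \<ge> K' \<Longrightarrow> xmon (cvec q d (\<lambda>_. int k)) * r \<in> lforms q n (chart_vars q c) (\<lambda>i. 0 + int k)"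
      using clear_denominators[OF _ d, of r "chart_vars q c" "\<lambda>_. 0"] r unfolding affine_ring_eq_lforms by metis
    have ur: "?u K' * r \<in> R c"
    proof -
      have "?u K' * r = xmon (cvec q c (\<lambda>_. - int K')) * (xmon (cvec q d (\<lambda>_. int K')) * r)"
        by (simp add: ratio_def flip: xmon_mult)
      also have "\<dots> \<in> R c"
        unfolding affine_ring_eq_lforms
        by (rule lforms_mult_cong[OF _ K'[OF order_refl], of _ "chart_vars q c" "\<lambda>_. - int K'"])
           (auto simp: xmon_in_lforms cvec_exps c)
      finally show ?thesis .
    qed
    have "?u k * (r * x) \<in> X c" if k: "k \<ge> K + K'" for k
    proof -
      have "?u k = ?u K' * ?u (k - K')" using k by (simp add: ratio_mult)
      hence "?u k * (r * x) = (?u K' * r) * (?u (k - K') * x)" by (simp add: ac_simps)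
      thus ?thesis using X_mult[OF c ur K[of "k - K'"]] k by simp
    qed
    moreover have "r * x \<in> ?O" using r x is_ideal_affine_ring unfolding is_ideal_def by blast
    ultimately show "r * x \<in> ?J" by blast
  qed auto
  moreover have "X c \<subseteq> ?J"
  proof
    fix x assume x: "x \<in> X c"
    hence "x \<in> ?O" using overlap_X[OF c d] X_subset_overlap_X[of c ?O] unfolding is_ideal_def by blast
    thus "x \<in> ?J" using X_mult[OF c ratio_in_chart_ring[OF c d] x] by blast
  qed
  ultimately have "ideal_generated ?O (X c) \<subseteq> ?J"
    unfolding ideal_generated_def by (intro hull_minimal)
  thus ?thesis using g by blast
qed

text \<open>
  A power of \<open>x\<^sub>d\<close> clears the denominators of \<open>f\<close>. Dehomogenizing the resulting form in another chart \<open>c\<close>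
  gives \<open>f\<close> times a power of \<open>x\<^sub>d / x\<^sub>c\<close>, which lies in \<open>X c\<close> for a large power because the ideals
  agree on the overlap. There are finitely many charts.
\<close>

lemma clear_to_vanishing_form:
  assumes d: "d \<in> charts q n" and f: "f \<in> X d"
  shows "\<exists>K. \<forall>k\<ge>K. xmon (cvec q d (\<lambda>_. int k)) * f \<in> V (\<lambda>_. int k)"
proof -
  have "\<forall>c\<in>charts q n. \<exists>K. \<forall>k\<ge>K. ratio q d c k * f \<in> X c"
    using overlap_X_clear[OF _ d] overlap_X_sym[OF _ d] X_subset_overlap_X f by blast
  then obtain K where K: "\<And>c k. c \<in> charts q n \<Longrightarrow> k \<ge> K c \<Longrightarrow> ratio q d c k * f \<in> X c" by metis
  obtain K' where K': "\<And>k. k \<ge> K' \<Longrightarrow> xmon (cvec q d (\<lambda>_. int k)) * f \<in> lforms q n {} (\<lambda>i. 0 + int k)"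
    using clear_denominators[OF _ d, of f "{}" "\<lambda>_. 0"] X_subset[OF d] f
    unfolding affine_ring_eq_lforms by auto
  show ?thesis
  proof (intro exI[of _ "K' + Max (K ` charts q n)"] allI impI)
    fix k assume k: "k \<ge> K' + Max (K ` charts q n)"
    have "dehomogenize q (\<lambda>_. int k) c (xmon (cvec q d (\<lambda>_. int k)) * f) \<in> X c" if c: "c \<in> charts q n" for c
    proof -
      have "dehomogenize q (\<lambda>_. int k) c (xmon (cvec q d (\<lambda>_. int k)) * f) = ratio q d c k * f"
        by (simp add: dehomogenize_eq ratio_def ac_simps flip: xmon_mult)
      moreover have "K c \<le> Max (K ` charts q n)" using finite_charts c by (intro Max_ge) auto
      ultimately show ?thesis using K[OF c, of k] k by simp
    qed
    thus "xmon (cvec q d (\<lambda>_. int k)) * f \<in> V (\<lambda>_. int k)"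
      using K'[of k] k by (auto simp: vanishing_forms_def forms_eq_lforms)
  qed
qed

lemma dehomogenize_cong:
  "(\<And>i. i \<in> {1..q} \<Longrightarrow> a i = b i) \<Longrightarrow> dehomogenize q a c f = dehomogenize q b c f"
  unfolding dehomogenize_eq using cvec_cong[of q "\<lambda>i. - a i" "\<lambda>i. - b i" c] by simp

lemma dehomogenize_mult:
  "dehomogenize q (a + b) c (f * g) = dehomogenize q a c f * dehomogenize q b c g"
proof -
  have "cvec q c (\<lambda>i. - (a + b) i) = cvec q c (\<lambda>i. - a i) + cvec q c (\<lambda>i. - b i)"
    unfolding cvec_add by (rule cvec_cong) simp
  thus ?thesis by (simp add: dehomogenize_eq ac_simps flip: xmon_mult)
qed

lemma V_cong: "f \<in> V a \<Longrightarrow> (\<And>i. i \<in> {1..q} \<Longrightarrow> a i = b i) \<Longrightarrow> f \<in> V b"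
  unfolding vanishing_forms_def forms_eq_lforms using lforms_cong[of f q n "{}" a "{}" b] dehomogenize_cong[of b a _ f]
  by simp

lemma V_subspace: "L.subspace (V a)"
proof (rule L.subspaceI)
  show "0 \<in> V a" using X_zero by (simp add: vanishing_forms_def forms_eq_lforms lforms_zero dehomogenize_eq)
next
  fix f g assume "f \<in> V a" "g \<in> V a"
  thus "f + g \<in> V a"
    using X_add by (simp add: vanishing_forms_def forms_eq_lforms lforms_add dehomogenize_eq distrib_left)
next
  fix c f assume "f \<in> V a"
  thus "laurent_scale c f \<in> V a"
    using L.subspace_scale[OF X_subspace]
    by (simp add: vanishing_forms_def forms_eq_lforms lforms_scale dehomogenize_eq flip: laurent_scale_mult_right)
qed

lemma V_mult: "r \<in> forms q n b \<Longrightarrow> f \<in> V a \<Longrightarrow> r * f \<in> V (b + a)"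
  unfolding vanishing_forms_def forms_eq_lforms dehomogenize_mult
  using lforms_mult[of r q n "{}" b f "{}" a] dehomogenize_in[of _ q n r "{}" b] X_mult
  by (auto simp: dehomogenize_mult affine_ring_eq_lforms)

text \<open>
  The part of a Laurent polynomial supported on \<open>M\<close>; for \<open>M = exps q n {} a\<close> it is the homogeneous
  component of multidegree \<open>a\<close>.
\<close>

definition restr :: "(nat \<times> nat \<Rightarrow>\<^sub>0 int) set \<Rightarrow> 'k laurent \<Rightarrow> 'k laurent" where
  "restr M f = (\<Sum>m\<in>keys f \<inter> M. single m (lookup f m))"

lemma lookup_restr: "lookup (restr M f) m = (if m \<in> M then lookup f m else 0)"
  unfolding restr_def lookup_sum lookup_single when_def by (simp add: in_keys_iff)

lemma restr_add: "restr M (f + g) = restr M f + restr M g"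
  by (rule poly_mapping_eqI) (simp add: lookup_restr lookup_add)

lemma restr_scale: "restr M (laurent_scale c f) = laurent_scale c (restr M f)"
  by (rule poly_mapping_eqI) (simp add: lookup_restr lookup_laurent_scale)

text \<open>
  Elements whose components all vanish on \<open>X\<close> form an ideal, which therefore contains \<open>ideal_of\<close>.
\<close>

definition comp_vanishing :: "'k laurent set" where
  "comp_vanishing = {f \<in> coord_ring q n. \<forall>a. restr (exps q n {} a) f \<in> V a}"

lemma restr_monomial_mult:
  assumes m: "m \<in> exps q n {} b" and f: "f \<in> coord_ring q n"
  shows "restr (exps q n {} a) (xmon m * f) = xmon m * restr (exps q n {} (a - b)) f"
proof (rule poly_mapping_eqI)
  fix k
  have l: "lookup (xmon m * g) k = lookup g (k - m)" for g :: "'k laurent"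
    using lookup_xmon_mult[of m g "k - m"] by simp
  show "lookup (restr (exps q n {} a) (xmon m * f)) k =
      lookup (xmon m * restr (exps q n {} (a - b)) f) k"
  proof (cases "lookup f (k - m) = 0")
    case False
    hence km: "k - m \<in> keys f" by (simp add: in_keys_iff)
    have "k \<in> exps q n {} a \<longleftrightarrow> k - m \<in> exps q n {} (a - b)"
    proof
      assume "k \<in> exps q n {} a"
      thus "k - m \<in> exps q n {} (a - b)"
        using km f m unfolding coord_ring_def laurent_ring_def exps_def by (simp add: gdeg_diff)
    next
      assume "k - m \<in> exps q n {} (a - b)"
      from exps_add[OF this m] show "k \<in> exps q n {} a" by simp
    qed
    thus ?thesis by (simp add: lookup_restr l)
  qed (simp add: lookup_restr l)
qed

lemma comp_vanishing_zero: "0 \<in> comp_vanishing"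
  using L.subspace_0[OF V_subspace] by (simp add: comp_vanishing_def coord_ring_def laurent_ring_def restr_def)

lemma comp_vanishing_add:
  assumes "x \<in> comp_vanishing" "y \<in> comp_vanishing" shows "x + y \<in> comp_vanishing"
proof -
  have "x + y \<in> coord_ring q n"
    using assms keys_add[of x y] unfolding comp_vanishing_def coord_ring_def laurent_ring_def by blast
  thus ?thesis using assms L.subspace_add[OF V_subspace] by (simp add: comp_vanishing_def restr_add)
qed

lemma comp_vanishing_ideal: "is_ideal (coord_ring q n) comp_vanishing"
  unfolding is_ideal_def
proof (intro conjI ballI)
  show "comp_vanishing \<subseteq> coord_ring q n" by (auto simp: comp_vanishing_def)
  show "0 \<in> comp_vanishing" by (rule comp_vanishing_zero)
  fix x y assume "x \<in> comp_vanishing" "y \<in> comp_vanishing" thus "x + y \<in> comp_vanishing" by (rule comp_vanishing_add)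
next
  fix r f :: "'k laurent" assume r: "r \<in> coord_ring q n" and f: "f \<in> comp_vanishing"
  have step: "laurent_scale c (xmon m * f) \<in> comp_vanishing" if m: "m \<in> keys r" for m c
  proof -
    have mE: "m \<in> exps q n {} (gdeg n m)"
      using m r by (auto simp: coord_ring_def laurent_ring_def exps_def)
    have "restr (exps q n {} a) (laurent_scale c (xmon m * f)) \<in> V a" for a
    proof -
      have fc: "f \<in> coord_ring q n" using f by (simp add: comp_vanishing_def)
      have "xmon m * restr (exps q n {} (a - gdeg n m)) f \<in> V (gdeg n m + (a - gdeg n m))"
        using f by (intro V_mult) (auto simp: forms_eq_lforms xmon_in_lforms mE comp_vanishing_def)
      thus ?thesis
        using L.subspace_scale[OF V_subspace] by (simp add: restr_scale restr_monomial_mult[OF mE fc])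
    qed
    moreover have "laurent_scale c (xmon m * f) \<in> coord_ring q n"
      unfolding coord_ring_def laurent_ring_def
    proof (intro CollectI ballI)
      fix k assume "k \<in> keys (laurent_scale c (xmon m * f))"
      hence "k \<in> keys (xmon m * f)" by (auto simp: in_keys_iff lookup_laurent_scale)
      then obtain k' where k': "k = m + k'" "k' \<in> keys f" using keys_xmon_mult by blast
      have "k' \<in> exps q n {} (gdeg n k')"
        using k'(2) f by (auto simp: comp_vanishing_def coord_ring_def laurent_ring_def exps_def)
      from exps_add[OF mE this] show "keys k \<subseteq> vars q n \<and> (\<forall>v. v \<notin> {} \<longrightarrow> 0 \<le> lookup k v)"
        unfolding k'(1) exps_def by blast
    qed
    ultimately show ?thesis by (simp add: comp_vanishing_def)
  qed
  have "r * f = (\<Sum>m\<in>keys r. laurent_scale (lookup r m) (xmon m * f))"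
    by (subst laurent_as_sum[of r]) (simp add: sum_distrib_right laurent_scale_mult_left)
  moreover have "(\<Sum>m\<in>M. laurent_scale (lookup r m) (xmon m * f)) \<in> comp_vanishing"
    if "M \<subseteq> keys r" for M
    using finite_subset[OF that finite_keys] that
    by (induction M rule: finite_induct) (auto intro!: comp_vanishing_add step comp_vanishing_zero)
  ultimately show "r * f \<in> comp_vanishing" by simp
qed

lemma restr_self: "f \<in> lforms q n {} a \<Longrightarrow> restr (exps q n {} a) f = f"
  by (rule poly_mapping_eqI) (auto simp: lookup_restr lforms_def in_keys_iff)

lemma V_subset_comp_vanishing: "V a \<subseteq> comp_vanishing"
proof
  fix f assume f: "f \<in> V a"
  hence fl: "f \<in> lforms q n {} a" by (simp add: vanishing_forms_def forms_eq_lforms)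
  have "restr (exps q n {} b) f \<in> V b" for b
  proof (cases "\<forall>i\<in>{1..q}. a i = b i")
    case True
    hence "f \<in> lforms q n {} b" using lforms_cong[OF fl] by auto
    thus ?thesis using restr_self V_cong[OF f] True by simp
  next
    case False
    then obtain i where "i \<in> {1..q}" "a i \<noteq> b i" by blast
    hence "keys f \<inter> exps q n {} b = {}" using fl by (force simp: lforms_def exps_def)
    thus ?thesis using L.subspace_0[OF V_subspace] by (simp add: restr_def)
  qed
  moreover have "f \<in> coord_ring q n" using f by (simp add: vanishing_forms_def forms_def)
  ultimately show "f \<in> comp_vanishing" by (simp add: comp_vanishing_def)
qed

text \<open>
  A form is its own homogeneous component, so it lies in \<open>comp_vanishing\<close> only if it vanishes on \<open>X\<close>.
\<close>

theorem ideal_of_forms: "ideal_of q n X \<inter> forms q n a = V a"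
proof (intro subset_antisym subsetI IntI)
  fix f assume f: "f \<in> ideal_of q n X \<inter> forms q n a"
  have "ideal_of q n X \<subseteq> comp_vanishing"
    unfolding ideal_of_def ideal_generated_def
    by (rule hull_minimal) (use V_subset_comp_vanishing comp_vanishing_ideal in auto)
  hence "restr (exps q n {} a) f \<in> V a" using f by (auto simp: comp_vanishing_def)
  thus "f \<in> V a" using f restr_self[of f a] by (simp add: forms_eq_lforms)
next
  fix f assume f: "f \<in> V a"
  hence "f \<in> V (restrict a {1..q})" by (rule V_cong) simp
  moreover have "restrict a {1..q} \<in> multidegrees q" by (simp add: multidegrees_def)
  ultimately have "f \<in> (\<Union>a\<in>multidegrees q. V a)" by blast
  thus "f \<in> ideal_of q n X"
    unfolding ideal_of_def ideal_generated_def by (rule hull_inc)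
qed (simp add: vanishing_forms_def)

end

section \<open>Homogeneous prime ideals\<close>

text \<open>
  Homogeneous ideals are represented by their sets of homogeneous elements. The element \<open>0\<close> is homogeneous of every multidegree.
\<close>

definition graded_ideal :: "nat \<Rightarrow> (nat \<Rightarrow> nat) \<Rightarrow> 'k::field laurent set \<Rightarrow> bool" where
  "graded_ideal q n H \<longleftrightarrow> H \<subseteq> (\<Union>a. forms q n a) \<and> 0 \<in> H \<and>
     (\<forall>a. \<forall>f\<in>H \<inter> forms q n a. \<forall>g\<in>H \<inter> forms q n a. f + g \<in> H) \<and>
     (\<forall>b. \<forall>r\<in>forms q n b. \<forall>f\<in>H. r * f \<in> H)"

lemma graded_ideal_add:
  "graded_ideal q n H \<Longrightarrow> f \<in> H \<Longrightarrow> g \<in> H \<Longrightarrow> f \<in> forms q n a \<Longrightarrow> g \<in> forms q n a \<Longrightarrow> f + g \<in> H"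
  unfolding graded_ideal_def by blast

lemma graded_ideal_mult: "graded_ideal q n H \<Longrightarrow> r \<in> forms q n b \<Longrightarrow> f \<in> H \<Longrightarrow> r * f \<in> H"
  unfolding graded_ideal_def by blast

lemma graded_ideal_zero: "graded_ideal q n H \<Longrightarrow> 0 \<in> H"
  unfolding graded_ideal_def by blast

lemma graded_ideal_degree: "graded_ideal q n H \<Longrightarrow> f \<in> H \<Longrightarrow> \<exists>a. f \<in> forms q n a"
  unfolding graded_ideal_def by blast

lemma forms_mult: "f \<in> forms q n a \<Longrightarrow> g \<in> forms q n b \<Longrightarrow> f * g \<in> forms q n (a + b)"
  unfolding forms_eq_lforms using lforms_mult[of f q n "{}" a g "{}" b] by simp

lemma graded_ideal_subspace:
  assumes "graded_ideal q n H" shows "L.subspace (H \<inter> forms q n a :: 'k::field laurent set)"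
proof (rule L.subspaceI)
  fix f g :: "'k laurent" assume "f \<in> H \<inter> forms q n a" "g \<in> H \<inter> forms q n a"
  thus "f + g \<in> H \<inter> forms q n a" using graded_ideal_add[OF assms] by (auto simp: forms_eq_lforms lforms_add)
next
  fix c and f :: "'k laurent" assume "f \<in> H \<inter> forms q n a"
  thus "laurent_scale c f \<in> H \<inter> forms q n a"
    using graded_ideal_mult[OF assms, of "single 0 c" "\<lambda>_. 0" f] lforms_scale[of f q n "{}" a c]
    by (auto simp: forms_eq_lforms const_in_lforms laurent_scale_def)
qed (simp add: graded_ideal_zero[OF assms] forms_eq_lforms lforms_zero)

text \<open>
  The homogeneous elements of the ideal generated by \<open>H\<close> and the form \<open>f\<close> of multidegree \<open>a\<close>.
\<close>

definition adjoin :: "nat \<Rightarrow> (nat \<Rightarrow> nat) \<Rightarrow> 'k::field laurent set \<Rightarrow> 'k laurent \<Rightarrow> (nat \<Rightarrow> int) \<Rightarrow> 'k laurent set" where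
  "adjoin q n H f a = {p + r * f |p r b. p \<in> H \<and> p \<in> forms q n b \<and> r \<in> forms q n (b - a)}"

lemma adjoin_in_forms:
  "f \<in> forms q n a \<Longrightarrow> p \<in> forms q n b \<Longrightarrow> r \<in> forms q n (b - a) \<Longrightarrow> p + r * f \<in> forms q n b"
  using forms_mult[of r q n "b - a" f a] by (simp add: forms_eq_lforms lforms_add)

lemma graded_ideal_adjoin:
  fixes H :: "'k::field laurent set"
  assumes H: "graded_ideal q n H" and f: "f \<in> forms q n a"
  shows "graded_ideal q n (adjoin q n H f a)"
  unfolding graded_ideal_def
proof (intro conjI allI ballI)
  show "adjoin q n H f a \<subseteq> (\<Union>a. forms q n a)"
    using adjoin_in_forms[OF f] unfolding adjoin_def by blast
  have "0 + 0 * f \<in> adjoin q n H f a"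
    unfolding adjoin_def mem_Collect_eq
    by (rule exI[of _ 0], rule exI[of _ 0], rule exI[of _ 0])
       (simp add: graded_ideal_zero[OF H] forms_eq_lforms lforms_zero)
  thus "0 \<in> adjoin q n H f a" by simp
next
  fix b g h assume g: "g \<in> adjoin q n H f a \<inter> forms q n b" and h: "h \<in> adjoin q n H f a \<inter> forms q n b"
  show "g + h \<in> adjoin q n H f a"
  proof (cases "g = 0 \<or> h = 0")
    case False
    obtain p r b1 where g1: "g = p + r * f" "p \<in> H" "p \<in> forms q n b1" "r \<in> forms q n (b1 - a)"
      using g by (auto simp: adjoin_def)
    obtain p' r' b2 where h1: "h = p' + r' * f" "p' \<in> H" "p' \<in> forms q n b2" "r' \<in> forms q n (b2 - a)"
      using h by (auto simp: adjoin_def)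
    have "g \<in> forms q n b1" "h \<in> forms q n b2"
      unfolding g1(1) h1(1) by (rule adjoin_in_forms[OF f g1(3,4)], rule adjoin_in_forms[OF f h1(3,4)])
    hence deg: "b2 i = b1 i" if "i \<in> {1..q}" for i
      using homogeneous_degree_unique[of g q n "{}" b1 "{}" b i] homogeneous_degree_unique[of h q n "{}" b2 "{}" b i]
        g h False that by (simp add: forms_eq_lforms)
    have p': "p' \<in> forms q n b1" and r': "r' \<in> forms q n (b1 - a)"
      using h1 deg lforms_cong[of p' q n "{}" b2 "{}" b1] lforms_cong[of r' q n "{}" "b2 - a" "{}" "b1 - a"]
      by (simp_all add: forms_eq_lforms)
    have "g + h = (p + p') + (r + r') * f" by (simp add: g1(1) h1(1) algebra_simps)
    moreover have "p + p' \<in> H" by (rule graded_ideal_add[OF H g1(2) h1(2) g1(3) p'])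
    moreover have "p + p' \<in> forms q n b1" "r + r' \<in> forms q n (b1 - a)"
      using g1 p' r' by (simp_all add: forms_eq_lforms lforms_add)
    ultimately show ?thesis unfolding adjoin_def by blast
  qed (use g h in auto)
next
  fix b and r g :: "'k laurent" assume r: "r \<in> forms q n b" and "g \<in> adjoin q n H f a"
  then obtain p s b1 where g1: "g = p + s * f" "p \<in> H" "p \<in> forms q n b1" "s \<in> forms q n (b1 - a)"
    by (auto simp: adjoin_def)
  have "r * g = r * p + (r * s) * f" by (simp add: g1 algebra_simps)
  moreover have "r * p \<in> forms q n (b + b1)" "r * s \<in> forms q n (b + b1 - a)"
    using forms_mult[OF r g1(3)] forms_mult[OF r g1(4)] by (simp_all add: algebra_simps)
  ultimately show "r * g \<in> adjoin q n H f a"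
    unfolding adjoin_def using graded_ideal_mult[OF H r g1(2)] by blast
qed

lemma subset_adjoin: assumes "graded_ideal q n H" shows "H \<subseteq> adjoin q n H f a"
proof
  fix p assume p: "p \<in> H"
  then obtain b where "p \<in> forms q n b" using graded_ideal_degree[OF assms] by blast
  moreover have "0 \<in> forms q n (b - a)" by (simp add: forms_eq_lforms lforms_zero)
  ultimately have "p + 0 * f \<in> adjoin q n H f a" unfolding adjoin_def using p by blast
  thus "p \<in> adjoin q n H f a" by simp
qed

lemma mem_adjoin: assumes "graded_ideal q n H" shows "f \<in> adjoin q n H f a"
proof -
  have "1 \<in> forms q n (a - a)" using one_in_lforms[of q n "{}"] by (simp add: forms_eq_lforms zero_fun_def)
  moreover have "0 \<in> forms q n a" by (simp add: forms_eq_lforms lforms_zero)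
  ultimately have "0 + 1 * f \<in> adjoin q n H f a"
    unfolding adjoin_def using graded_ideal_zero[OF assms] by blast
  thus ?thesis by simp
qed

text \<open>
  An ideal that is maximal among those containing no member of \<open>\<M>\<close> is prime: if \<open>f\<close> and \<open>g\<close> are not in
  it, adjoining either one captures members \<open>A\<close> and \<open>B\<close> of \<open>\<M>\<close>, and if \<open>f * g\<close> were in it, then so
  would be all products of elements of \<open>A\<close> and \<open>B\<close>. Zorn's lemma applies because the members of \<open>\<M>\<close>
  are finite. Singletons give primes disjoint from a multiplicative set; the sets of all monomials of
  a given multidegree give primes that are not irrelevant.
\<close>

lemma graded_prime_exists:
  fixes H0 :: "'k::field laurent set"
  assumes H0: "graded_ideal q n H0"
    and fin: "\<And>A. A \<in> \<M> \<Longrightarrow> finite A"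
    and mult: "\<And>A B. A \<in> \<M> \<Longrightarrow> B \<in> \<M> \<Longrightarrow> \<exists>C\<in>\<M>. C \<subseteq> {f * g |f g. f \<in> A \<and> g \<in> B}"
    and avoid: "\<And>A. A \<in> \<M> \<Longrightarrow> \<not> A \<subseteq> H0"
  shows "\<exists>P. graded_ideal q n P \<and> H0 \<subseteq> P \<and> (\<forall>A\<in>\<M>. \<not> A \<subseteq> P) \<and>
    (\<forall>a b f g. f \<in> forms q n a \<longrightarrow> g \<in> forms q n b \<longrightarrow> f * g \<in> P \<longrightarrow> f \<in> P \<or> g \<in> P)"
proof -
  let ?S = "{P. graded_ideal q n P \<and> H0 \<subseteq> P \<and> (\<forall>A\<in>\<M>. \<not> A \<subseteq> P)}"
  have "\<exists>P\<in>?S. \<forall>Q\<in>?S. P \<subseteq> Q \<longrightarrow> Q = P"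
  proof (rule subset_Zorn_nonempty)
    show "?S \<noteq> {}" using H0 avoid by blast
    fix \<C> assume ne: "\<C> \<noteq> {}" and chain: "subset.chain ?S \<C>"
    have S: "\<And>P. P \<in> \<C> \<Longrightarrow> P \<in> ?S" using chain by (auto simp: subset_chain_def)
    have gr: "\<And>P. P \<in> \<C> \<Longrightarrow> graded_ideal q n P" using S by blast
    have "graded_ideal q n (\<Union>\<C>)"
      unfolding graded_ideal_def
    proof (intro conjI allI ballI)
      show "\<Union>\<C> \<subseteq> (\<Union>a. forms q n a)" using graded_ideal_degree[OF gr] by blast
      show "0 \<in> \<Union>\<C>" using ne graded_ideal_zero[OF gr] by blast
    next
      fix a f g assume f: "f \<in> \<Union>\<C> \<inter> forms q n a" and g: "g \<in> \<Union>\<C> \<inter> forms q n a"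
      then obtain P P' where P: "P \<in> \<C>" "f \<in> P" "P' \<in> \<C>" "g \<in> P'" by blast
      hence "P \<subseteq> P' \<or> P' \<subseteq> P" using chain unfolding subset_chain_def by blast
      then obtain P'' where "P'' \<in> \<C>" "f \<in> P''" "g \<in> P''" using P by blast
      thus "f + g \<in> \<Union>\<C>" using graded_ideal_add[OF gr] f g by blast
    next
      fix b and r f :: "'k laurent" assume "r \<in> forms q n b" "f \<in> \<Union>\<C>"
      thus "r * f \<in> \<Union>\<C>" using graded_ideal_mult[OF gr] by blast
    qed
    moreover have "\<not> A \<subseteq> \<Union>\<C>" if A: "A \<in> \<M>" for A
    proof
      assume "A \<subseteq> \<Union>\<C>"
      then obtain P where "P \<in> \<C>" "A \<subseteq> P"
        using finite_subset_Union_chain[OF fin[OF A] _ ne chain] by blast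
      thus False using S A by blast
    qed
    moreover have "H0 \<subseteq> \<Union>\<C>" using ne S by blast
    ultimately show "\<Union>\<C> \<in> ?S" by blast
  qed
  then obtain P where P: "graded_ideal q n P" "H0 \<subseteq> P" "\<And>A. A \<in> \<M> \<Longrightarrow> \<not> A \<subseteq> P"
    and max: "\<And>Q. graded_ideal q n Q \<Longrightarrow> H0 \<subseteq> Q \<Longrightarrow> \<forall>A\<in>\<M>. \<not> A \<subseteq> Q \<Longrightarrow> P \<subseteq> Q \<Longrightarrow> Q = P" by auto
  have big: "\<exists>A\<in>\<M>. A \<subseteq> adjoin q n P f a" if f: "f \<in> forms q n a" "f \<notin> P" for f :: "'k laurent" and a
  proof (rule ccontr)
    assume "\<not> ?thesis"
    hence "adjoin q n P f a = P"
      using max[OF graded_ideal_adjoin[OF P(1) f(1)]] P(2) subset_adjoin[OF P(1), of f a] by blast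
    thus False using mem_adjoin[OF P(1), of f a] f(2) by blast
  qed
  have "f \<in> P \<or> g \<in> P" if f: "f \<in> forms q n a" and g: "g \<in> forms q n b" and fg: "f * g \<in> P" for a b and f g :: "'k laurent"
  proof (rule ccontr)
    assume "\<not> ?thesis"
    then obtain A B where A: "A \<in> \<M>" "A \<subseteq> adjoin q n P f a" and B: "B \<in> \<M>" "B \<subseteq> adjoin q n P g b"
      using big f g by metis
    obtain C where C: "C \<in> \<M>" "C \<subseteq> {f * g |f g. f \<in> A \<and> g \<in> B}" using mult[OF A(1) B(1)] by auto
    have "C \<subseteq> P"
    proof
      fix h assume "h \<in> C"
      then obtain u v where uv: "h = u * v" "u \<in> adjoin q n P f a" "v \<in> adjoin q n P g b" using C A B by blast
      obtain p r a1 where u: "u = p + r * f" "p \<in> P" "p \<in> forms q n a1" "r \<in> forms q n (a1 - a)"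
        using uv(2) by (auto simp: adjoin_def)
      obtain p' r' b1 where v: "v = p' + r' * g" "p' \<in> P" "p' \<in> forms q n b1" "r' \<in> forms q n (b1 - b)"
        using uv(3) by (auto simp: adjoin_def)
      have rf: "r * f \<in> forms q n a1" and rg: "r' * g \<in> forms q n b1"
        using forms_mult[OF u(4) f] forms_mult[OF v(4) g] by simp_all
      have vf: "v \<in> forms q n b1" using v(3) rg unfolding v(1) by (simp add: forms_eq_lforms lforms_add)
      have 1: "v * p \<in> P" by (rule graded_ideal_mult[OF P(1) vf u(2)])
      have 2: "(r * f) * p' \<in> P" by (rule graded_ideal_mult[OF P(1) rf v(2)])
      have 3: "(r * r') * (f * g) \<in> P" by (rule graded_ideal_mult[OF P(1) forms_mult[OF u(4) v(4)] fg])
      \<comment> \<open>All three summands are in \<open>P\<close>: \<open>p\<close>, \<open>p'\<close> and \<open>f * g\<close> are.\<close>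
      have "h = v * p + ((r * f) * p' + (r * r') * (f * g))"
        by (simp add: uv(1) u(1) v(1) algebra_simps)
      moreover have "(r * f) * p' \<in> forms q n (a1 + b1)" by (rule forms_mult[OF rf v(3)])
      moreover have "(r * f) * (r' * g) \<in> forms q n (a1 + b1)" by (rule forms_mult[OF rf rg])
      hence "(r * r') * (f * g) \<in> forms q n (a1 + b1)" by (simp add: ac_simps)
      moreover have "p * v \<in> forms q n (a1 + b1)" by (rule forms_mult[OF u(3) vf])
      hence "v * p \<in> forms q n (a1 + b1)" by (simp add: ac_simps)
      ultimately show "h \<in> P"
        using 1 2 3 graded_ideal_add[OF P(1)] lforms_add[of _ q n "{}" "a1 + b1"] by (metis forms_eq_lforms)
    qed
    thus False using P(3)[OF C(1)] by blast
  qed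
  with P show ?thesis by (intro exI[of _ P]) blast
qed

text \<open>
  Pigeonhole principle: a monomial of large multidegree contains a large power of one variable from
  each group, and such a choice of variables is a chart.
\<close>

lemma exps_dominates_chart:
  assumes m: "m \<in> exps q n {} a" and a: "\<And>i. i \<in> {1..q} \<Longrightarrow> a i > int (n i + 1) * (int k - 1)"
  obtains d where "d \<in> charts q n" "m - cvec q d (\<lambda>_. int k) \<in> exps q n {} (\<lambda>i. a i - int k)"
proof -
  have "\<forall>i\<in>{1..q}. \<exists>j\<in>{0..n i}. lookup m (i, j) \<ge> int k"
  proof (rule ballI, rule ccontr)
    fix i assume i: "i \<in> {1..q}" and "\<not> (\<exists>j\<in>{0..n i}. lookup m (i, j) \<ge> int k)"
    hence "\<And>j. j \<in> {0..n i} \<Longrightarrow> lookup m (i, j) \<le> int k - 1" by force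
    hence "gdeg n m i \<le> of_nat (card {0..n i}) * (int k - 1)"
      unfolding gdeg_def by (intro sum_bounded_above) auto
    moreover have "gdeg n m i = a i" using m i by (simp add: exps_def)
    ultimately show False using a[OF i] by simp
  qed
  then obtain d0 where d0: "\<And>i. i \<in> {1..q} \<Longrightarrow> d0 i \<in> {0..n i} \<and> lookup m (i, d0 i) \<ge> int k" by metis
  define d where "d = restrict d0 {1..q}"
  have d0n: "d0 i \<in> {0..n i}" and d0k: "lookup m (i, d0 i) \<ge> int k" if "i \<in> {1..q}" for i
    using d0[OF that] by (rule conjunct1, rule conjunct2)
  have d: "d \<in> charts q n" unfolding charts_def
  proof (rule PiE_I)
    fix i assume i: "i \<in> {1..q}"
    thus "d i \<in> {0..n i}" using d0n[OF i] by (simp only: d_def restrict_apply if_True)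
  qed (auto simp: d_def restrict_def)
  have "m - cvec q d (\<lambda>_. int k) \<in> exps q n {} (\<lambda>i. a i - int k)"
    unfolding exps_def
  proof (intro CollectI conjI ballI allI impI)
    show "keys (m - cvec q d (\<lambda>_. int k)) \<subseteq> vars q n"
      using keys_diff[of m "cvec q d (\<lambda>_. int k)"] keys_cvec[OF d, of "\<lambda>_. int k"] m
      unfolding exps_def by blast
    fix i assume i: "i \<in> {1..q}"
    have "gdeg n m i = a i" using m i by (simp add: exps_def)
    thus "gdeg n (m - cvec q d (\<lambda>_. int k)) i = a i - int k" by (simp add: gdeg_diff gdeg_cvec[OF d i])
  next
    fix v :: "nat \<times> nat"
    obtain i j where v: "v = (i, j)" by (cases v)
    have "lookup m v \<ge> 0" using m by (simp add: v exps_def)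
    moreover have "lookup m (i, j) \<ge> int k" if "i \<in> {1..q}" "j = d i"
      using d0k[OF that(1)] that by (simp only: d_def restrict_apply if_True)
    ultimately show "0 \<le> lookup (m - cvec q d (\<lambda>_. int k)) v"
      by (auto simp: v lookup_minus lookup_cvec)
  qed
  thus ?thesis using that d by blast
qed

text \<open>
  The ideal of the chart \<open>d\<close> cut out by a homogeneous ideal.
\<close>

definition localize :: "nat \<Rightarrow> (nat \<Rightarrow> nat) \<Rightarrow> (nat \<Rightarrow> nat) \<Rightarrow> 'k::field laurent set \<Rightarrow> 'k laurent set" where
  "localize q n d P = {f \<in> chart_ring q n d. \<exists>K. xmon (cvec q d (\<lambda>_. int K)) * f \<in> P}"

lemma chart_xmon_forms: "d \<in> charts q n \<Longrightarrow> xmon (cvec q d (\<lambda>_. int k)) \<in> forms q n (\<lambda>_. int k)"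
  unfolding forms_eq_lforms xmon_in_lforms by (rule cvec_exps_nonneg) auto

lemma chart_xmon_add: "xmon (cvec q d (\<lambda>_. int k)) * xmon (cvec q d (\<lambda>_. int l)) = xmon (cvec q d (\<lambda>_. int (k + l)))"
proof -
  have "cvec q d (\<lambda>_. int k) + cvec q d (\<lambda>_. int l) = cvec q d (\<lambda>_. int (k + l))"
    unfolding cvec_add by (rule cvec_cong) simp
  thus ?thesis by (simp add: xmon_mult)
qed

lemma clear_chart_ring:
  assumes "d \<in> charts q n" "f \<in> chart_ring q n d"
  obtains K where "\<And>k. k \<ge> K \<Longrightarrow> xmon (cvec q d (\<lambda>_. int k)) * f \<in> forms q n (\<lambda>_. int k)"
proof -
  have "f \<in> lforms q n ({} \<union> chart_vars q d) (\<lambda>_. 0)" using assms(2) by (simp add: affine_ring_eq_lforms)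
  from clear_denominators[OF this assms(1)] show ?thesis using that by (auto simp: forms_eq_lforms)
qed

lemma localize_increase:
  assumes P: "graded_ideal q n P" and d: "d \<in> charts q n" and f: "xmon (cvec q d (\<lambda>_. int K)) * f \<in> P" and "k \<ge> K"
  shows "xmon (cvec q d (\<lambda>_. int k)) * f \<in> P"
proof -
  have "xmon (cvec q d (\<lambda>_. int (k - K))) * (xmon (cvec q d (\<lambda>_. int K)) * f) \<in> P"
    by (rule graded_ideal_mult[OF P chart_xmon_forms[OF d] f])
  moreover have "xmon (cvec q d (\<lambda>_. int (k - K))) * (xmon (cvec q d (\<lambda>_. int K)) * f) = xmon (cvec q d (\<lambda>_. int k)) * f"
    using \<open>k \<ge> K\<close> by (simp only: mult.assoc[symmetric] chart_xmon_add) simp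
  ultimately show ?thesis by simp
qed

lemma localize_is_prime:
  fixes P :: "'k::field laurent set"
  assumes P: "graded_ideal q n P"
    and prime: "\<And>a b f g. f \<in> forms q n a \<Longrightarrow> g \<in> forms q n b \<Longrightarrow> f * g \<in> P \<Longrightarrow> f \<in> P \<or> g \<in> P"
    and d: "d \<in> charts q n" and xd: "xmon (cvec q d (\<lambda>_. 1)) \<notin> P"
  shows "is_prime_ideal (chart_ring q n d) (localize q n d P)"
proof -
  let ?x = "\<lambda>k. xmon (cvec q d (\<lambda>_. int k)) :: 'k laurent" and ?R = "chart_ring q n d :: 'k laurent set" and ?L = "localize q n d P"
  have R: "is_ideal ?R ?R" by (rule is_ideal_affine_ring)
  have xP: "?x k \<notin> P" for k
  proof (induction k)
    case 0
    show ?case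
    proof
      assume "?x 0 \<in> P"
      hence "xmon (cvec q d (\<lambda>_. int 1)) * ?x 0 \<in> P" by (rule graded_ideal_mult[OF P chart_xmon_forms[OF d]])
      thus False using xd by (simp only: chart_xmon_add) simp
    qed
  next
    case (Suc k)
    have "?x (Suc k) = ?x k * ?x 1" by (simp only: chart_xmon_add) simp
    thus ?case using prime[OF chart_xmon_forms[OF d] chart_xmon_forms[OF d], of k 1] Suc xd by auto
  qed
  have "is_ideal ?R ?L"
    unfolding is_ideal_def
  proof (intro conjI ballI)
    show "?L \<subseteq> ?R" by (auto simp: localize_def)
    show "0 \<in> ?L" using graded_ideal_zero[OF P] by (simp add: localize_def affine_ring_eq_lforms lforms_zero)
  next
    fix f g assume f: "f \<in> ?L" and g: "g \<in> ?L"
    obtain Kf where Kf: "?x Kf * f \<in> P" using f by (auto simp: localize_def)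
    obtain Kg where Kg: "?x Kg * g \<in> P" using g by (auto simp: localize_def)
    obtain Lf where Lf: "\<And>k. k \<ge> Lf \<Longrightarrow> ?x k * f \<in> forms q n (\<lambda>_. int k)"
      using clear_chart_ring[OF d, of f] f by (auto simp: localize_def)
    obtain Lg where Lg: "\<And>k. k \<ge> Lg \<Longrightarrow> ?x k * g \<in> forms q n (\<lambda>_. int k)"
      using clear_chart_ring[OF d, of g] g by (auto simp: localize_def)
    let ?K = "Kf + Kg + Lf + Lg"
    have "?x ?K * f + ?x ?K * g \<in> P"
      by (rule graded_ideal_add[OF P localize_increase[OF P d Kf] localize_increase[OF P d Kg] Lf Lg]) auto
    hence "?x ?K * (f + g) \<in> P" by (simp add: distrib_left)
    moreover have "f + g \<in> ?R" using f g R unfolding localize_def is_ideal_def by blast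
    ultimately show "f + g \<in> ?L" unfolding localize_def by blast
  next
    fix r f :: "'k laurent" assume r: "r \<in> ?R" and f: "f \<in> ?L"
    obtain Kf where Kf: "?x Kf * f \<in> P" using f by (auto simp: localize_def)
    obtain Lr where Lr: "\<And>k. k \<ge> Lr \<Longrightarrow> ?x k * r \<in> forms q n (\<lambda>_. int k)"
      using clear_chart_ring[OF d r] by metis
    have "(?x Lr * r) * (?x Kf * f) \<in> P" by (rule graded_ideal_mult[OF P Lr[OF order_refl] Kf])
    moreover have "(?x Lr * r) * (?x Kf * f) = (?x Lr * ?x Kf) * (r * f)" by (simp only: ac_simps)
    ultimately have "?x (Lr + Kf) * (r * f) \<in> P" by (simp only: chart_xmon_add)
    moreover have "r * f \<in> ?R" using f r R unfolding localize_def is_ideal_def by blast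
    ultimately show "r * f \<in> ?L" unfolding localize_def by blast
  qed
  moreover have "?L \<noteq> ?R"
  proof -
    have "1 \<in> ?R" by (simp only: affine_ring_eq_lforms one_in_lforms)
    moreover have "1 \<notin> ?L" using xP by (simp add: localize_def)
    ultimately show ?thesis by blast
  qed
  moreover have "f \<in> ?L \<or> g \<in> ?L" if f: "f \<in> ?R" and g: "g \<in> ?R" and fg: "f * g \<in> ?L" for f g
  proof -
    obtain K where K: "?x K * (f * g) \<in> P" using fg by (auto simp: localize_def)
    obtain Lf where Lf: "?x Lf * f \<in> forms q n (\<lambda>_. int Lf)"
      using clear_chart_ring[OF d f] by (metis order_refl)
    obtain Lg where Lg: "?x Lg * g \<in> forms q n (\<lambda>_. int Lg)"
      using clear_chart_ring[OF d g] by (metis order_refl)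
    have "(?x Lf * ?x Lg) * (?x K * (f * g)) \<in> P"
      by (rule graded_ideal_mult[OF P forms_mult[OF chart_xmon_forms[OF d] chart_xmon_forms[OF d]] K])
    moreover have "(?x Lf * ?x Lg) * (?x K * (f * g)) = ((?x Lf * f) * (?x Lg * g)) * ?x K" by (simp only: ac_simps)
    ultimately have "((?x Lf * f) * (?x Lg * g)) * ?x K \<in> P" by simp
    hence "(?x Lf * f) * (?x Lg * g) \<in> P"
      using prime[OF forms_mult[OF Lf Lg] chart_xmon_forms[OF d, of K]] xP by blast
    hence "?x Lf * f \<in> P \<or> ?x Lg * g \<in> P" using prime[OF Lf Lg] by blast
    thus ?thesis using f g unfolding localize_def by blast
  qed
  ultimately show ?thesis unfolding is_prime_ideal_def by (intro conjI ballI impI)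
qed

section \<open>The chart rings modulo a zero-dimensional subscheme\<close>

definition eval_at :: "'k::field poly \<Rightarrow> 'k laurent \<Rightarrow> 'k laurent" where
  "eval_at p y = poly (map_poly (single 0) p) y"

lemma eval_at_mult: "eval_at (p * p' :: 'k::field poly) y = eval_at p y * eval_at p' y"
proof -
  have "map_poly (single 0) (p * p') =
      (map_poly (single 0) p * map_poly (single 0) p' :: 'k laurent poly)"
  proof (rule poly_eqI)
    fix k
    have s: "(\<Sum>i\<in>I. single (0::nat \<times> nat \<Rightarrow>\<^sub>0 int) (f i)) = single 0 (\<Sum>i\<in>I. f i)"
      for I :: "nat set" and f :: "nat \<Rightarrow> 'k"
      by (induction I rule: infinite_finite_induct) (simp_all add: single_add)
    show "coeff (map_poly (single (0::nat \<times> nat \<Rightarrow>\<^sub>0 int)) (p * p')) k =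
      coeff (map_poly (single 0) p * map_poly (single 0) p') k"
      by (simp add: coeff_map_poly coeff_mult mult_single s)
  qed
  thus ?thesis by (simp add: eval_at_def)
qed

lemma eval_at_add: "eval_at (p + p' :: 'k::field poly) y = eval_at p y + eval_at p' y"
proof -
  have "map_poly (single 0) (p + p') =
      (map_poly (single 0) p + map_poly (single 0) p' :: 'k laurent poly)"
    by (rule poly_eqI) (simp add: coeff_map_poly single_add)
  thus ?thesis by (simp add: eval_at_def)
qed

lemma eval_at_eq_sum: "degree p \<le> D \<Longrightarrow> eval_at p y = (\<Sum>k\<le>D. laurent_scale (coeff p k) (y ^ k))"
proof -
  assume D: "degree p \<le> D"
  have "degree (map_poly (single (0::nat \<times> nat \<Rightarrow>\<^sub>0 int)) p) \<le> D"
    using D by (intro degree_le) (simp add: coeff_map_poly coeff_eq_0)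
  hence "eval_at p y = (\<Sum>k\<le>D. coeff (map_poly (single 0) p) k * y ^ k)"
    unfolding eval_at_def poly_altdef
    by (intro sum.mono_neutral_left) (auto simp: coeff_eq_0)
  thus ?thesis by (simp add: coeff_map_poly laurent_scale_def)
qed

lemma eval_at_monom: "eval_at (monom 1 l) y = y ^ l"
  by (simp add: eval_at_def map_poly_monom poly_monom)

lemma eval_at_1: "eval_at 1 y = 1" by (simp add: eval_at_def)

text \<open>
  The exponent of the coordinate \<open>x\<^sub>i\<^sub>j / x\<^sub>i\<^sub>,\<^sub>c\<^sub>i\<close> of the chart \<open>c\<close>.
\<close>

definition coord_exp :: "(nat \<Rightarrow> nat) \<Rightarrow> nat \<Rightarrow> nat \<Rightarrow> (nat \<times> nat \<Rightarrow>\<^sub>0 int)" where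
  "coord_exp c i j = single (i, j) 1 - single (i, c i) 1"

lemma coord_exp_exps:
  assumes "c \<in> charts q n" "i \<in> {1..q}" "j \<le> n i"
  shows "coord_exp c i j \<in> exps q n (chart_vars q c) (\<lambda>_. 0)"
proof -
  have ci: "c i \<le> n i" using assms by (auto simp: charts_def PiE_iff)
  have "keys (coord_exp c i j) \<subseteq> vars q n"
    using keys_diff[of "single (i, j) (1::int)" "single (i, c i) 1"] assms ci
    by (auto simp: coord_exp_def vars_def split: if_splits)
  moreover have "gdeg n (coord_exp c i j) k = 0" if "k \<in> {1..q}" for k
    using var_exps[where n = n, OF assms(2,3), of "{}"] var_exps[where n = n, OF assms(2) ci, of "{}"] that
    by (simp add: coord_exp_def gdeg_diff exps_def)
  moreover have "lookup (coord_exp c i j) v \<ge> 0" if "v \<notin> chart_vars q c" for v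
    using that assms(2) by (auto simp: coord_exp_def lookup_minus lookup_single when_def chart_vars_def)
  ultimately show ?thesis unfolding exps_def by blast
qed

lemma xmon_power: "xmon m ^ l = xmon (frag_cmul (int l) m)"
proof (induction l)
  case (Suc l)
  have "frag_cmul (int (Suc l)) m = m + frag_cmul (int l) m" by (simp add: frag_cmul_distrib)
  thus ?case using Suc by (simp add: xmon_mult)
qed simp

lemma mult_image_subspace: "L.subspace S \<Longrightarrow> L.subspace ((*) y ` S)"
proof (rule L.subspaceI)
  assume S: "L.subspace S"
  show "0 \<in> (*) y ` S" using L.subspace_0[OF S] by (intro image_eqI[of _ _ 0]) auto
  fix u v assume "u \<in> (*) y ` S" "v \<in> (*) y ` S"
  then obtain u' v' where "u' \<in> S" "v' \<in> S" "u = y * u'" "v = y * v'" by blast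
  thus "u + v \<in> (*) y ` S"
    using L.subspace_add[OF S] by (intro image_eqI[of _ _ "u' + v'"]) (auto simp: distrib_left)
next
  assume S: "L.subspace S"
  fix c u assume "u \<in> (*) y ` S"
  then obtain u' where "u' \<in> S" "u = y * u'" by blast
  thus "laurent_scale c u \<in> (*) y ` S"
    using L.subspace_scale[OF S] by (intro image_eqI[of _ _ "laurent_scale c u'"]) (auto simp: laurent_scale_mult_right)
qed

text \<open>
  Let \<open>S\<close> denote the coordinate ring and \<open>x\<close> the variable. The hypothesis says
  \<open>S\<^sub>a \<subseteq> P + x S\<close>. Splitting off one variable of the \<open>i\<close>-th group from each monomial and
  applying the hypothesis again yields \<open>S\<^sub>b \<subseteq> P + x ^ (k + 1) * S\<^sub>c\<close> with \<open>b = a + k * udeg i\<close> and a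
  cofactor multidegree \<open>c = a - udeg i\<close> that does not depend on \<open>k\<close>. Hence the dimension of \<open>S\<^sub>b\<close> modulo
  \<open>P\<close> stays bounded as \<open>k\<close> grows.
\<close>

lemma adjoin_variable_power:
  fixes P :: "'k::field laurent set"
  assumes P: "graded_ideal q n P" and i: "i \<in> {1..q}" and j: "j \<le> n i"
    and a: "\<forall>i\<in>{1..q}. 0 \<le> a i"
    and sub: "xmon ` exps q n {} a \<subseteq> adjoin q n P (xmon (single (i, j) 1)) (udeg i)"
  shows "forms q n (a + (\<lambda>l. int k * udeg i l)) \<subseteq>
    {u + v |u v. u \<in> P \<inter> forms q n (a + (\<lambda>l. int k * udeg i l)) \<and>
       v \<in> (*) (xmon (single (i, j) 1) ^ Suc k) ` forms q n (a - udeg i)}"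
    (is "_ \<subseteq> ?G k")
proof -
  let ?a = "\<lambda>k. a + (\<lambda>l. int k * udeg i l)"
  let ?x = "xmon (single (i, j) 1) :: 'k laurent"
  have x: "?x \<in> forms q n (udeg i)" by (simp only: forms_eq_lforms xmon_in_lforms var_exps[where n = n, OF i j])
  have xk: "?x ^ k \<in> forms q n (\<lambda>l. int k * udeg i l)" for k
  proof (induction k)
    case 0 thus ?case using one_in_lforms[of q n "{}"] by (simp add: forms_eq_lforms)
  next
    case (Suc k)
    have "udeg i + (\<lambda>l. int k * udeg i l) = (\<lambda>l. int (Suc k) * udeg i l)" by (auto simp: fun_eq_iff algebra_simps)
    with forms_mult[OF x Suc] show ?case by simp
  qed
  have Gsub: "L.subspace (?G k)" for k
    by (intro L.subspace_sums graded_ideal_subspace[OF P] mult_image_subspace)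
       (simp add: forms_eq_lforms lforms_subspace)
  have gen: "forms q n (?a k) \<subseteq> ?G k" if "\<And>m. m \<in> exps q n {} (?a k) \<Longrightarrow> xmon m \<in> ?G k" for k
  proof -
    have "xmon ` exps q n {} (?a k) \<subseteq> ?G k" using that by (intro image_subsetI)
    hence "L.span (xmon ` exps q n {} (?a k)) \<subseteq> ?G k" by (intro L.span_minimal Gsub)
    thus ?thesis using lforms_subset_span[of q n "{}" "?a k"] unfolding forms_eq_lforms by (rule subset_trans[rotated])
  qed
  have a0: "?a 0 = a" by (simp add: fun_eq_iff)
  have "forms q n (?a 0) \<subseteq> ?G 0"
  proof (rule gen)
    fix m assume "m \<in> exps q n {} (?a 0)"
    hence m: "m \<in> exps q n {} a" unfolding a0 .
    hence "xmon m \<in> adjoin q n P ?x (udeg i)" using sub by blast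
    then obtain p r b where pr: "xmon m = p + r * ?x" "p \<in> P" "p \<in> forms q n b" "r \<in> forms q n (b - udeg i)"
      by (auto simp: adjoin_def)
    have "(xmon m :: 'k laurent) \<in> forms q n b" unfolding pr(1) by (rule adjoin_in_forms[OF x pr(3,4)])
    hence "m \<in> exps q n {} b" by (simp add: forms_eq_lforms xmon_in_lforms)
    hence deg: "b k = a k" if "k \<in> {1..q}" for k using m that by (simp add: exps_def)
    have "p \<in> forms q n (?a 0)" "r \<in> forms q n (a - udeg i)"
      using pr deg lforms_cong[of p q n "{}" b "{}" a] lforms_cong[of r q n "{}" "b - udeg i" "{}" "a - udeg i"]
      unfolding a0 by (simp_all add: forms_eq_lforms)
    moreover have "xmon m = p + ?x ^ Suc 0 * r" by (simp add: pr(1) mult.commute)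
    ultimately show "xmon m \<in> ?G 0" using pr(2) by blast
  qed
  thus "forms q n (?a k) \<subseteq> ?G k"
  proof (induction k)
    case (Suc k)
    note G0 = Suc.prems
    show ?case
    proof (rule gen)
      fix m assume m: "m \<in> exps q n {} (?a (Suc k))"
      have a': "?a (Suc k) = ?a k + udeg i" by (auto simp: fun_eq_iff algebra_simps)
      have "0 \<le> a i" using a i by blast
      hence "0 \<le> ?a k i" by (simp add: udeg_def)
      then obtain j' where j': "j' \<le> n i" "m - single (i, j') 1 \<in> exps q n {} (?a k)"
        using exps_split_var[OF m[unfolded a'] i] by metis
      let ?z = "xmon (single (i, j') 1) :: 'k laurent"
      let ?m = "xmon (m - single (i, j') 1) :: 'k laurent"
      have z: "?z \<in> forms q n (udeg i)" by (simp only: forms_eq_lforms xmon_in_lforms var_exps[where n = n, OF i j'(1)])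
      have "?m \<in> forms q n (?a k)" by (simp only: forms_eq_lforms xmon_in_lforms j'(2))
      then obtain p w where pw: "?m = p + ?x ^ Suc k * w" "p \<in> P" "p \<in> forms q n (?a k)" "w \<in> forms q n (a - udeg i)"
        using Suc.IH[OF G0] by blast
      have "?z * w \<in> forms q n (udeg i + (a - udeg i))" by (rule forms_mult[OF z pw(4)])
      also have "udeg i + (a - udeg i) = ?a 0" by (simp add: fun_eq_iff)
      finally obtain p' w' where pw': "?z * w = p' + ?x ^ Suc 0 * w'" "p' \<in> P" "p' \<in> forms q n (?a 0)" "w' \<in> forms q n (a - udeg i)"
        using G0 by blast
      have "xmon m = ?z * ?m" by (simp add: xmon_mult)
      also have "\<dots> = ?z * p + ?x ^ Suc k * (?z * w)" by (simp add: pw(1) algebra_simps)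
      also have "\<dots> = (?z * p + ?x ^ Suc k * p') + ?x ^ Suc (Suc k) * w'"
        unfolding pw'(1) by (simp add: algebra_simps)
      finally have eq: "xmon m = (?z * p + ?x ^ Suc k * p') + ?x ^ Suc (Suc k) * w'" .
      have 1: "?z * p \<in> P" "?x ^ Suc k * p' \<in> P"
        by (rule graded_ideal_mult[OF P z pw(2)], rule graded_ideal_mult[OF P xk pw'(2)])
      have 2: "?z * p \<in> forms q n (?a (Suc k))"
        using forms_mult[OF z pw(3)] unfolding a' by (simp only: ac_simps)
      have 3: "?x ^ Suc k * p' \<in> forms q n (?a (Suc k))"
        using forms_mult[OF xk pw'(3), of "Suc k"] unfolding a0 by (simp only: ac_simps)
      have "?z * p + ?x ^ Suc k * p' \<in> P \<inter> forms q n (?a (Suc k))"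
        using graded_ideal_add[OF P 1 2 3] 2 3 by (simp add: forms_eq_lforms lforms_add)
      thus "xmon m \<in> ?G (Suc k)" using eq pw'(4) by blast
    qed
  qed
qed

context subscheme
begin

lemma V_graded_ideal: "graded_ideal q n (\<Union>a. V a)"
  unfolding graded_ideal_def
proof (intro conjI allI ballI)
  show "(\<Union>a. V a) \<subseteq> (\<Union>a. forms q n a)" by (auto simp: vanishing_forms_def)
  show "0 \<in> (\<Union>a. V a)" using L.subspace_0[OF V_subspace] by blast
next
  fix a f g assume f: "f \<in> (\<Union>a. V a) \<inter> forms q n a" and g: "g \<in> (\<Union>a. V a) \<inter> forms q n a"
  have *: "h \<in> V a" if "h \<in> (\<Union>a. V a) \<inter> forms q n a" for h
  proof (cases "h = 0")
    case False
    obtain b where b: "h \<in> V b" using \<open>h \<in> (\<Union>a. V a) \<inter> forms q n a\<close> by blast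
    hence "b i = a i" if "i \<in> {1..q}" for i
      using homogeneous_degree_unique[OF False, of q n "{}" b "{}" a i] that \<open>h \<in> (\<Union>a. V a) \<inter> forms q n a\<close>
      by (simp add: vanishing_forms_def forms_eq_lforms)
    with V_cong[OF b] show ?thesis by blast
  qed (simp add: L.subspace_0[OF V_subspace])
  from L.subspace_add[OF V_subspace *[OF f] *[OF g]] show "f + g \<in> (\<Union>a. V a)" by blast
next
  fix b and r f :: "'k laurent" assume "r \<in> forms q n b" "f \<in> (\<Union>a. V a)"
  thus "r * f \<in> (\<Union>a. V a)" using V_mult by blast
qed

lemma R_eval_at: "y \<in> R c \<Longrightarrow> eval_at p y \<in> R c"
proof -
  assume y: "y \<in> R c"
  have "y ^ k \<in> R c" for k by (induction k) (auto intro: R_one R_mult y)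
  thus ?thesis
    by (subst eval_at_eq_sum[OF order_refl]) (intro L.subspace_sum[OF R_subspace] L.subspace_scale[OF R_subspace])
qed

text \<open>
  Suppose the coordinate \<open>y = x\<^sub>i\<^sub>j / x\<close> of the chart \<open>c\<close>, with \<open>x = x\<^sub>i\<^sub>,\<^sub>c\<^sub>i\<close>, is transcendental modulo
  \<open>X c\<close>. Then there is a homogeneous prime \<open>P\<close> containing the ideal of \<open>X\<close> modulo which \<open>y\<close> is still
  transcendental, that is, a positive-dimensional closed subset of \<open>X\<close>. It has to meet the
  hyperplane \<open>x = 0\<close>: otherwise \<open>P\<close> and \<open>x\<close> together would contain all monomials of some multidegree, and
  the dimensions of the coordinate ring modulo \<open>P\<close> would stay bounded in the direction \<open>udeg i\<close>, although
  the powers of \<open>y\<close> are independent. So some homogeneous prime \<open>Q\<close> contains \<open>P\<close> and \<open>x\<close> and is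
  visible in a chart \<open>d\<close>. There \<open>P\<close> and \<open>Q\<close> give a chain of primes of length one.
\<close>

lemma coordinate_algebraic:
  assumes zd: "zero_dimensional q n X" and c: "c \<in> charts q n" and i: "i \<in> {1..q}" and j: "j \<le> n i"
  shows "\<exists>p. p \<noteq> 0 \<and> eval_at p (xmon (coord_exp c i j)) \<in> X c"
proof (rule ccontr)
  assume "\<not> ?thesis"
  hence transc: "\<And>p. p \<noteq> 0 \<Longrightarrow> eval_at p (xmon (coord_exp c i j)) \<notin> X c" by blast
  let ?y = "xmon (coord_exp c i j) :: 'k laurent"
  let ?x = "xmon (single (i, c i) 1) :: 'k laurent"
  have ci: "c i \<le> n i" using c i by (auto simp: charts_def PiE_iff)
  have yR: "?y \<in> R c" by (simp add: affine_ring_eq_lforms xmon_in_lforms coord_exp_exps[OF c i j])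
  have x: "?x \<in> forms q n (udeg i)" by (simp only: forms_eq_lforms xmon_in_lforms var_exps[where n = n, OF i ci])
  \<comment> \<open>The forms \<open>x\<^sub>c\<^sup>b * p(y)\<close> with \<open>p \<noteq> 0\<close>; the vector \<open>b\<close> may have negative entries that cancel.\<close>
  define M1 where "M1 = {{xmon (cvec q c b) * eval_at p ?y} |b p. p \<noteq> 0 \<and> (\<exists>a. xmon (cvec q c b) * eval_at p ?y \<in> forms q n a)}"
  have M1I: "{xmon (cvec q c b) * eval_at p ?y} \<in> M1" if "p \<noteq> 0" "xmon (cvec q c b) * eval_at p ?y \<in> forms q n a" for p a b
    using that unfolding M1_def by blast
  have M1_fin: "finite A" if "A \<in> M1" for A using that by (auto simp: M1_def)
  have M1_mult: "\<exists>C\<in>M1. C \<subseteq> {f * g |f g. f \<in> A \<and> g \<in> B}" if "A \<in> M1" "B \<in> M1" for A B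
  proof -
    from that obtain b p a b' p' a' where A: "A = {xmon (cvec q c b) * eval_at p ?y}" "p \<noteq> 0" "xmon (cvec q c b) * eval_at p ?y \<in> forms q n a"
      and B: "B = {xmon (cvec q c b') * eval_at p' ?y}" "p' \<noteq> 0" "xmon (cvec q c b') * eval_at p' ?y \<in> forms q n a'"
      unfolding M1_def by blast
    have "xmon (cvec q c (b + b')) = (xmon (cvec q c b) * xmon (cvec q c b') :: 'k laurent)"
      by (simp only: xmon_mult cvec_add)
    hence eq: "xmon (cvec q c (b + b')) * eval_at (p * p') ?y = (xmon (cvec q c b) * eval_at p ?y) * (xmon (cvec q c b') * eval_at p' ?y)"
      by (simp only: eval_at_mult mult.assoc mult.left_commute)
    have "{xmon (cvec q c (b + b')) * eval_at (p * p') ?y} \<in> M1"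
    proof (rule M1I)
      show "p * p' \<noteq> 0" using A(2) B(2) by simp
      show "xmon (cvec q c (b + b')) * eval_at (p * p') ?y \<in> forms q n (a + a')"
        unfolding eq by (rule forms_mult[OF A(3) B(3)])
    qed
    moreover have "{xmon (cvec q c (b + b')) * eval_at (p * p') ?y} \<subseteq> {f * g |f g. f \<in> A \<and> g \<in> B}"
    proof
      fix h assume "h \<in> {xmon (cvec q c (b + b')) * eval_at (p * p') ?y}"
      hence "h = xmon (cvec q c b) * eval_at p ?y * (xmon (cvec q c b') * eval_at p' ?y)" unfolding eq by (rule singletonD)
      moreover have "xmon (cvec q c b) * eval_at p ?y \<in> A" "xmon (cvec q c b') * eval_at p' ?y \<in> B"
        unfolding A(1) B(1) by (rule singletonI)+
      ultimately show "h \<in> {f * g |f g. f \<in> A \<and> g \<in> B}" by blast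
    qed
    ultimately show "\<exists>C\<in>M1. C \<subseteq> {f * g |f g. f \<in> A \<and> g \<in> B}" by (rule bexI[rotated])
  qed
  have M1_avoid: "\<not> A \<subseteq> (\<Union>a. V a)" if "A \<in> M1" for A
  proof -
    from that obtain b p where A: "A = {xmon (cvec q c b) * eval_at p ?y}" "p \<noteq> 0" unfolding M1_def by blast
    let ?h = "xmon (cvec q c b) * eval_at p ?y"
    have inv: "xmon (cvec q c (\<lambda>i. - b i)) * ?h = eval_at p ?y"
    proof -
      have "xmon (cvec q c (\<lambda>i. - b i)) * ?h = xmon (cvec q c (\<lambda>i. - b i) + cvec q c b) * eval_at p ?y"
        by (simp only: xmon_mult[symmetric] mult.assoc)
      also have "cvec q c (\<lambda>i. - b i) + cvec q c b = 0"
        unfolding cvec_add by (rule cvec_zero) simp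
      finally show ?thesis by simp
    qed
    show "\<not> A \<subseteq> (\<Union>a. V a)"
    proof
      assume "A \<subseteq> (\<Union>a. V a)"
      then obtain a where a: "?h \<in> V a" using A(1) by blast
      have "eval_at p ?y \<in> X c"
      proof (cases "?h = 0")
        case True
        thus ?thesis using inv X_zero[OF c] by simp
      next
        case False
        have "?h \<in> lforms q n (chart_vars q c) b"
          using R_eval_at[OF yR, of p] unfolding affine_ring_eq_lforms
          by (intro lforms_mult_cong[of "xmon (cvec q c b)" q n "chart_vars q c" b _ "chart_vars q c" "\<lambda>_. 0"])
             (auto simp: xmon_in_lforms cvec_exps c)
        hence "b k = a k" if "k \<in> {1..q}" for k
          using homogeneous_degree_unique[OF False, of q n "chart_vars q c" b "{}" a k] a that
          by (simp add: vanishing_forms_def forms_eq_lforms)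
        hence "dehomogenize q a c ?h = dehomogenize q b c ?h" by (intro dehomogenize_cong) simp
        also have "\<dots> = eval_at p ?y" unfolding dehomogenize_eq by (rule inv)
        finally show ?thesis using a c by (auto simp: vanishing_forms_def)
      qed
      thus False using transc A(2) by blast
    qed
  qed
  obtain P where *: "graded_ideal q n P \<and> (\<Union>a. V a) \<subseteq> P \<and> (\<forall>A\<in>M1. \<not> A \<subseteq> P) \<and>
    (\<forall>a b f g. f \<in> forms q n a \<longrightarrow> g \<in> forms q n b \<longrightarrow> f * g \<in> P \<longrightarrow> f \<in> P \<or> g \<in> P)"
    using graded_prime_exists[OF V_graded_ideal, of M1, OF M1_fin M1_mult M1_avoid] by (rule exE)
  have P: "graded_ideal q n P" "(\<Union>a. V a) \<subseteq> P" "\<And>A. A \<in> M1 \<Longrightarrow> \<not> A \<subseteq> P"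
    using conjunct1[OF *] conjunct1[OF conjunct2[OF *]] conjunct1[OF conjunct2[OF conjunct2[OF *]]]
    by - (assumption, assumption, blast)
  have Pprime: "\<And>a b f g. f \<in> forms q n a \<Longrightarrow> g \<in> forms q n b \<Longrightarrow> f * g \<in> P \<Longrightarrow> f \<in> P \<or> g \<in> P"
    using conjunct2[OF conjunct2[OF conjunct2[OF *]]] by blast
  let ?H = "adjoin q n P ?x (udeg i)"
  have H: "graded_ideal q n ?H" by (rule graded_ideal_adjoin[OF P(1) x])
  define M2 where "M2 = {(xmon ` exps q n {} a :: 'k laurent set) |a. \<forall>i\<in>{1..q}. 0 \<le> a i}"
  have not_H: "\<not> xmon ` exps q n {} a \<subseteq> ?H" if a: "\<forall>i\<in>{1..q}. 0 \<le> a i" for a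
  proof
    assume sub: "xmon ` exps q n {} a \<subseteq> ?H"
    \<comment> \<open>The \<open>D + 1\<close> forms \<open>h l\<close> below have cofactors in a space of dimension at most \<open>D\<close>.\<close>
    define D where "D = card (exps q n {} (a - udeg i))"
    let ?b = "a + (\<lambda>l. int D * udeg i l)"
    define h where "h l = xmon (cvec q c ?b) * ?y ^ l" for l
    have hf: "h l \<in> forms q n ?b" if l: "l \<le> D" for l
    proof -
      let ?E = "cvec q c ?b + frag_cmul (int l) (coord_exp c i j)"
      have hE: "h l = xmon ?E" by (simp only: h_def xmon_power xmon_mult)
      have "?y ^ l \<in> R c" using R_eval_at[OF yR, of "monom 1 l"] by (simp add: eval_at_monom)
      hence "h l \<in> lforms q n (chart_vars q c) ?b"
        unfolding h_def affine_ring_eq_lforms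
        by (intro lforms_mult_cong[of "xmon (cvec q c ?b)" q n "chart_vars q c" ?b _ "chart_vars q c" "\<lambda>_. 0"])
           (auto simp: xmon_in_lforms cvec_exps c)
      hence E: "?E \<in> exps q n (chart_vars q c) ?b" by (simp only: hE xmon_in_lforms)
      have "0 \<le> lookup ?E v" for v
      proof (cases "v \<in> chart_vars q c")
        case True
        then obtain k where k: "k \<in> {1..q}" "v = (k, c k)" by (auto simp: chart_vars_def)
        have ak: "0 \<le> a k" using a k(1) by blast
        have "lookup (coord_exp c i j) v \<ge> - udeg i k"
          by (auto simp: coord_exp_def lookup_minus lookup_single when_def k(2) udeg_def)
        hence "int l * lookup (coord_exp c i j) v \<ge> int l * - udeg i k" by (rule mult_left_mono) simp
        moreover have "int l * udeg i k \<le> int D * udeg i k" using l by (intro mult_right_mono) (auto simp: udeg_def)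
        ultimately show ?thesis using ak k by (simp add: lookup_add lookup_cvec)
      next
        case False thus ?thesis using E unfolding exps_def by blast
      qed
      hence "?E \<in> exps q n {} ?b" using E unfolding exps_def by blast
      thus ?thesis by (simp only: hE forms_eq_lforms xmon_in_lforms)
    qed
    have "\<exists>p w. h l = p + ?x ^ Suc D * w \<and> p \<in> P \<inter> forms q n ?b \<and> w \<in> forms q n (a - udeg i)" if l: "l \<le> D" for l
      using subsetD[OF adjoin_variable_power[OF P(1) i ci a sub] hf[OF l]] by blast
    then obtain p w where pw: "\<And>l. l \<le> D \<Longrightarrow> h l = p l + ?x ^ Suc D * w l \<and> p l \<in> P \<inter> forms q n ?b \<and> w l \<in> forms q n (a - udeg i)"
      by metis
    let ?F = "xmon ` exps q n {} (a - udeg i) :: 'k laurent set"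
    have wF: "w l \<in> L.span ?F" if "l \<le> D" for l
      using pw[OF that] lforms_subset_span[of q n "{}" "a - udeg i"] unfolding forms_eq_lforms by blast
    have "finite ?F" "card ?F \<le> D" unfolding D_def by (intro finite_imageI finite_exps card_image_le)+
    then obtain u where u: "\<exists>l\<le>D. u l \<noteq> 0" "(\<Sum>l\<le>D. laurent_scale (u l) (w l)) = 0"
      using L.dependent_sequence[of D w ?F] wF by blast
    define f where "f = (\<Sum>l\<le>D. monom (u l) l)"
    have cf: "coeff f l = (if l \<le> D then u l else 0)" for l by (simp add: f_def coeff_sum)
    have f0: "f \<noteq> 0" using u(1) cf by (metis coeff_0)
    have "degree f \<le> D" by (rule degree_le) (simp add: cf)
    hence "xmon (cvec q c ?b) * eval_at f ?y = (\<Sum>l\<le>D. laurent_scale (u l) (h l))"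
      by (simp add: eval_at_eq_sum[of f D] cf sum_distrib_left h_def flip: laurent_scale_mult_right)
    also have "\<dots> = (\<Sum>l\<le>D. laurent_scale (u l) (p l)) + ?x ^ Suc D * (\<Sum>l\<le>D. laurent_scale (u l) (w l))"
      using pw by (simp add: sum_distrib_left L.scale_right_distrib sum.distrib laurent_scale_mult_right del: power_Suc)
    also have "\<dots> = (\<Sum>l\<le>D. laurent_scale (u l) (p l))" unfolding u(2) by simp
    also have "\<dots> \<in> P \<inter> forms q n ?b"
      using pw by (intro L.subspace_sum L.subspace_scale graded_ideal_subspace[OF P(1)]) auto
    finally have "xmon (cvec q c ?b) * eval_at f ?y \<in> P \<inter> forms q n ?b" .
    thus False using P(3)[OF M1I[OF f0]] by blast
  qed
  have M2_fin: "finite A" and M2_avoid: "\<not> A \<subseteq> ?H" if "A \<in> M2" for A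
    using that not_H by (auto simp: M2_def finite_exps)
  have M2_mult: "\<exists>C\<in>M2. C \<subseteq> {f * g |f g. f \<in> A \<and> g \<in> B}" if "A \<in> M2" "B \<in> M2" for A B
  proof -
    from that obtain a b where a: "A = xmon ` exps q n {} a" "\<forall>i\<in>{1..q}. 0 \<le> a i"
      and b: "B = xmon ` exps q n {} b" "\<forall>i\<in>{1..q}. 0 \<le> b i" unfolding M2_def by blast
    have "xmon ` exps q n {} (a + b) \<subseteq> {f * g |f g. f \<in> A \<and> g \<in> B}"
    proof (rule image_subsetI)
      fix m assume "m \<in> exps q n {} (a + b)"
      then obtain m1 m2 where m: "m1 \<in> exps q n {} a" "m2 \<in> exps q n {} b" "m = m1 + m2"
        using exps_split[of m q n a b] a(2) b(2) by blast
      have "xmon m = xmon m1 * xmon m2" by (simp only: m(3) xmon_mult)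
      thus "xmon m \<in> {f * g |f g. f \<in> A \<and> g \<in> B}" using m(1,2) a(1) b(1) by blast
    qed
    moreover have "xmon ` exps q n {} (a + b) \<in> M2" unfolding M2_def using a(2) b(2) by force
    ultimately show "\<exists>C\<in>M2. C \<subseteq> {f * g |f g. f \<in> A \<and> g \<in> B}" by blast
  qed
  obtain Q where *: "graded_ideal q n Q \<and> ?H \<subseteq> Q \<and> (\<forall>A\<in>M2. \<not> A \<subseteq> Q) \<and>
    (\<forall>a b f g. f \<in> forms q n a \<longrightarrow> g \<in> forms q n b \<longrightarrow> f * g \<in> Q \<longrightarrow> f \<in> Q \<or> g \<in> Q)"
    using graded_prime_exists[OF H, of M2, OF M2_fin M2_mult M2_avoid] by (rule exE)
  have Q: "graded_ideal q n Q" "?H \<subseteq> Q" "\<And>A. A \<in> M2 \<Longrightarrow> \<not> A \<subseteq> Q"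
    using conjunct1[OF *] conjunct1[OF conjunct2[OF *]] conjunct1[OF conjunct2[OF conjunct2[OF *]]]
    by - (assumption, assumption, blast)
  have Qprime: "\<And>a b f g. f \<in> forms q n a \<Longrightarrow> g \<in> forms q n b \<Longrightarrow> f * g \<in> Q \<Longrightarrow> f \<in> Q \<or> g \<in> Q"
    using conjunct2[OF conjunct2[OF conjunct2[OF *]]] by blast
  have xQ: "?x \<in> Q" using Q(2) mem_adjoin[OF P(1), of ?x "udeg i"] by blast
  have PQ: "P \<subseteq> Q" using Q(2) subset_adjoin[OF P(1), of ?x "udeg i"] by blast
  have "\<not> xmon ` exps q n {} (\<lambda>_. 1) \<subseteq> Q" by (rule Q(3)) (auto simp: M2_def)
  then obtain m where m: "m \<in> exps q n {} (\<lambda>_. 1)" "xmon m \<notin> Q" by blast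
  obtain d where d: "d \<in> charts q n" "m - cvec q d (\<lambda>_. int 1) \<in> exps q n {} (\<lambda>i. 1 - int 1)"
    using exps_dominates_chart[OF m(1), of 1] by auto
  \<comment> \<open>A monomial of multidegree \<open>(1, \<dots>, 1)\<close> is the monomial of a chart, up to a factor of multidegree zero.\<close>
  have xdQ: "xmon (cvec q d (\<lambda>_. 1)) \<notin> Q"
  proof
    assume "xmon (cvec q d (\<lambda>_. 1)) \<in> Q"
    moreover have "xmon (m - cvec q d (\<lambda>_. int 1)) \<in> forms q n (\<lambda>i. 1 - int 1)"
      by (simp only: forms_eq_lforms xmon_in_lforms d(2))
    ultimately have "xmon (m - cvec q d (\<lambda>_. int 1)) * xmon (cvec q d (\<lambda>_. 1)) \<in> Q"
      by (intro graded_ideal_mult[OF Q(1)])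
    thus False using m(2) by (simp add: xmon_mult)
  qed
  hence xdP: "xmon (cvec q d (\<lambda>_. 1)) \<notin> P" using PQ by blast
  have xP: "?x \<notin> P"
  proof
    assume xP: "?x \<in> P"
    have "cvec q c (udeg i) = single (i, c i) 1"
    proof (rule poly_mapping_eqI)
      fix v show "lookup (cvec q c (udeg i)) v = lookup (single (i, c i) 1) v"
        using i by (cases v) (auto simp: lookup_cvec udeg_def lookup_single when_def)
    qed
    hence eq: "xmon (cvec q c (udeg i)) * eval_at 1 ?y = ?x" by (simp add: eval_at_1)
    have "{xmon (cvec q c (udeg i)) * eval_at 1 ?y} \<in> M1" by (rule M1I[where a = "udeg i"]) (simp_all only: eq x one_neq_zero not_False_eq_True)
    thus False using P(3) xP eq by auto
  qed
  \<comment> \<open>The function \<open>x / x\<^sub>i\<^sub>,\<^sub>d\<^sub>i\<close> separates the two primes of the chart \<open>d\<close>.\<close>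
  let ?z = "xmon (single (i, c i) 1 - single (i, d i) 1) :: 'k laurent"
  have di: "d i \<le> n i" using d(1) i by (auto simp: charts_def PiE_iff)
  have zR: "?z \<in> R d"
    using coord_exp_exps[OF d(1) i ci] by (simp add: affine_ring_eq_lforms xmon_in_lforms coord_exp_def)
  have xd: "xmon (single (i, d i) 1) \<in> forms q n (udeg i)"
    by (simp only: forms_eq_lforms xmon_in_lforms var_exps[where n = n, OF i di])
  have zQ: "?z \<in> localize q n d Q"
  proof -
    let ?m = "cvec q d (\<lambda>_. 1) - single (i, d i) 1"
    have "?m = cvec q d (\<lambda>k. 1 - udeg i k)"
    proof (rule poly_mapping_eqI)
      fix v show "lookup ?m v = lookup (cvec q d (\<lambda>k. 1 - udeg i k)) v"
        using i by (cases v) (auto simp: lookup_cvec udeg_def lookup_single lookup_minus when_def)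
    qed
    hence "?m \<in> exps q n {} (\<lambda>k. 1 - udeg i k)" using cvec_exps_nonneg[OF d(1)] by (simp add: udeg_def)
    hence "xmon ?m \<in> forms q n (\<lambda>k. 1 - udeg i k)" by (simp only: forms_eq_lforms xmon_in_lforms)
    hence "xmon ?m * ?x \<in> Q" by (intro graded_ideal_mult[OF Q(1)] xQ)
    moreover have "xmon ?m * ?x = xmon (cvec q d (\<lambda>_. int 1)) * ?z" by (simp add: xmon_mult algebra_simps)
    ultimately have "xmon (cvec q d (\<lambda>_. int 1)) * ?z \<in> Q" by simp
    thus ?thesis using zR unfolding localize_def by blast
  qed
  have zP: "?z \<notin> localize q n d P"
  proof
    assume "?z \<in> localize q n d P"
    then obtain K where "xmon (cvec q d (\<lambda>_. int K)) * ?z \<in> P" by (auto simp: localize_def)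
    hence "xmon (single (i, d i) 1) * (xmon (cvec q d (\<lambda>_. int K)) * ?z) \<in> P"
      by (rule graded_ideal_mult[OF P(1) xd])
    hence *: "xmon (cvec q d (\<lambda>_. int K)) * ?x \<in> P" by (simp add: xmon_mult algebra_simps)
    have "?x \<in> P \<or> xmon (cvec q d (\<lambda>_. int K)) \<in> P"
      using Pprime[OF chart_xmon_forms[OF d(1)] x *] by blast
    moreover have "xmon (cvec q d (\<lambda>_. int K)) \<notin> P"
    proof
      assume "xmon (cvec q d (\<lambda>_. int K)) \<in> P"
      hence "1 \<in> localize q n d P" unfolding localize_def using R_one by auto
      moreover have "is_prime_ideal (R d) (localize q n d P)"
        by (rule localize_is_prime[OF P(1) Pprime d(1) xdP])
      ultimately show False
        using R_one unfolding is_prime_ideal_def is_ideal_def by (metis mult.right_neutral subsetI subset_antisym)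
    qed
    ultimately show False using xP by blast
  qed
  have "X d \<subseteq> localize q n d P"
  proof
    fix f assume f: "f \<in> X d"
    then obtain K where "xmon (cvec q d (\<lambda>_. int K)) * f \<in> V (\<lambda>_. int K)"
      using clear_to_vanishing_form[OF d(1) f] by blast
    hence "xmon (cvec q d (\<lambda>_. int K)) * f \<in> P" using P(2) by blast
    thus "f \<in> localize q n d P" using f X_subset[OF d(1)] unfolding localize_def by blast
  qed
  moreover have "localize q n d P \<subset> localize q n d Q" using zP zQ PQ unfolding localize_def by blast
  moreover have "is_prime_ideal (R d) (localize q n d P)"
    by (rule localize_is_prime[OF P(1) Pprime d(1) xdP])
  moreover have "is_prime_ideal (R d) (localize q n d Q)"
    by (rule localize_is_prime[OF Q(1) Qprime d(1) xdQ])
  ultimately show False using zd d(1) unfolding zero_dimensional_def by blast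
qed

text \<open>
  Division with remainder by \<open>p\<close>.
\<close>

lemma power_in_span:
  assumes p: "p \<noteq> 0" and pX: "eval_at p y \<in> X c" and c: "c \<in> charts q n" and y: "y \<in> R c"
  shows "y ^ l \<in> L.span ((\<lambda>k. y ^ k) ` {..degree p} \<union> X c)"
proof -
  let ?S = "(\<lambda>k. y ^ k) ` {..degree p} \<union> X c"
  have "y ^ l = eval_at ((monom 1 l div p) * p + monom 1 l mod p) y" by (simp add: eval_at_monom)
  also have "\<dots> = eval_at (monom 1 l div p) y * eval_at p y + eval_at (monom 1 l mod p) y" by (simp only: eval_at_add eval_at_mult)
  also have "\<dots> \<in> L.span ?S"
  proof (rule L.span_add)
    have "eval_at (monom 1 l div p) y * eval_at p y \<in> X c" by (rule X_mult[OF c R_eval_at[OF y] pX])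
    thus "eval_at (monom 1 l div p) y * eval_at p y \<in> L.span ?S" by (intro L.span_base) blast
    have "degree (monom 1 l mod p) \<le> degree p"
      using degree_mod_less[OF p, of "monom 1 l"] by auto
    thus "eval_at (monom 1 l mod p) y \<in> L.span ?S"
      by (simp only: eval_at_eq_sum) (intro L.span_sum L.span_scale L.span_base, blast)
  qed
  finally show ?thesis .
qed

text \<open>
  Monomials in the coordinates span the chart ring, and modulo \<open>X c\<close> the exponent of each
  coordinate may be bounded by the degree of an equation for it.
\<close>

theorem chart_ring_finite:
  assumes zd: "zero_dimensional q n X" and c: "c \<in> charts q n"
  obtains F where "finite F" "R c \<subseteq> L.span (F \<union> X c)"
proof -
  have step: "\<exists>F. finite F \<and> (\<forall>m \<in> exps q n (chart_vars q c) (\<lambda>_. 0).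
      keys m \<subseteq> U \<union> chart_vars q c \<longrightarrow> xmon m \<in> L.span (F \<union> X c))" if "finite U" for U
    using that
  proof (induction U rule: finite_induct)
    case empty
    have "m = 0" if m: "m \<in> exps q n (chart_vars q c) (\<lambda>_. 0)" "keys m \<subseteq> chart_vars q c" for m
    proof (rule poly_mapping_eqI)
      fix v
      show "lookup m v = lookup 0 v"
      proof (cases "v \<in> chart_vars q c")
        case True
        then obtain i where i: "i \<in> {1..q}" "v = (i, c i)" by (auto simp: chart_vars_def)
        have "lookup m (i, j) = 0" if "j \<noteq> c i" for j
        proof -
          have "(i, j) \<notin> keys m" using m(2) that by (auto simp: chart_vars_def)
          thus ?thesis by (simp add: in_keys_iff)
        qed
        hence "gdeg n m i = (\<Sum>j=0..n i. if j = c i then lookup m (i, c i) else 0)"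
          unfolding gdeg_def by (intro sum.cong) auto
        also have "\<dots> = lookup m (i, c i)" using c i(1) by (auto simp: charts_def PiE_iff)
        finally show ?thesis using m(1) i by (simp add: exps_def)
      next
        case False
        hence "v \<notin> keys m" using m(2) by blast
        thus ?thesis by (simp add: in_keys_iff)
      qed
    qed
    moreover have "xmon 0 \<in> L.span ({1} \<union> X c)" by (rule L.span_base) simp
    ultimately have "\<forall>m \<in> exps q n (chart_vars q c) (\<lambda>_. 0).
      keys m \<subseteq> {} \<union> chart_vars q c \<longrightarrow> xmon m \<in> L.span ({1} \<union> X c)"
      unfolding Un_empty_left by blast
    thus ?case by blast
  next
    case (insert v U)
    then obtain F where F: "finite F" "\<And>m. m \<in> exps q n (chart_vars q c) (\<lambda>_. 0) \<Longrightarrow>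
      keys m \<subseteq> U \<union> chart_vars q c \<Longrightarrow> xmon m \<in> L.span (F \<union> X c)" by blast
    show ?case
    proof (cases "v \<in> vars q n - chart_vars q c")
      case False
      have "xmon m \<in> L.span (F \<union> X c)" if m: "m \<in> exps q n (chart_vars q c) (\<lambda>_. 0)"
        "keys m \<subseteq> insert v U \<union> chart_vars q c" for m
        using m False by (intro F(2)) (auto simp: exps_def)
      thus ?thesis using F(1) by blast
    next
      case True
      then obtain i j where ij: "v = (i, j)" "i \<in> {1..q}" "j \<le> n i" by (auto simp: vars_def)
      let ?y = "xmon (coord_exp c i j) :: 'k laurent"
      obtain p where p: "p \<noteq> 0" "eval_at p ?y \<in> X c" using coordinate_algebraic[OF zd c ij(2,3)] by blast
      have yR: "?y \<in> R c" by (simp only: affine_ring_eq_lforms xmon_in_lforms coord_exp_exps[OF c ij(2,3)])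
      have ykR: "?y ^ k \<in> R c" for k by (induction k) (auto intro: R_one R_mult yR)
      let ?F = "(\<lambda>(k, f). ?y ^ k * f) ` ({..degree p} \<times> F)"
      have yspan: "?y ^ k * u \<in> L.span (?F \<union> X c)" if "k \<le> degree p" "u \<in> L.span (F \<union> X c)" for k u
        using that(2)
      proof (induction rule: L.span_induct_alt)
        case base thus ?case by (simp add: L.span_zero)
      next
        case (step a b w)
        have "?y ^ k * b \<in> ?F \<union> X c"
        proof (cases "b \<in> X c")
          case True thus ?thesis using X_mult[OF c ykR] by blast
        next
          case False
          hence "(k, b) \<in> {..degree p} \<times> F" using step(1) that(1) by blast
          thus ?thesis by (intro UnI1 image_eqI[of _ _ "(k, b)"]) auto
        qed
        hence "?y ^ k * b \<in> L.span (?F \<union> X c)" by (rule L.span_base)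
        hence "laurent_scale a (?y ^ k * b) + ?y ^ k * w \<in> L.span (?F \<union> X c)"
          using step(2) by (intro L.span_add L.span_scale)
        thus ?case by (simp only: distrib_left laurent_scale_mult_right)
      qed
      have "xmon m \<in> L.span (?F \<union> X c)" if m: "m \<in> exps q n (chart_vars q c) (\<lambda>_. 0)"
        "keys m \<subseteq> insert v U \<union> chart_vars q c" for m
      proof -
        have v0: "lookup m v \<ge> 0" using m(1) True unfolding exps_def by blast
        define l where "l = nat (lookup m v)"
        let ?m = "m - frag_cmul (int l) (coord_exp c i j)"
        have ci: "(i, c i) \<in> chart_vars q c" using ij(2) by (auto simp: chart_vars_def)
        have ly: "lookup (coord_exp c i j) w = (if w = v then 1 else if w = (i, c i) then -1 else 0)" for w
          using True ci by (auto simp: coord_exp_def lookup_minus lookup_single when_def ij(1))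
        have lm: "lookup ?m w = (if w = v then 0 else if w = (i, c i) then lookup m w + int l else lookup m w)" for w
          using v0 by (auto simp: lookup_minus ly l_def)
        have keys: "keys ?m \<subseteq> U \<union> chart_vars q c"
          using m(2) ci by (auto simp: in_keys_iff lm split: if_splits)
        have "keys ?m \<subseteq> vars q n"
          using m(1) coord_exp_exps[OF c ij(2,3)] keys_diff[of m "frag_cmul (int l) (coord_exp c i j)"]
            keys_cmul[of "int l" "coord_exp c i j"] unfolding exps_def by blast
        moreover have "gdeg n (frag_cmul (int l) (coord_exp c i j)) k = 0" if "k \<in> {1..q}" for k
          using coord_exp_exps[OF c ij(2,3)] that by (simp add: exps_def gdeg_def sum_distrib_left[symmetric])
        moreover have "lookup ?m w \<ge> 0" if "w \<notin> chart_vars q c" for w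
        proof -
          have "lookup m w \<ge> 0" using m(1) that unfolding exps_def by blast
          thus ?thesis using that ci by (auto simp: lm)
        qed
        ultimately have m': "?m \<in> exps q n (chart_vars q c) (\<lambda>_. 0)"
          using m(1) unfolding exps_def by (simp add: gdeg_diff)
        have u: "xmon ?m \<in> L.span (F \<union> X c)" by (rule F(2)[OF m' keys])
        have uR: "xmon ?m \<in> R c" by (simp only: affine_ring_eq_lforms xmon_in_lforms m')
        have "w * xmon ?m \<in> L.span (?F \<union> X c)" if "w \<in> L.span ((\<lambda>k. ?y ^ k) ` {..degree p} \<union> X c)" for w
          using that
        proof (induction rule: L.span_induct_alt)
          case base thus ?case by (simp add: L.span_zero)
        next
          case (step a b w)
          have "b * xmon ?m \<in> L.span (?F \<union> X c)"
          proof (cases "b \<in> X c")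
            case True
            have "xmon ?m * b \<in> X c" by (rule X_mult[OF c uR True])
            thus ?thesis by (intro L.span_base) (simp add: mult.commute)
          next
            case False
            then obtain k where "k \<le> degree p" "b = ?y ^ k" using step(1) by blast
            thus ?thesis using yspan[OF _ u] by blast
          qed
          hence "laurent_scale a (b * xmon ?m) + w * xmon ?m \<in> L.span (?F \<union> X c)"
            using step(2) by (intro L.span_add L.span_scale)
          thus ?case by (simp only: distrib_right laurent_scale_mult_left)
        qed
        from this[OF power_in_span[OF p c yR]] have "?y ^ l * xmon ?m \<in> L.span (?F \<union> X c)" .
        moreover have "?y ^ l * xmon ?m = xmon m" by (simp add: xmon_power xmon_mult)
        ultimately show ?thesis by simp
      qed
      moreover have "finite ?F" using F(1) by simp
      ultimately show ?thesis by blast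
    qed
  qed
  have "finite (vars q n)" by (simp add: vars_def)
  from step[OF this] obtain F where F: "finite F" "\<And>m. m \<in> exps q n (chart_vars q c) (\<lambda>_. 0) \<Longrightarrow>
      keys m \<subseteq> vars q n \<union> chart_vars q c \<Longrightarrow> xmon m \<in> L.span (F \<union> X c)" by blast
  have "xmon ` exps q n (chart_vars q c) (\<lambda>_. 0) \<subseteq> L.span (F \<union> X c)"
    using F(2) by (auto simp: exps_def)
  hence "L.span (xmon ` exps q n (chart_vars q c) (\<lambda>_. 0)) \<subseteq> L.span (F \<union> X c)"
    by (rule L.span_minimal) (rule L.subspace_span)
  hence "R c \<subseteq> L.span (F \<union> X c)"
    unfolding affine_ring_eq_lforms by (rule subset_trans[OF lforms_subset_span])
  thus ?thesis using that F(1) by blast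
qed

end

section \<open>The Hilbert function and the generic linear form\<close>

definition fscale :: "'k::field \<Rightarrow> ((nat \<Rightarrow> nat) \<Rightarrow> 'k laurent) \<Rightarrow> ((nat \<Rightarrow> nat) \<Rightarrow> 'k laurent)" where
  "fscale k s = (\<lambda>c. laurent_scale k (s c))"

global_interpretation F: vector_space fscale
  by unfold_locales (simp_all add: fscale_def fun_eq_iff L.scale_right_distrib L.scale_left_distrib)

global_interpretation LF: vector_space_pair laurent_scale fscale by unfold_locales

definition delta :: "(nat \<Rightarrow> nat) \<Rightarrow> 'k::field laurent \<Rightarrow> ((nat \<Rightarrow> nat) \<Rightarrow> 'k laurent)" where
  "delta c f = (\<lambda>d. if d = c then f else 0)"

lemma delta_linear: "Vector_Spaces.linear laurent_scale fscale (delta c)"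
  by (auto simp: Vector_Spaces.linear_iff L.vector_space_axioms F.vector_space_axioms delta_def fscale_def fun_eq_iff)

locale zero_dim_subscheme = subscheme +
  assumes zd: "zero_dimensional q n X"
begin

text \<open>
  The values outside the index set of charts are arbitrary, both here and in \<open>ideal_prod\<close>, so they disappear in
  the quotient.
\<close>

definition chart_prod :: "((nat \<Rightarrow> nat) \<Rightarrow> 'a laurent) set" where
  "chart_prod = {s. \<forall>c\<in>charts q n. s c \<in> R c}"

definition ideal_prod :: "((nat \<Rightarrow> nat) \<Rightarrow> 'a laurent) set" where
  "ideal_prod = {s. \<forall>c\<in>charts q n. s c \<in> X c}"

lemma chart_prod_fin: "\<exists>F. finite F \<and> chart_prod \<subseteq> F.span (F \<union> ideal_prod)"
proof -
  have "\<forall>c\<in>charts q n. \<exists>F. finite F \<and> R c \<subseteq> L.span (F \<union> X c)" using chart_ring_finite[OF zd] by metis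
  then obtain F where F: "\<And>c. c \<in> charts q n \<Longrightarrow> finite (F c) \<and> R c \<subseteq> L.span (F c \<union> X c)" by metis
  let ?F = "\<Union>c\<in>charts q n. delta c ` F c"
  have "chart_prod \<subseteq> F.span (?F \<union> ideal_prod)"
  proof
    fix s assume s: "s \<in> chart_prod"
    have d: "delta c (s c) \<in> F.span (?F \<union> ideal_prod)" if c: "c \<in> charts q n" for c
    proof -
      interpret d: Vector_Spaces.linear laurent_scale fscale "delta c" by (rule delta_linear)
      have "s c \<in> L.span (F c \<union> X c)" using F[OF c] s c by (auto simp: chart_prod_def)
      hence "delta c (s c) \<in> F.span (delta c ` (F c \<union> X c))" using d.span_image by blast
      moreover have "delta c ` (F c \<union> X c) \<subseteq> ?F \<union> ideal_prod"
        using c X_zero by (auto simp: ideal_prod_def delta_def)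
      ultimately show ?thesis using F.span_mono by blast
    qed
    define r where "r = s - (\<Sum>c\<in>charts q n. delta c (s c))"
    have r: "r d = 0" if "d \<in> charts q n" for d
    proof -
      have "(\<Sum>c\<in>charts q n. delta c (s c)) d = (\<Sum>c\<in>charts q n. delta c (s c) d)"
        by (induction rule: infinite_finite_induct) simp_all
      also have "\<dots> = s d" using that finite_charts by (simp add: delta_def)
      finally show ?thesis by (simp add: r_def)
    qed
    have "r \<in> ideal_prod" using X_zero by (simp add: ideal_prod_def r)
    hence "r \<in> F.span (?F \<union> ideal_prod)" by (intro F.span_base) simp
    from F.span_add[OF this F.span_sum[of "charts q n" "\<lambda>c. delta c (s c)", OF d]]
    show "s \<in> F.span (?F \<union> ideal_prod)" by (simp add: r_def)
  qed
  moreover have "finite ?F" using F finite_charts by auto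
  ultimately show ?thesis by blast
qed

sublocale algebra_mod_ideal fscale chart_prod ideal_prod
proof unfold_locales
  show "fscale c (x * y) = fscale c x * y" for c :: 'a and x y
    by (simp add: fscale_def fun_eq_iff laurent_scale_mult_left)
  show "F.subspace chart_prod"
    by (rule F.subspaceI) (auto simp: chart_prod_def fscale_def L.subspace_0[OF R_subspace] L.subspace_add[OF R_subspace] L.subspace_scale[OF R_subspace])
  show "F.subspace ideal_prod"
    by (rule F.subspaceI) (auto simp: ideal_prod_def fscale_def X_zero X_add L.subspace_scale[OF X_subspace])
  show "1 \<in> chart_prod" by (simp add: chart_prod_def R_one)
  show "x * y \<in> chart_prod" if "x \<in> chart_prod" "y \<in> chart_prod" for x y using that by (simp add: chart_prod_def R_mult)
  show "ideal_prod \<subseteq> chart_prod" using X_subset by (auto simp: chart_prod_def ideal_prod_def)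
  show "x * y \<in> ideal_prod" if "x \<in> chart_prod" "y \<in> ideal_prod" for x y using that X_mult by (simp add: chart_prod_def ideal_prod_def)
  show "\<exists>F. finite F \<and> chart_prod \<subseteq> F.span (F \<union> ideal_prod)" by (rule chart_prod_fin)
qed

text \<open>
  The vanishing forms are by definition those mapped into \<open>ideal_prod\<close>, which identifies forms modulo vanishing forms with a subspace of \<open>chart_prod\<close> modulo \<open>ideal_prod\<close>.
\<close>

definition dehom :: "(nat \<Rightarrow> int) \<Rightarrow> 'a laurent \<Rightarrow> ((nat \<Rightarrow> nat) \<Rightarrow> 'a laurent)" where
  "dehom a f = (\<lambda>c. dehomogenize q a c f)"

definition G :: "(nat \<Rightarrow> int) \<Rightarrow> ((nat \<Rightarrow> nat) \<Rightarrow> 'a laurent) set" where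
  "G a = dehom a ` forms q n a"

lemma dehom_linear: "Vector_Spaces.linear laurent_scale fscale (dehom a)"
  by (simp add: Vector_Spaces.linear_iff L.vector_space_axioms F.vector_space_axioms dehom_def fscale_def fun_eq_iff
      dehomogenize_eq distrib_left laurent_scale_mult_right)

lemma dehom_mult: "dehom (a + b) (f * g) = dehom a f * dehom b g"
  by (simp only: dehom_def fun_eq_iff dehomogenize_mult times_fun_def) simp

lemma dehom_in_chart_prod: "f \<in> forms q n a \<Longrightarrow> dehom a f \<in> chart_prod"
  using dehomogenize_in[of _ q n f "{}" a] by (simp add: chart_prod_def dehom_def affine_ring_eq_lforms forms_eq_lforms)

lemma G_chart_prod: "G a \<subseteq> chart_prod" using dehom_in_chart_prod by (auto simp: G_def)

lemma forms_subspace: "L.subspace (forms q n a :: 'a laurent set)"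
  unfolding forms_eq_lforms by (rule lforms_subspace)

lemma G_subspace: "F.subspace (G a)"
proof -
  interpret dehom: Vector_Spaces.linear laurent_scale fscale "dehom a" by (rule dehom_linear)
  show ?thesis unfolding G_def by (rule dehom.subspace_image[OF forms_subspace])
qed

lemma G_mult: "x \<in> G a \<Longrightarrow> y \<in> G b \<Longrightarrow> x * y \<in> G (a + b)"
proof -
  assume "x \<in> G a" "y \<in> G b"
  then obtain f g where fg: "f \<in> forms q n a" "x = dehom a f" "g \<in> forms q n b" "y = dehom b g" by (auto simp: G_def)
  have "dehom (a + b) (f * g) \<in> G (a + b)" unfolding G_def by (intro imageI forms_mult fg)
  thus ?thesis by (simp only: fg dehom_mult)
qed

lemma G_cong: "(\<And>i. i \<in> {1..q} \<Longrightarrow> a i = b i) \<Longrightarrow> G a = G b"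
proof -
  assume ab: "\<And>i. i \<in> {1..q} \<Longrightarrow> a i = b i"
  have "(forms q n a :: 'a laurent set) = forms q n b"
    unfolding forms_eq_lforms
  proof (intro subset_antisym subsetI)
    fix f :: "'a laurent"
    show "f \<in> lforms q n {} b" if "f \<in> lforms q n {} a" by (rule lforms_cong[OF that subset_refl ab])
    show "f \<in> lforms q n {} a" if "f \<in> lforms q n {} b" by (rule lforms_cong[OF that subset_refl ab[symmetric]])
  qed
  moreover have "dehom a = dehom b" unfolding dehom_def by (intro ext dehomogenize_cong ab)
  ultimately show ?thesis by (simp add: G_def)
qed

lemma hilbert_fun_eq_rk: "hilbert_fun q n X a = rk (G a)"
proof -
  have lin: "Vector_Spaces.linear laurent_scale fscale (proj \<circ> dehom a)"
    using dehom_linear[of a] proj(1) by (simp add: Vector_Spaces.linear_iff)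
  have "quot_dim laurent_scale (forms q n a) (V a) = F.dim ((proj \<circ> dehom a) ` forms q n a)"
  proof (rule LF.quot_dim_eq_dim_image[OF lin forms_subspace])
    show "V a \<subseteq> forms q n a" by (auto simp: vanishing_forms_def)
    show "(proj \<circ> dehom a) f = 0 \<longleftrightarrow> f \<in> V a" if "f \<in> forms q n a" for f
      using that unfolding o_apply proj(3) by (simp add: ideal_prod_def dehom_def vanishing_forms_def)
    show "F.fin_dim ((proj \<circ> dehom a) ` forms q n a)"
      using fin_dim_proj[OF G_chart_prod[of a]] by (simp add: G_def image_comp)
  qed
  thus ?thesis unfolding hilbert_fun_def ideal_of_forms rk_def G_def by (simp add: image_comp)
qed

text \<open>
  The form with indeterminate coefficients \<open>t ^ j\<close>. It stands in for a linear form that vanishes at no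
  point of \<open>X\<close>.
\<close>

definition generic_form :: "nat \<Rightarrow> ((nat \<Rightarrow> nat) \<Rightarrow> 'a laurent) poly" where
  "generic_form i = (\<Sum>j\<le>n i. monom (dehom (udeg i) (xmon (single (i, j) 1))) j)"

lemma coeff_generic_form:
  "coeff (generic_form i) j = (if j \<le> n i then dehom (udeg i) (xmon (single (i, j) 1)) else 0)"
  by (simp add: generic_form_def coeff_sum)

lemma generic_form_G: "i \<in> {1..q} \<Longrightarrow> coeff (generic_form i) j \<in> G (udeg i)"
  unfolding coeff_generic_form G_def
  using F.subspace_0[OF G_subspace, of "udeg i"] var_exps[where n = n and q = q and i = i and j = j and T = "{}"]
  by (auto simp: G_def forms_eq_lforms xmon_in_lforms)

text \<open>
  On the chart \<open>c\<close> the coefficient of \<open>t ^ c i\<close> is \<open>1\<close>. So the coefficients, multiplied with the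
  indicator functions of the sets of charts with a given value of \<open>c i\<close>, add up to \<open>1\<close>.
\<close>

lemma generic_form_regular:
  assumes i: "i \<in> {1..q}" shows "regular (generic_form i)"
proof (rule regular_of_unit_content)
  let ?f = "generic_form i"
  let ?z = "\<lambda>k. (\<lambda>c. if c i = k then 1 else 0) :: (nat \<Rightarrow> nat) \<Rightarrow> 'a laurent"
  show "?f \<in> polys_over chart_prod" using generic_form_G[OF i] G_chart_prod by (auto simp: polys_over_def)
  show "?z k \<in> chart_prod" for k by (auto simp: chart_prod_def R_one L.subspace_0[OF R_subspace])
  have one: "coeff ?f (c i) c = 1" if c: "c \<in> charts q n" for c
  proof -
    have "c i \<le> n i" using c i by (auto simp: charts_def PiE_iff)
    moreover have "cvec q c (\<lambda>k. - udeg i k) + single (i, c i) 1 = 0"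
    proof (rule poly_mapping_eqI)
      fix v show "lookup (cvec q c (\<lambda>k. - udeg i k) + single (i, c i) 1) v = lookup 0 v"
        using i by (cases v) (auto simp: lookup_add lookup_cvec lookup_single when_def udeg_def)
    qed
    ultimately show ?thesis by (simp add: coeff_generic_form dehom_def dehomogenize_eq xmon_mult)
  qed
  define r where "r = (\<Sum>k\<le>degree ?f. ?z k * coeff ?f k) - 1"
  have r: "r c = 0" if c: "c \<in> charts q n" for c
  proof -
    have "coeff ?f (c i) \<noteq> 0"
    proof
      assume "coeff ?f (c i) = 0"
      hence "coeff ?f (c i) c = 0" by simp
      thus False using one[OF c] by simp
    qed
    hence ci: "c i \<le> degree ?f" by (rule le_degree)
    have "(\<Sum>k\<le>degree ?f. ?z k * coeff ?f k) c = (\<Sum>k\<le>degree ?f. (?z k * coeff ?f k) c)"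
      by (induction rule: infinite_finite_induct) simp_all
    also have "\<dots> = (\<Sum>k\<le>degree ?f. if k = c i then coeff ?f (c i) c else 0)"
      by (intro sum.cong) auto
    also have "\<dots> = 1" using ci one[OF c] by simp
    finally show ?thesis by (simp add: r_def)
  qed
  have "r \<in> ideal_prod" using X_zero by (simp add: ideal_prod_def r)
  thus "(\<Sum>k\<le>degree ?f. ?z k * coeff ?f k) - 1 \<in> ideal_prod" unfolding r_def .
qed

lemma regular_form_exists:
  assumes "\<forall>i\<in>{1..q}. 0 \<le> b i"
  shows "\<exists>f. regular f \<and> (\<forall>k. coeff f k \<in> G b)"
  using assms
proof (induction b rule: multidegree_induct)
  case (cong a b)
  thus ?case using G_cong[of a b] by auto
next
  case zero
  have "1 = dehom (\<lambda>_. 0) 1" by (simp add: dehom_def dehomogenize_eq cvec_zero fun_eq_iff)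
  hence "1 \<in> G (\<lambda>_. 0)" unfolding G_def forms_eq_lforms using one_in_lforms by blast
  hence "\<forall>k. coeff 1 k \<in> G (\<lambda>_. 0)" using F.subspace_0[OF G_subspace] by (simp add: coeff_1)
  thus ?case using regular_1 by blast
next
  case (step a i)
  from step(3) obtain f where f: "regular f" "\<forall>k. coeff f k \<in> G a" by (elim exE conjE)
  have "coeff (f * generic_form i) k \<in> G (a + udeg i)" for k
    unfolding coeff_mult using f(2) generic_form_G[OF step(2)]
    by (intro F.subspace_sum[OF G_subspace] G_mult) auto
  hence "\<forall>k. coeff (f * generic_form i) k \<in> G (a + udeg i)" ..
  with regular_mult[OF f(1) generic_form_regular[OF step(2)]]
  have "regular (f * generic_form i) \<and> (\<forall>k. coeff (f * generic_form i) k \<in> G (a + udeg i))" ..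
  thus ?case by (rule exI)
qed

lemma rk_G_mono: "i \<in> {1..q} \<Longrightarrow> rk (G a) \<le> rk (G (a + udeg i))"
proof (rule rk_le_of_regular[OF generic_form_regular G_subspace G_chart_prod G_subspace G_chart_prod])
  fix g k assume i: "i \<in> {1..q}" and "g \<in> G a"
  from G_mult[OF this(2) generic_form_G[OF i]]
  show "proj (coeff (generic_form i) k * g) \<in> proj ` G (a + udeg i)" by (simp add: mult.commute)
qed

lemma G_span:
  assumes "\<forall>i\<in>{1..q}. 0 \<le> a i" "\<forall>i\<in>{1..q}. 0 \<le> b i"
  shows "G (b + a) \<subseteq> F.span {u * g |u g. u \<in> dehom b ` xmon ` exps q n {} b \<and> g \<in> G a}" (is "_ \<subseteq> F.span ?S")
proof -
  interpret dehom: Vector_Spaces.linear laurent_scale fscale "dehom (b + a)" by (rule dehom_linear)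
  have "G (b + a) \<subseteq> dehom (b + a) ` L.span (xmon ` exps q n {} (b + a))"
    unfolding G_def forms_eq_lforms by (intro image_mono lforms_subset_span)
  also have "\<dots> = F.span (dehom (b + a) ` xmon ` exps q n {} (b + a))" by (rule dehom.span_image[symmetric])
  also have "\<dots> \<subseteq> F.span ?S"
  proof (rule F.span_mono, rule subsetI)
    fix y assume "y \<in> dehom (b + a) ` xmon ` exps q n {} (b + a)"
    then obtain m where m: "m \<in> exps q n {} (b + a)" "y = dehom (b + a) (xmon m)" by blast
    obtain m1 m2 where m12: "m1 \<in> exps q n {} b" "m2 \<in> exps q n {} a" "m = m1 + m2"
      using exps_split[OF m(1)] assms by blast
    have "y = dehom b (xmon m1) * dehom a (xmon m2)"
      by (simp only: m(2) m12(3) dehom_mult[symmetric] xmon_mult)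
    moreover have "dehom a (xmon m2) \<in> G a"
      unfolding G_def forms_eq_lforms by (intro imageI) (simp only: xmon_in_lforms m12(2))
    ultimately show "y \<in> ?S" using m12(1) by blast
  qed
  finally show ?thesis .
qed

text \<open>
  Equality of the ranks means that multiplication by the generic form from \<open>G a\<close> to \<open>G (a + udeg i)\<close> is
  bijective over the rational functions in \<open>t\<close>. It stays surjective in multidegree \<open>a + b\<close>, because forms of multidegree \<open>b + (a + udeg i)\<close> are combinations of monomials of
  multidegree \<open>b\<close> times forms of multidegree \<open>a + udeg i\<close>.
\<close>

lemma rk_G_stable:
  assumes a: "\<forall>i\<in>{1..q}. 0 \<le> a i" and b: "\<forall>i\<in>{1..q}. 0 \<le> b i" and i: "i \<in> {1..q}"
    and eq: "rk (G a) = rk (G (a + udeg i))"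
  shows "rk (G (a + b)) = rk (G (a + b + udeg i))"
proof -
  have ai: "\<forall>k\<in>{1..q}. 0 \<le> (a + udeg i) k" using a by (simp add: udeg_def)
  have fG: "proj (coeff (generic_form i) k * g) \<in> proj ` G (c + udeg i)" if "g \<in> G c" for g k c
    using G_mult[OF that generic_form_G[OF i], of k] by (simp add: mult.commute)
  let ?B = "dehom b ` xmon ` exps q n {} b :: ((nat \<Rightarrow> nat) \<Rightarrow> 'a laurent) set"
  have BG: "?B \<subseteq> G b" by (auto simp: G_def forms_eq_lforms xmon_in_lforms)
  have "rk (G (b + (a + udeg i))) \<le> rk (G (b + a))"
  proof (rule rk_le_of_stable[where B = ?B, OF generic_form_regular[OF i] G_subspace G_chart_prod G_subspace G_chart_prod fG eq])
    show "finite ?B" by (intro finite_imageI finite_exps)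
    show "?B \<subseteq> chart_prod" using BG G_chart_prod by blast
    show "u * g \<in> G (b + a)" if "u \<in> ?B" "g \<in> G a" for u g using that BG by (intro G_mult) auto
    show "G (b + (a + udeg i)) \<subseteq> F.span {u * g |u g. u \<in> ?B \<and> g \<in> G (a + udeg i)}" by (rule G_span[OF ai b])
    show "proj (coeff (generic_form i) k * h) \<in> proj ` G (b + (a + udeg i))" if "h \<in> G (b + a)" for h k
      using fG[OF that] by (simp only: add.assoc)
  qed (assumption | rule G_subspace G_chart_prod)+
  moreover have "rk (G (a + b)) \<le> rk (G (a + b + udeg i))" by (rule rk_G_mono[OF i])
  ultimately show ?thesis by (simp add: ac_simps)
qed

lemma rk_G_bounded: "rk (G a) \<le> rk chart_prod" by (rule rk_mono[OF subset_refl G_chart_prod])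

lemma rk_G_negative: "i \<in> {1..q} \<Longrightarrow> a i < 0 \<Longrightarrow> rk (G a) = 0"
proof -
  assume i: "i \<in> {1..q}" "a i < 0"
  have "exps q n {} a = {}"
  proof (rule ccontr)
    assume "exps q n {} a \<noteq> {}"
    then obtain m where m: "m \<in> exps q n {} a" by blast
    hence "gdeg n m i \<ge> 0" unfolding gdeg_def by (intro sum_nonneg) (simp add: exps_def)
    thus False using m i by (simp add: exps_def)
  qed
  hence "forms q n a = ({0} :: 'a laurent set)"
    by (auto simp: forms_eq_lforms lforms_def)
  hence "G a \<subseteq> ideal_prod" by (auto simp: G_def dehom_def dehomogenize_eq ideal_prod_def X_zero)
  hence "proj ` G a \<subseteq> {0}" by (auto simp: proj(3))
  hence "proj ` G a \<subseteq> F.span {}" by simp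
  from F.dim_le_card[OF this] show ?thesis by (simp add: rk_def)
qed

text \<open>
  \<open>X\<close> is nonempty, so the constant \<open>1\<close> does not vanish on it.
\<close>

lemma rk_G_zero: "rk (G (\<lambda>_. 0)) \<ge> 1"
proof -
  obtain c where c: "c \<in> charts q n" "X c \<noteq> R c" using zd by (auto simp: zero_dimensional_def)
  have "1 \<notin> X c"
  proof
    assume "1 \<in> X c"
    hence "R c \<subseteq> X c" using X_mult[OF c(1), of _ 1] by auto
    thus False using c X_subset by blast
  qed
  hence "1 \<notin> ideal_prod" using c(1) by (auto simp: ideal_prod_def)
  hence p1: "proj 1 \<noteq> 0" by (simp add: proj(3))
  have "1 = dehom (\<lambda>_. 0) 1" by (simp add: dehom_def dehomogenize_eq cvec_zero fun_eq_iff)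
  hence "1 \<in> G (\<lambda>_. 0)" unfolding G_def forms_eq_lforms using one_in_lforms by blast
  hence "{proj 1} \<subseteq> F.span (proj ` G (\<lambda>_. 0))" by (auto intro: F.span_base)
  from F.dim_mono_fin[OF this fin_dim_proj[OF G_chart_prod]]
  have "F.dim {proj 1} \<le> rk (G (\<lambda>_. 0))" by (simp add: rk_def)
  moreover have "F.dim {proj 1} = card {proj 1}"
    using p1 by (intro F.dim_eq_card_independent) (simp add: F.dependent_single)
  ultimately show ?thesis by simp
qed

end

section \<open>Functions on the subscheme\<close>

context zero_dim_subscheme
begin

text \<open>
  Representatives of global functions on \<open>X\<close>, with arbitrary values outside the index set of charts.
\<close>

definition compat :: "((nat \<Rightarrow> nat) \<Rightarrow> 'a laurent) set" where
  "compat = {s \<in> chart_prod. \<forall>c\<in>charts q n. \<forall>d\<in>charts q n. s c - s d \<in> ideal_generated (overlap_ring q n c d) (X c)}"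

abbreviation OX :: "(nat \<Rightarrow> nat) \<Rightarrow> (nat \<Rightarrow> nat) \<Rightarrow> 'a laurent set" where
  "OX c d \<equiv> ideal_generated (overlap_ring q n c d) (X c)"

lemma OX_zero: "c \<in> charts q n \<Longrightarrow> d \<in> charts q n \<Longrightarrow> 0 \<in> OX c d"
  and OX_add: "c \<in> charts q n \<Longrightarrow> d \<in> charts q n \<Longrightarrow> x \<in> OX c d \<Longrightarrow> y \<in> OX c d \<Longrightarrow> x + y \<in> OX c d"
  and OX_mult: "c \<in> charts q n \<Longrightarrow> d \<in> charts q n \<Longrightarrow> r \<in> overlap_ring q n c d \<Longrightarrow> x \<in> OX c d \<Longrightarrow> r * x \<in> OX c d"
  using overlap_X[of c d] unfolding is_ideal_def by blast+

lemma R_overlap: "R c \<subseteq> overlap_ring q n c d" "R d \<subseteq> overlap_ring q n c d"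
  unfolding affine_ring_eq_lforms by (auto elim!: lforms_cong)

lemma OX_subspace: "c \<in> charts q n \<Longrightarrow> d \<in> charts q n \<Longrightarrow> L.subspace (OX c d)"
proof (rule L.subspaceI)
  assume *: "c \<in> charts q n" "d \<in> charts q n"
  fix k x assume "x \<in> OX c d"
  thus "laurent_scale k x \<in> OX c d"
    unfolding laurent_scale_def using R_overlap(1)[of c d] R_const[of k c] by (intro OX_mult *) auto
qed (auto simp: OX_zero OX_add)

lemma compat_subspace: "F.subspace compat"
proof (rule F.subspaceI)
  show "0 \<in> compat" using F.subspace_0[OF A_subspace] OX_zero by (simp add: compat_def)
next
  fix s t assume st: "s \<in> compat" "t \<in> compat"
  have "(s + t) c - (s + t) d \<in> OX c d" if "c \<in> charts q n" "d \<in> charts q n" for c d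
  proof -
    have eq: "(s + t) c - (s + t) d = (s c - s d) + (t c - t d)" by simp
    have "s c - s d \<in> OX c d" "t c - t d \<in> OX c d" using st that by (auto simp: compat_def)
    thus ?thesis unfolding eq by (rule OX_add[OF that])
  qed
  thus "s + t \<in> compat" using st F.subspace_add[OF A_subspace] by (simp add: compat_def)
next
  fix k s assume s: "s \<in> compat"
  have "fscale k s c - fscale k s d \<in> OX c d" if "c \<in> charts q n" "d \<in> charts q n" for c d
  proof -
    have "fscale k s c - fscale k s d = laurent_scale k (s c - s d)" by (simp add: fscale_def L.scale_right_diff_distrib)
    moreover have "s c - s d \<in> OX c d" using s that by (auto simp: compat_def)
    ultimately show ?thesis using L.subspace_scale[OF OX_subspace[OF that]] by simp
  qed
  thus "fscale k s \<in> compat" using s F.subspace_scale[OF A_subspace] by (simp add: compat_def)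
qed

lemma compat_chart_prod: "compat \<subseteq> chart_prod" by (auto simp: compat_def)

lemma scheme_length_eq_rk: "scheme_length q n X = rk compat"
proof -
  let ?S = "section_reps q n X"
  have S: "?S = {s \<in> compat. \<forall>c. c \<notin> charts q n \<longrightarrow> s c = 0}"
    by (auto simp: section_reps_def compat_def chart_prod_def)
  have Ssub: "F.subspace ?S"
    using compat_subspace unfolding S F.subspace_def by (auto simp: fscale_def)
  have im: "proj ` ?S = proj ` compat"
  proof (intro subset_antisym image_subsetI)
    show "proj s \<in> proj ` compat" if "s \<in> ?S" for s using that S by blast
    fix s assume s: "s \<in> compat"
    define t where "t = (\<lambda>c. if c \<in> charts q n then s c else 0)"
    have "t \<in> ?S" using s unfolding S compat_def chart_prod_def t_def by auto
    moreover have "s - t \<in> ideal_prod" using X_zero by (simp add: ideal_prod_def t_def)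
    hence "proj s = proj t" by (simp add: proj_eq_iff)
    ultimately show "proj s \<in> proj ` ?S" by blast
  qed
  interpret FF: vector_space_pair fscale fscale by unfold_locales
  have "quot_dim fscale ?S (null_section_reps q n X) = F.dim (proj ` ?S)"
  proof (rule FF.quot_dim_eq_dim_image[OF proj(1) Ssub])
    show "null_section_reps q n X \<subseteq> ?S" by (auto simp: null_section_reps_def)
    show "proj s = 0 \<longleftrightarrow> s \<in> null_section_reps q n X" if "s \<in> ?S" for s
      using that unfolding proj(3) by (simp add: ideal_prod_def null_section_reps_def)
    show "F.fin_dim (proj ` ?S)" unfolding im by (rule fin_dim_proj[OF compat_chart_prod])
  qed
  moreover have "(\<lambda>(k::'a) s c. laurent_scale k (s c)) = fscale" by (simp add: fscale_def fun_eq_iff)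
  ultimately show ?thesis unfolding scheme_length_def rk_def im by simp
qed

text \<open>
  Locally at a chart \<open>d\<close> the product \<open>s d * x\<^sup>m\<close> is a form as soon as \<open>m\<close> contains a sufficiently high power
  of \<open>x\<^sub>d\<close>. The same form represents the product in every other chart \<open>c\<close>, as \<open>s c - s d\<close> is
  carried into \<open>X c\<close> by a power of \<open>x\<^sub>d / x\<^sub>c\<close>. By the pigeonhole principle every monomial of large
  multidegree qualifies for some chart.
\<close>

lemma compat_times_monomial:
  assumes s: "s \<in> compat"
  obtains K where "\<And>k a m. k \<ge> K \<Longrightarrow> (\<And>i. i \<in> {1..q} \<Longrightarrow> a i > int (n i + 1) * (int k - 1)) \<Longrightarrow>
    m \<in> exps q n {} a \<Longrightarrow> proj (s * dehom a (xmon m)) \<in> proj ` G a"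
proof -
  have "\<forall>c\<in>charts q n. \<forall>d\<in>charts q n. \<exists>K. \<forall>k\<ge>K. ratio q d c k * (s c - s d) \<in> X c"
    using s overlap_X_clear by (auto simp: compat_def)
  then obtain K1 where K1: "\<And>c d k. c \<in> charts q n \<Longrightarrow> d \<in> charts q n \<Longrightarrow> k \<ge> K1 c d \<Longrightarrow>
    ratio q d c k * (s c - s d) \<in> X c" by metis
  have "\<forall>d\<in>charts q n. \<exists>K. \<forall>k\<ge>K. xmon (cvec q d (\<lambda>_. int k)) * s d \<in> forms q n (\<lambda>_. int k)"
  proof
    fix d assume d: "d \<in> charts q n"
    hence "s d \<in> R d" using s by (auto simp: compat_def chart_prod_def)
    from clear_chart_ring[OF d this] show "\<exists>K. \<forall>k\<ge>K. xmon (cvec q d (\<lambda>_. int k)) * s d \<in> forms q n (\<lambda>_. int k)"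
      by metis
  qed
  then obtain K2 where K2: "\<And>d k. d \<in> charts q n \<Longrightarrow> k \<ge> K2 d \<Longrightarrow>
    xmon (cvec q d (\<lambda>_. int k)) * s d \<in> forms q n (\<lambda>_. int k)" by metis
  define K where "K = Max (insert 0 ((\<lambda>(c, d). K1 c d) ` (charts q n \<times> charts q n))) + Max (insert 0 (K2 ` charts q n))"
  have K: "K1 c d \<le> K" "K2 d \<le> K" if "c \<in> charts q n" "d \<in> charts q n" for c d
  proof -
    have "K1 c d \<in> insert 0 ((\<lambda>(c, d). K1 c d) ` (charts q n \<times> charts q n))" using that by force
    hence "K1 c d \<le> Max (insert 0 ((\<lambda>(c, d). K1 c d) ` (charts q n \<times> charts q n)))"
      using finite_charts by (intro Max_ge) auto
    thus "K1 c d \<le> K" by (simp add: K_def)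
    have "K2 d \<le> Max (insert 0 (K2 ` charts q n))" using that finite_charts by (intro Max_ge) auto
    thus "K2 d \<le> K" by (simp add: K_def)
  qed
  show ?thesis
  proof (rule that)
    fix k a m assume k: "k \<ge> K" and a: "\<And>i. i \<in> {1..q} \<Longrightarrow> a i > int (n i + 1) * (int k - 1)"
      and m: "m \<in> exps q n {} a"
    obtain d where d: "d \<in> charts q n" "m - cvec q d (\<lambda>_. int k) \<in> exps q n {} (\<lambda>i. a i - int k)"
      using exps_dominates_chart[OF m a] by metis
    let ?m = "m - cvec q d (\<lambda>_. int k)"
    define f where "f = xmon ?m * (xmon (cvec q d (\<lambda>_. int k)) * s d)"
    have mm: "xmon ?m * xmon (cvec q d (\<lambda>_. int k)) = (xmon m :: 'a laurent)" by (simp add: xmon_mult)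
    have fm: "f = xmon m * s d" unfolding f_def mult.assoc[symmetric] mm ..
    have md: "xmon ?m \<in> lforms q n {} (\<lambda>i. a i - int k)" by (simp only: xmon_in_lforms d(2))
    have f: "f \<in> forms q n a"
      unfolding f_def forms_eq_lforms
      by (rule lforms_mult_cong[OF md K2[OF d(1) order.trans[OF K(2)[OF d(1) d(1)] k], unfolded forms_eq_lforms]]) auto
    have "s * dehom a (xmon m) - dehom a f \<in> ideal_prod"
      unfolding ideal_prod_def
    proof (intro CollectI ballI)
      fix c assume c: "c \<in> charts q n"
      have r: "dehomogenize q (\<lambda>i. a i - int k) c (xmon ?m) \<in> R c"
        using dehomogenize_in[OF c md] by (simp add: affine_ring_eq_lforms)
      have E: "cvec q c (\<lambda>i. - a i) = cvec q c (\<lambda>i. - (a i - int k)) + cvec q c (\<lambda>_. - int k)"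
        unfolding cvec_add by (rule cvec_cong) simp
      have "dehomogenize q a c (xmon m) = (xmon (cvec q c (\<lambda>i. - a i) + m) :: 'a laurent)"
        by (simp only: dehomogenize_eq xmon_mult)
      also have "cvec q c (\<lambda>i. - a i) + m = (cvec q c (\<lambda>i. - (a i - int k)) + ?m) + (cvec q d (\<lambda>_. int k) + cvec q c (\<lambda>_. - int k))"
        unfolding E by (simp add: algebra_simps)
      also have "xmon \<dots> = dehomogenize q (\<lambda>i. a i - int k) c (xmon ?m) * (ratio q d c k :: 'a laurent)"
        by (simp only: dehomogenize_eq ratio_def xmon_mult)
      finally have eq: "dehomogenize q a c (xmon m) = dehomogenize q (\<lambda>i. a i - int k) c (xmon ?m) * (ratio q d c k :: 'a laurent)" .
      have "(s * dehom a (xmon m) - dehom a f) c = s c * dehomogenize q a c (xmon m) - dehomogenize q a c (xmon m) * s d"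
        by (simp add: dehom_def fm dehomogenize_eq mult.assoc)
      also have "\<dots> = dehomogenize q (\<lambda>i. a i - int k) c (xmon ?m) * (ratio q d c k * (s c - s d))"
        unfolding eq by (simp add: algebra_simps)
      also have "\<dots> \<in> X c"
        by (rule X_mult[OF c r K1[OF c d(1) order.trans[OF K(1)[OF c d(1)] k]]])
      finally show "(s * dehom a (xmon m) - dehom a f) c \<in> X c" .
    qed
    hence "proj (s * dehom a (xmon m)) = proj (dehom a f)" by (simp add: proj_eq_iff)
    thus "proj (s * dehom a (xmon m)) \<in> proj ` G a" using f unfolding G_def by blast
  qed
qed

text \<open>
  Global functions on \<open>X\<close> form a finite-dimensional space, so one multidegree works for all of them.
\<close>

lemma compat_times_form:
  obtains A where "A \<ge> 0" "\<And>s g. s \<in> compat \<Longrightarrow> g \<in> G (\<lambda>_. A) \<Longrightarrow> proj (g * s) \<in> proj ` G (\<lambda>_. A)"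
proof -
  obtain B where B: "finite B" "B \<subseteq> proj ` compat" "proj ` compat \<subseteq> F.span B"
    using F.fin_dim_basis[OF fin_dim_proj[OF compat_chart_prod]] by metis
  have "\<forall>b\<in>B. \<exists>K. \<forall>k a m. k \<ge> K \<longrightarrow> (\<forall>i\<in>{1..q}. a i > int (n i + 1) * (int k - 1)) \<longrightarrow>
    m \<in> exps q n {} a \<longrightarrow> proj (b * dehom a (xmon m)) \<in> proj ` G a"
  proof
    fix b assume "b \<in> B"
    then obtain s where s: "s \<in> compat" "b = proj s" using B(2) by blast
    obtain K where K: "\<And>k a m. k \<ge> K \<Longrightarrow> (\<And>i. i \<in> {1..q} \<Longrightarrow> a i > int (n i + 1) * (int k - 1)) \<Longrightarrow>
      m \<in> exps q n {} a \<Longrightarrow> proj (s * dehom a (xmon m)) \<in> proj ` G a"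
      using compat_times_monomial[OF s(1)] by metis
    have "proj (b * dehom a (xmon m)) = proj (s * dehom a (xmon m))" if "m \<in> exps q n {} a" for a m
    proof -
      have "dehom a (xmon m) \<in> chart_prod" using that by (intro dehom_in_chart_prod) (simp add: forms_eq_lforms xmon_in_lforms)
      thus ?thesis using proj_mult_proj[of "dehom a (xmon m)" s] by (simp add: s(2) mult.commute)
    qed
    thus "\<exists>K. \<forall>k a m. k \<ge> K \<longrightarrow> (\<forall>i\<in>{1..q}. a i > int (n i + 1) * (int k - 1)) \<longrightarrow>
      m \<in> exps q n {} a \<longrightarrow> proj (b * dehom a (xmon m)) \<in> proj ` G a"
      using K by (intro exI[of _ K]) simp
  qed
  then obtain K where K: "\<And>b k a m. b \<in> B \<Longrightarrow> k \<ge> K b \<Longrightarrow> (\<forall>i\<in>{1..q}. a i > int (n i + 1) * (int k - 1)) \<Longrightarrow>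
    m \<in> exps q n {} a \<Longrightarrow> proj (b * dehom a (xmon m)) \<in> proj ` G a" by metis
  define k where "k = Max (insert 0 (K ` B))"
  have k: "K b \<le> k" if "b \<in> B" for b unfolding k_def using B(1) that by (intro Max_ge) auto
  \<comment> \<open>Large enough for the pigeonhole principle in every group of variables.\<close>
  define A where "A = (\<Sum>i=1..q. int (n i + 1) * int k) + 1"
  have A: "A > int (n i + 1) * (int k - 1)" if "i \<in> {1..q}" for i
  proof -
    have "int (n i + 1) * (int k - 1) \<le> int (n i + 1) * int k" by (intro mult_left_mono) auto
    also have "\<dots> \<le> (\<Sum>i=1..q. int (n i + 1) * int k)" using that by (intro member_le_sum) auto
    finally show ?thesis by (simp add: A_def)
  qed
  have A0: "A \<ge> 0" unfolding A_def by (intro add_nonneg_nonneg sum_nonneg) auto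
  let ?A = "\<lambda>_::nat. A"
  have PG: "F.subspace (proj ` G ?A)" by (rule proj.subspace_image[OF G_subspace])
  have "proj (dehom ?A f * s) \<in> proj ` G ?A" if s: "s \<in> compat" and f: "f \<in> forms q n ?A" for s f
  proof -
    have mono_mem: "proj (s * dehom ?A (xmon m)) \<in> proj ` G ?A" if m: "m \<in> exps q n {} ?A" for m
    proof -
      have "dehom ?A (xmon m) \<in> chart_prod" using m by (intro dehom_in_chart_prod) (simp add: forms_eq_lforms xmon_in_lforms)
      hence "proj (s * dehom ?A (xmon m)) = proj (proj s * dehom ?A (xmon m))"
        using proj_mult_proj[of "dehom ?A (xmon m)" s] by (simp add: mult.commute)
      moreover have "proj (y * dehom ?A (xmon m)) \<in> proj ` G ?A" if "y \<in> F.span B" for y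
        using that
      proof (induction rule: F.span_induct_alt)
        case base
        have "0 * dehom ?A (xmon m) = 0" by (rule mult_zero_left)
        thus ?case using F.subspace_0[OF PG] by (simp only: proj.zero)
      next
        case (step c b y)
        have "proj (b * dehom ?A (xmon m)) \<in> proj ` G ?A"
          using K[OF step(1) k[OF step(1)] _ m] A by blast
        hence "fscale c (proj (b * dehom ?A (xmon m))) + proj (y * dehom ?A (xmon m)) \<in> proj ` G ?A"
          using step(2) by (intro F.subspace_add[OF PG] F.subspace_scale[OF PG])
        thus ?case by (simp only: distrib_right proj.add proj.scale scale_mult_left[symmetric])
      qed
      ultimately show ?thesis using B(3) s by auto
    qed
    have "f \<in> L.span (xmon ` exps q n {} ?A)" using f lforms_subset_span unfolding forms_eq_lforms by blast
    thus ?thesis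
    proof (induction rule: L.span_induct_alt)
      case base
      have "dehom ?A 0 * s = 0" by (simp add: dehom_def dehomogenize_eq fun_eq_iff)
      thus ?case using F.subspace_0[OF PG] by (simp only: proj.zero)
    next
      case (step c b f)
      interpret dehom: Vector_Spaces.linear laurent_scale fscale "dehom ?A" by (rule dehom_linear)
      have "proj (dehom ?A b * s) \<in> proj ` G ?A" using mono_mem step(1) by (auto simp: mult.commute)
      hence "fscale c (proj (dehom ?A b * s)) + proj (dehom ?A f * s) \<in> proj ` G ?A"
        using step(2) by (intro F.subspace_add[OF PG] F.subspace_scale[OF PG])
      thus ?case by (simp only: dehom.add dehom.scale distrib_right proj.add proj.scale scale_mult_left[symmetric])
    qed
  qed
  hence "proj (g * s) \<in> proj ` G ?A" if "s \<in> compat" "g \<in> G ?A" for s g using that unfolding G_def by blast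
  thus ?thesis using that A0 by blast
qed

lemma rk_compat_le: "\<exists>A\<ge>0. rk compat \<le> rk (G (\<lambda>_. A))"
proof -
  obtain A where A: "A \<ge> 0" "\<And>s g. s \<in> compat \<Longrightarrow> g \<in> G (\<lambda>_. A) \<Longrightarrow> proj (g * s) \<in> proj ` G (\<lambda>_. A)"
    using compat_times_form by metis
  obtain f where f: "regular f" "\<forall>k. coeff f k \<in> G (\<lambda>_. A)"
    using regular_form_exists[of "\<lambda>_. A"] A(1) by blast
  have "rk compat \<le> rk (G (\<lambda>_. A))"
    using A(2) f(2) by (intro rk_le_of_regular[OF f(1) compat_subspace compat_chart_prod G_subspace G_chart_prod]) blast
  thus ?thesis using A(1) by blast
qed

lemma eval_poly_mult:
  "map_poly (\<lambda>s. s c) (p * p') = map_poly (\<lambda>s. s c) p * map_poly (\<lambda>s. s c) (p' :: ((nat \<Rightarrow> nat) \<Rightarrow> 'a laurent) poly)"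
proof (rule poly_eqI)
  fix k
  have s: "(\<Sum>i\<in>I. f i) c = (\<Sum>i\<in>I. f i c)" for I :: "nat set" and f :: "nat \<Rightarrow> (nat \<Rightarrow> nat) \<Rightarrow> 'a laurent"
    by (induction I rule: infinite_finite_induct) simp_all
  show "coeff (map_poly (\<lambda>s. s c) (p * p')) k = coeff (map_poly (\<lambda>s. s c) p * map_poly (\<lambda>s. s c) p') k"
    by (simp add: coeff_map_poly coeff_mult s)
qed

text \<open>
  Let \<open>f\<close> be a generic form of multidegree \<open>b\<close> and \<open>u\<close> its inverse up to a scalar polynomial \<open>p\<close>, so that
  \<open>f * u = p\<close> modulo \<open>ideal_prod\<close>. Dividing a form \<open>\<phi>\<close> of multidegree \<open>b\<close> by \<open>f\<close> gives a function: \<open>p * u * \<phi>\<close>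
  has compatible local expressions, since the two forms \<open>f\<close> and \<open>\<phi>\<close> transform by the same factor from
  chart to chart. Moreover \<open>p * u\<close> is regular, so the ranks can be compared.
\<close>

lemma rk_G_le_compat:
  assumes b: "\<forall>i\<in>{1..q}. 0 \<le> b i"
  shows "rk (G b) \<le> rk compat"
proof -
  obtain f where f: "regular f" "\<And>k. coeff f k \<in> G b" using regular_form_exists[OF b] by blast
  obtain u p where u: "u \<in> polys_over chart_prod" "p \<noteq> 0" "f * u - map_poly (\<lambda>c. fscale c 1) p \<in> polys_over ideal_prod"
    using regular_divides_scalar_poly[OF f(1)] by metis
  let ?p = "map_poly (\<lambda>c. fscale c 1) p :: ((nat \<Rightarrow> nat) \<Rightarrow> 'a laurent) poly"
  have preg: "regular ?p" by (rule regular_scalar_poly[OF u(2)])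
  have pA: "?p \<in> polys_over chart_prod" using preg by (simp add: regular_def)
  have fA: "f \<in> polys_over chart_prod" using f(1) by (simp add: regular_def)
  have reg: "regular (?p * u)"
    unfolding regular_def
  proof (intro conjI ballI impI)
    show "?p * u \<in> polys_over chart_prod" by (rule polys_over_mult[OF pA u(1)])
    fix g assume g: "g \<in> polys_over chart_prod" and h: "?p * u * g \<in> polys_over ideal_prod"
    have 1: "f * (?p * u * g) \<in> polys_over ideal_prod" by (rule polys_over_N_mult[OF fA h])
    have 2: "(?p * g) * (f * u - ?p) \<in> polys_over ideal_prod" by (rule polys_over_N_mult[OF polys_over_mult[OF pA g] u(3)])
    have "?p * (?p * g) = f * (?p * u * g) - (?p * g) * (f * u - ?p)" by (simp add: algebra_simps)
    hence "?p * (?p * g) \<in> polys_over ideal_prod" using polys_over_diff[OF N_subspace 1 2] by simp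
    thus "g \<in> polys_over ideal_prod" using preg g polys_over_mult[OF pA g] unfolding regular_def by blast
  qed
  have "coeff (?p * u) k * dehom b \<phi> \<in> compat" if \<phi>: "\<phi> \<in> forms q n b" for k \<phi>
    unfolding compat_def
  proof (intro CollectI conjI ballI)
    show "coeff (?p * u) k * dehom b \<phi> \<in> chart_prod"
      using polys_over_mult[OF pA u(1)] by (intro A_mult dehom_in_chart_prod \<phi>) (simp add: polys_over_def)
    fix c d assume c: "c \<in> charts q n" and d: "d \<in> charts q n"
    let ?ev = "\<lambda>c. map_poly (\<lambda>s. s c) :: ((nat \<Rightarrow> nat) \<Rightarrow> 'a laurent) poly \<Rightarrow> 'a laurent poly"
    let ?g = "\<lambda>c. dehomogenize q b c \<phi>"
    let ?E = "\<lambda>c. ?ev c f * ?ev c u - ?ev c ?p"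
    have pcd: "?ev d ?p = ?ev c ?p" by (rule poly_eqI) (simp add: coeff_map_poly, simp add: fscale_def)
    have E: "coeff (?E c) l \<in> X c" if "c \<in> charts q n" for c l
    proof -
      have "coeff (?E c) l = coeff (f * u - ?p) l c"
        by (simp add: eval_poly_mult[symmetric] coeff_map_poly)
      also have "\<dots> \<in> X c" using u(3) that by (simp add: polys_over_def ideal_prod_def)
      finally show ?thesis .
    qed
    \<comment> \<open>Both sides are \<open>\<phi> * f\<close> divided by the same monomial.\<close>
    have swap: "smult (?g c) (?ev d f) = smult (?g d) (?ev c f)"
    proof (rule poly_eqI)
      fix l
      obtain \<psi> where \<psi>: "coeff f l = dehom b \<psi>" using f(2)[of l] by (auto simp: G_def)
      show "coeff (smult (?g c) (?ev d f)) l = coeff (smult (?g d) (?ev c f)) l"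
        by (simp add: coeff_map_poly \<psi> dehom_def dehomogenize_eq ac_simps)
    qed
    have "smult (?g c) (?ev c ?p * ?ev c u) - smult (?g d) (?ev d ?p * ?ev d u)
      = smult (?g d) (?E c * ?ev d u) - smult (?g c) (?E d * ?ev c u)
        + (smult (?g c) (?ev d f) - smult (?g d) (?ev c f)) * (?ev c u * ?ev d u)"
      unfolding pcd by (simp add: algebra_simps smult_diff_right smult_add_right)
    hence Z: "smult (?g c) (?ev c ?p * ?ev c u) - smult (?g d) (?ev d ?p * ?ev d u)
      = smult (?g d) (?E c * ?ev d u) - smult (?g c) (?E d * ?ev c u)"
      unfolding swap by simp
    have gR: "?g c \<in> R c" if "c \<in> charts q n" for c using dehom_in_chart_prod[OF \<phi>] that by (auto simp: chart_prod_def dehom_def)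
    have uR: "coeff (?ev c u) l \<in> R c" if "c \<in> charts q n" for c l
      using u(1) that by (simp add: coeff_map_poly polys_over_def chart_prod_def)
    have mem: "coeff (smult g (E * w)) k \<in> OX c d"
      if "\<And>l. coeff E l \<in> OX c d" "\<And>l. coeff w l \<in> overlap_ring q n c d" "g \<in> overlap_ring q n c d" for g E w
    proof -
      have "coeff (smult g (E * w)) k = g * (\<Sum>l\<le>k. coeff w (k - l) * coeff E l)"
        by (simp add: coeff_mult mult.commute)
      thus ?thesis using that by (auto intro!: OX_mult[OF c d] L.subspace_sum[OF OX_subspace[OF c d]])
    qed
    have EO: "coeff (?E c) l \<in> OX c d" "coeff (?E d) l \<in> OX c d" for l
      using E[OF c] E[OF d] X_subset_overlap_X overlap_X_sym[OF c d] by blast+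
    have 1: "coeff (smult (?g d) (?E c * ?ev d u)) k \<in> OX c d"
      by (rule mem) (use EO uR[OF d] gR[OF d] R_overlap in blast)+
    have 2: "coeff (smult (?g c) (?E d * ?ev c u)) k \<in> OX c d"
      by (rule mem) (use EO uR[OF c] gR[OF c] R_overlap in blast)+
    have "(coeff (?p * u) k * dehom b \<phi>) c - (coeff (?p * u) k * dehom b \<phi>) d
      = coeff (smult (?g c) (?ev c ?p * ?ev c u) - smult (?g d) (?ev d ?p * ?ev d u)) k"
      by (simp add: eval_poly_mult[symmetric] coeff_map_poly dehom_def mult.commute)
    also have "\<dots> \<in> OX c d"
      unfolding Z coeff_diff by (rule L.subspace_diff[OF OX_subspace[OF c d] 1 2])
    finally show "(coeff (?p * u) k * dehom b \<phi>) c - (coeff (?p * u) k * dehom b \<phi>) d \<in> OX c d" .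
  qed
  thus ?thesis
    by (intro rk_le_of_regular[OF reg G_subspace G_chart_prod compat_subspace compat_chart_prod]) (auto simp: G_def)
qed

end

section \<open>Sums over all multidegrees of a given total degree\<close>

lemma coeff_linear_power_pred: "coeff ([:- 1, 1:] ^ Suc k) k = - (of_nat (Suc k) :: 'a::comm_ring_1)"
proof (induction k)
  case (Suc k)
  have "coeff ([:- 1, 1:] ^ Suc (Suc k)) (Suc k) =
      coeff ([:- 1, 1:] ^ Suc k) k - (coeff ([:- 1, 1:] ^ Suc k) (Suc k) :: 'a)"
    by (subst power_Suc) (simp add: coeff_pCons del: power_Suc)
  thus ?case using Suc by (simp add: coeff_linear_power del: power_Suc)
qed simp

lemma antidifference_exists:
  fixes P :: "'a::field_char_0 poly"
  assumes "degree P \<le> m"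
  shows "\<exists>Q. degree Q \<le> Suc m \<and> coeff Q (Suc m) = coeff P m / of_nat (Suc m) \<and>
    (\<forall>x. poly Q x - poly Q (x - 1) = poly P x)"
  using assms
proof (induction m arbitrary: P)
  case 0
  then obtain c where c: "P = [:c:]" using 0 by (auto elim: degree_eq_zeroE)
  show ?case by (intro exI[of _ "[:0, c:]"]) (simp add: c algebra_simps)
next
  case (Suc m)
  define a where "a = coeff P (Suc m) / of_nat (Suc (Suc m))"
  define Q1 where "Q1 = monom a (Suc (Suc m))"
  define D1 where "D1 = Q1 - smult a ([:- 1, 1:] ^ Suc (Suc m))"
  have Q1: "coeff Q1 k = (if k = Suc (Suc m) then a else 0)" for k
    by (simp add: Q1_def)
  have degQ1: "degree Q1 \<le> Suc (Suc m)" by (rule degree_le) (simp add: Q1)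
  have D1c: "coeff D1 (Suc (Suc m)) = 0" "coeff D1 (Suc m) = coeff P (Suc m)"
    by (simp_all add: D1_def Q1 coeff_linear_power coeff_linear_power_pred a_def del: power_Suc of_nat_Suc)
  have degD1: "degree D1 \<le> Suc (Suc m)"
    unfolding D1_def using degQ1 degree_linear_power[of "- 1 :: 'a" "Suc (Suc m)"]
    by (intro degree_diff_le order.trans[OF degree_smult_le]) auto
  have "degree (P - D1) \<le> m"
  proof (rule degree_le, intro allI impI)
    fix k assume "m < k"
    then consider "k = Suc m" | "k = Suc (Suc m)" | "k > Suc (Suc m)" by linarith
    thus "coeff (P - D1) k = 0"
      using D1c Suc.prems degD1 by cases (auto simp: coeff_eq_0)
  qed
  from Suc.IH[OF this] obtain Q' where Q': "degree Q' \<le> Suc m"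
    "\<And>x. poly Q' x - poly Q' (x - 1) = poly (P - D1) x" by blast
  show ?case
  proof (intro exI[of _ "Q1 + Q'"] conjI allI)
    show "degree (Q1 + Q') \<le> Suc (Suc m)" using degQ1 Q'(1) by (intro degree_add_le) auto
    show "coeff (Q1 + Q') (Suc (Suc m)) = coeff P (Suc m) / of_nat (Suc (Suc m))"
      using Q'(1) by (simp add: Q1 a_def coeff_eq_0)
    fix x
    have "poly D1 x = poly Q1 x - poly Q1 (x - 1)" by (simp add: D1_def Q1_def poly_monom del: power_Suc)
    hence 1: "poly Q1 x = poly D1 x + poly Q1 (x - 1)" by simp
    have 2: "poly Q' x = poly P x - poly D1 x + poly Q' (x - 1)" using Q'(2)[of x] by (simp add: algebra_simps)
    show "poly (Q1 + Q') x - poly (Q1 + Q') (x - 1) = poly P x" by (simp add: 1 2)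
  qed
qed

lemma shift_poly:
  fixes P :: "'a::field_char_0 poly"
  assumes "degree P \<le> m"
  shows "degree (pcompose P [:- t, 1:]) \<le> m" "coeff (pcompose P [:- t, 1:]) m = coeff P m"
    "poly (pcompose P [:- t, 1:]) x = poly P (x - t)"
proof -
  have d: "degree (pcompose P [:- t, 1:]) = degree P" by (simp add: degree_pcompose)
  thus "degree (pcompose P [:- t, 1:]) \<le> m" using assms by simp
  show "coeff (pcompose P [:- t, 1:]) m = coeff P m"
  proof (cases "degree P = m")
    case True
    thus ?thesis using lead_coeff_comp[of "[:- t, 1:]" P] d by simp
  next
    case False
    hence "degree P < m" using assms by simp
    thus ?thesis using d by (simp add: coeff_eq_0)
  qed
  show "poly (pcompose P [:- t, 1:]) x = poly P (x - t)" by (simp add: poly_pcompose)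
qed

definition compositions :: "nat \<Rightarrow> int \<Rightarrow> (nat \<Rightarrow> int) set" where
  "compositions q d = {a \<in> multidegrees q. (\<forall>i\<in>{1..q}. 0 \<le> a i) \<and> (\<Sum>i=1..q. a i) = d}"

lemma finite_compositions: "finite (compositions q d)"
proof (rule finite_subset)
  show "compositions q d \<subseteq> PiE {1..q} (\<lambda>_. {0..d})"
  proof
    fix a assume a: "a \<in> compositions q d"
    have "a i \<in> {0..d}" if i: "i \<in> {1..q}" for i
    proof -
      have "a i \<le> (\<Sum>i=1..q. a i)" using a i by (intro member_le_sum) (auto simp: compositions_def)
      thus ?thesis using a i by (auto simp: compositions_def)
    qed
    thus "a \<in> PiE {1..q} (\<lambda>_. {0..d})" using a by (auto simp: compositions_def multidegrees_def PiE_iff)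
  qed
  show "finite (PiE {1..q} (\<lambda>_. {0..d}))" by (intro finite_PiE) auto
qed

lemma compositions_neg: "d < 0 \<Longrightarrow> compositions q d = {}"
  using sum_nonneg[of "{1..q}"] unfolding compositions_def by fastforce

lemma sum_compositions_Suc:
  "(\<Sum>a\<in>compositions (Suc q) d. h a) = (\<Sum>k\<in>{0..d}. \<Sum>b\<in>compositions q (d - k). h (b(Suc q := k)))"
proof -
  have upd: "(\<Sum>i=1..q. (b(Suc q := k)) i) = (\<Sum>i=1..q. b i)" for b :: "nat \<Rightarrow> int" and k
    by (intro sum.cong) auto
  have "(\<Sum>k\<in>{0..d}. \<Sum>b\<in>compositions q (d - k). h (b(Suc q := k)))
    = (\<Sum>(k, b)\<in>Sigma {0..d} (\<lambda>k. compositions q (d - k)). h (b(Suc q := k)))"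
    by (intro sum.Sigma) (auto simp: finite_compositions)
  also have "\<dots> = (\<Sum>a\<in>compositions (Suc q) d. h a)"
  proof (rule sum.reindex_bij_witness[where i = "\<lambda>a. (a (Suc q), a(Suc q := undefined))" and j = "\<lambda>(k, b). b(Suc q := k)"])
    fix x assume x: "x \<in> Sigma {0..d} (\<lambda>k. compositions q (d - k))"
    obtain k b where kb: "x = (k, b)" by (cases x)
    have b: "b \<in> compositions q (d - k)" and k: "0 \<le> k" "k \<le> d" using x kb by auto
    have "b (Suc q) = undefined" using b by (auto simp: compositions_def multidegrees_def PiE_iff extensional_def)
    thus "((case x of (k, b) \<Rightarrow> b(Suc q := k)) (Suc q), (case x of (k, b) \<Rightarrow> b(Suc q := k))(Suc q := undefined)) = x"
      by (auto simp: kb fun_eq_iff)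
    have "b(Suc q := k) \<in> multidegrees (Suc q)"
      using b by (auto simp: compositions_def multidegrees_def PiE_iff extensional_def)
    moreover have "0 \<le> (b(Suc q := k)) i" if "i \<in> {1..Suc q}" for i
      using b k that by (auto simp: compositions_def)
    moreover have "(\<Sum>i=1..Suc q. (b(Suc q := k)) i) = d"
      using b upd[of b k] by (simp add: compositions_def)
    ultimately show "(case x of (k, b) \<Rightarrow> b(Suc q := k)) \<in> compositions (Suc q) d"
      by (simp only: kb prod.case compositions_def mem_Collect_eq) blast
    show "h (case x of (k, b) \<Rightarrow> b(Suc q := k)) = (case x of (k, b) \<Rightarrow> h (b(Suc q := k)))" by (simp add: kb)
  next
    fix a assume a: "a \<in> compositions (Suc q) d"
    show "(case (a (Suc q), a(Suc q := undefined)) of (k, b) \<Rightarrow> b(Suc q := k)) = a" by simp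
    have nn: "0 \<le> a i" if "i \<in> {1..Suc q}" for i using a that by (auto simp: compositions_def)
    have sum: "(\<Sum>i=1..q. a i) + a (Suc q) = d" using a by (simp add: compositions_def)
    have "a (Suc q) \<in> {0..d}" using sum nn[of "Suc q"] sum_nonneg[of "{1..q}" a] nn by auto
    moreover have "a(Suc q := undefined) \<in> multidegrees q"
      using a by (auto simp: compositions_def multidegrees_def PiE_iff extensional_def)
    hence "a(Suc q := undefined) \<in> compositions q (d - a (Suc q))"
      using nn sum upd[of a undefined] by (auto simp: compositions_def)
    ultimately show "(a (Suc q), a(Suc q := undefined)) \<in> Sigma {0..d} (\<lambda>k. compositions q (d - k))" by blast
  qed
  finally show ?thesis by simp
qed

lemma compositions_0: "compositions 0 d = (if d = 0 then {\<lambda>_. undefined} else {})"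
  by (auto simp: compositions_def multidegrees_def)

text \<open>
  Induction on the number of variables, summing over the last one. The values \<open>k < r\<^sub>q\<close> of the last variable
  contribute finitely many shifted polynomials of smaller degree. From \<open>r\<^sub>q\<close> on the inner sum no
  longer depends on \<open>k\<close> except through \<open>d - k\<close>, so that the outer sum is an antidifference of it, and
  this contributes the dominant term.
\<close>

lemma sum_compositions_polynomial:
  fixes h :: "(nat \<Rightarrow> int) \<Rightarrow> nat" and r :: "nat \<Rightarrow> int"
  assumes "\<And>i. i \<in> {1..Suc q} \<Longrightarrow> 0 \<le> r i"
    and "\<And>a b. (\<And>i. i \<in> {1..Suc q} \<Longrightarrow> a i = b i) \<Longrightarrow> h a = h b"
    and "\<And>a. (\<And>i. i \<in> {1..Suc q} \<Longrightarrow> 0 \<le> a i) \<Longrightarrow> h a = h (\<lambda>i. min (a i) (r i))"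
  shows "\<exists>P :: rat poly. degree P \<le> q \<and> coeff P q = of_nat (h r) / fact q \<and>
    (\<forall>d \<ge> (\<Sum>i=1..Suc q. r i). of_nat (\<Sum>a\<in>compositions (Suc q) d. h a) = poly P (of_int d))"
  using assms
proof (induction q arbitrary: h)
  case 0
  have "(\<Sum>a\<in>compositions (Suc 0) d. h a) = h r" if d: "d \<ge> r 1" for d
  proof -
    have d0: "0 \<le> d" using d 0(1)[of 1] by simp
    have "(\<Sum>a\<in>compositions (Suc 0) d. h a) = (\<Sum>k\<in>{0..d}. if k = d then h (\<lambda>i. if i = Suc 0 then d else undefined) else 0)"
      unfolding sum_compositions_Suc by (intro sum.cong) (auto simp: compositions_0 fun_upd_def)
    also have "\<dots> = h (\<lambda>i. if i = Suc 0 then d else undefined)" using d0 by simp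
    also have "\<dots> = h (\<lambda>i. min ((\<lambda>i. if i = Suc 0 then d else undefined) i) (r i))" using d0 by (intro 0(3)) auto
    also have "\<dots> = h r" using d by (intro 0(2)) auto
    finally show ?thesis .
  qed
  thus ?case by (intro exI[of _ "[:of_nat (h r):]"]) auto
next
  case (Suc q)
  let ?n = "Suc (Suc q)"
  define h' where "h' k b = h (b(?n := k))" for k b
  define R where "R = (\<Sum>i=1..Suc q. r i)"
  define \<rho> where "\<rho> = r ?n"
  define S where "S k d = (\<Sum>b\<in>compositions (Suc q) d. h' k b)" for k d
  have \<rho>0: "0 \<le> \<rho>" unfolding \<rho>_def by (rule Suc.prems(1)) simp
  have R0: "0 \<le> R" unfolding R_def by (intro sum_nonneg Suc.prems(1)) auto
  have "\<exists>P :: rat poly. degree P \<le> q \<and> coeff P q = of_nat (h' k r) / fact q \<and>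
    (\<forall>d \<ge> R. of_nat (S k d) = poly P (of_int d))" if k: "0 \<le> k" for k
    unfolding R_def S_def
  proof (rule Suc.IH)
    show "0 \<le> r i" if "i \<in> {1..Suc q}" for i using Suc.prems(1) that by auto
    show "h' k a = h' k b" if "\<And>i. i \<in> {1..Suc q} \<Longrightarrow> a i = b i" for a b
      unfolding h'_def using that by (intro Suc.prems(2)) auto
    fix a :: "nat \<Rightarrow> int" assume a: "\<And>i. i \<in> {1..Suc q} \<Longrightarrow> 0 \<le> a i"
    have "h' k a = h (\<lambda>i. min ((a(?n := k)) i) (r i))"
      unfolding h'_def using a k by (intro Suc.prems(3)) auto
    also have "\<dots> = h (\<lambda>i. min (((\<lambda>i. min (a i) (r i))(?n := k)) i) (r i))" by (intro Suc.prems(2)) auto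
    also have "\<dots> = h' k (\<lambda>i. min (a i) (r i))"
      unfolding h'_def using a k Suc.prems(1) by (intro Suc.prems(3)[symmetric]) auto
    finally show "h' k a = h' k (\<lambda>i. min (a i) (r i))" .
  qed
  then obtain P :: "int \<Rightarrow> rat poly" where P: "\<And>k. 0 \<le> k \<Longrightarrow> degree (P k) \<le> q"
    "\<And>k. 0 \<le> k \<Longrightarrow> coeff (P k) q = of_nat (h' k r) / fact q"
    "\<And>k d. 0 \<le> k \<Longrightarrow> R \<le> d \<Longrightarrow> of_nat (S k d) = poly (P k) (of_int d)" by metis
  have h'\<rho>: "h' k b = h' \<rho> b" if k: "k \<ge> \<rho>" and b: "\<And>i. i \<in> {1..Suc q} \<Longrightarrow> 0 \<le> b i" for k b
  proof -
    have "h' k b = h (\<lambda>i. min ((b(?n := k)) i) (r i))"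
      unfolding h'_def using b k \<rho>0 by (intro Suc.prems(3)) auto
    also have "\<dots> = h (\<lambda>i. min ((b(?n := \<rho>)) i) (r i))" using k by (intro Suc.prems(2)) (auto simp: \<rho>_def)
    also have "\<dots> = h' \<rho> b" unfolding h'_def using b \<rho>0 by (intro Suc.prems(3)[symmetric]) auto
    finally show ?thesis .
  qed
  have S\<rho>: "S k d = S \<rho> d" if "k \<ge> \<rho>" for k d
    unfolding S_def using that by (intro sum.cong h'\<rho>) (auto simp: compositions_def)
  obtain Q where Q: "degree Q \<le> Suc q" "coeff Q (Suc q) = coeff (P \<rho>) q / of_nat (Suc q)"
    "\<And>x. poly Q x - poly Q (x - 1) = poly (P \<rho>) x"
    using antidifference_exists[OF P(1)[OF \<rho>0]] by blast
  define C where "C = (\<Sum>x\<in>{0..<R}. (of_nat (S \<rho> x) :: rat)) - poly Q (of_int R - 1)"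
  define W where "W = (\<Sum>k\<in>{0..<\<rho>}. pcompose (P k) [:- of_int k, 1:]) + pcompose Q [:- of_int \<rho>, 1:] + [:C:]"
  \<comment> \<open>The induction starts at the empty sum, for \<open>D = R - 1\<close>.\<close>
  have tele: "(\<Sum>x\<in>{R..D}. of_nat (S \<rho> x)) = poly Q (of_int D) - poly Q (of_int R - 1)" if "D \<ge> R - 1" for D
    using that
  proof (induction D rule: int_ge_induct)
    case (step D)
    have "{R..D + 1} = insert (D + 1) {R..D}" using step(1) by auto
    hence "(\<Sum>x\<in>{R..D + 1}. of_nat (S \<rho> x)) = of_nat (S \<rho> (D + 1)) + (\<Sum>x\<in>{R..D}. (of_nat (S \<rho> x) :: rat))" by simp
    also have "of_nat (S \<rho> (D + 1)) = poly (P \<rho>) (of_int (D + 1))" using step(1) by (intro P(3) \<rho>0) auto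
    also have "\<dots> = poly Q (of_int (D + 1)) - poly Q (of_int D)" using Q(3)[of "of_int (D + 1)"] by simp
    finally show ?case using step(2) by simp
  qed simp
  show ?case
  proof (intro exI[of _ W] conjI allI impI)
    have dP: "degree (pcompose (P k) [:- of_int k, 1:]) \<le> q" if "k \<in> {0..<\<rho>}" for k
      using that by (intro shift_poly P(1)) auto
    have dS: "degree (\<Sum>k\<in>{0..<\<rho>}. pcompose (P k) [:- of_int k, 1:]) \<le> q" by (intro degree_sum_le dP) auto
    show "degree W \<le> Suc q"
      unfolding W_def using dS shift_poly(1)[OF Q(1), of "of_int \<rho>"] by (intro degree_add_le) auto
    have "h' \<rho> r = h r" unfolding h'_def by (simp add: \<rho>_def)
    thus "coeff W (Suc q) = of_nat (h r) / fact (Suc q)"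
      unfolding W_def using dS shift_poly(2)[OF Q(1), of "of_int \<rho>"] Q(2) P(2)[OF \<rho>0]
      by (simp add: coeff_eq_0)
    fix d assume "(\<Sum>i=1..?n. r i) \<le> d"
    hence d: "R + \<rho> \<le> d" by (simp add: R_def \<rho>_def)
    have "{0..d} = {0..<\<rho>} \<union> {\<rho>..d}" "{0..<\<rho>} \<inter> {\<rho>..d} = {}" using d R0 \<rho>0 by auto
    hence "(\<Sum>a\<in>compositions ?n d. h a) = (\<Sum>k\<in>{0..<\<rho>}. S k (d - k)) + (\<Sum>k\<in>{\<rho>..d}. S k (d - k))"
      unfolding sum_compositions_Suc[of h "Suc q" d] h'_def[symmetric] S_def[symmetric]
      by (simp add: sum.union_disjoint)
    also have "(\<Sum>k\<in>{\<rho>..d}. S k (d - k)) = (\<Sum>k\<in>{\<rho>..d}. S \<rho> (d - k))" by (intro sum.cong S\<rho>) auto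
    also have "\<dots> = (\<Sum>x\<in>{0..d - \<rho>}. S \<rho> x)"
      by (rule sum.reindex_bij_witness[of _ "\<lambda>x. d - x" "\<lambda>k. d - k"]) auto
    finally have 1: "(\<Sum>a\<in>compositions ?n d. h a) = (\<Sum>k\<in>{0..<\<rho>}. S k (d - k)) + (\<Sum>x\<in>{0..d - \<rho>}. S \<rho> x)" .
    have "{0..d - \<rho>} = {0..<R} \<union> {R..d - \<rho>}" "{0..<R} \<inter> {R..d - \<rho>} = {}" using d R0 by auto
    hence "(\<Sum>x\<in>{0..d - \<rho>}. of_nat (S \<rho> x)) = (\<Sum>x\<in>{0..<R}. of_nat (S \<rho> x)) + (\<Sum>x\<in>{R..d - \<rho>}. (of_nat (S \<rho> x) :: rat))"
      by (simp add: sum.union_disjoint)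
    also have "(\<Sum>x\<in>{R..d - \<rho>}. (of_nat (S \<rho> x) :: rat)) = poly Q (of_int (d - \<rho>)) - poly Q (of_int R - 1)"
      using d by (intro tele) auto
    finally have 2: "(\<Sum>x\<in>{0..d - \<rho>}. of_nat (S \<rho> x)) = C + poly Q (of_int d - of_int \<rho>)" by (simp add: C_def)
    have 3: "(\<Sum>k\<in>{0..<\<rho>}. of_nat (S k (d - k))) = (\<Sum>k\<in>{0..<\<rho>}. poly (P k) (of_int d - of_int k))"
    proof (intro sum.cong refl)
      fix k assume k: "k \<in> {0..<\<rho>}"
      have "of_nat (S k (d - k)) = poly (P k) (of_int (d - k))" using k d by (intro P(3)) auto
      thus "of_nat (S k (d - k)) = poly (P k) (of_int d - of_int k)" by simp
    qed
    show "of_nat (\<Sum>a\<in>compositions ?n d. h a) = poly W (of_int d)"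
      unfolding 1 W_def using 2 3 by (simp add: poly_sum poly_pcompose)
  qed
qed

section \<open>Regularity and the Hilbert-Poincare polynomial\<close>

lemma poly_eq_if_eventually:
  fixes P Q :: "rat poly"
  assumes "\<And>d::int. d \<ge> d0 \<Longrightarrow> poly P (of_int d) = poly Q (of_int d)"
  shows "P = Q"
proof (rule ccontr)
  assume "P \<noteq> Q"
  hence "finite {x. poly (P - Q) x = 0}" by (intro poly_roots_finite) simp
  moreover have "(of_int :: int \<Rightarrow> rat) ` {d0..} \<subseteq> {x. poly (P - Q) x = 0}" using assms by auto
  ultimately have "finite ((of_int :: int \<Rightarrow> rat) ` {d0..})" by (rule finite_subset[rotated])
  hence "finite {d0..}" by (rule finite_imageD) (auto simp: inj_on_def)
  thus False by (simp add: infinite_Ici)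
qed

lemma Least_int_le:
  fixes U :: "int \<Rightarrow> bool"
  assumes "U x" and bound: "\<And>y. U y \<Longrightarrow> M \<le> y"
  shows "(LEAST y. U y) \<le> x"
proof -
  define k where "k = (LEAST k::nat. U (M + int k))"
  have M: "U (M + int (nat (x - M)))" using assms(1) bound[OF assms(1)] by simp
  have k: "U (M + int k)" unfolding k_def by (rule LeastI[where P = "\<lambda>k. U (M + int k)", OF M])
  have min: "M + int k \<le> y" if y: "U y" for y
  proof -
    have "U (M + int (nat (y - M)))" using y bound[OF y] by simp
    hence "k \<le> nat (y - M)" unfolding k_def by (rule Least_le)
    thus ?thesis using bound[OF y] by simp
  qed
  have "(LEAST y. U y) = M + int k" by (rule Least_equality[where P = U, OF k min])
  thus ?thesis using min[OF assms(1)] by simp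
qed

text \<open>
  A bounded nondecreasing function stops growing, and by assumption never resumes.
\<close>

lemma stabilization_index_exists:
  fixes \<phi> :: "int \<Rightarrow> nat"
  assumes incr: "\<And>d. \<phi> d \<le> \<phi> (d + 1)" and bound: "\<And>d. \<phi> d \<le> B"
    and stable: "\<And>d. 0 \<le> d \<Longrightarrow> \<phi> d = \<phi> (d + 1) \<Longrightarrow> \<phi> (d + 1) = \<phi> (d + 2)"
  defines "reg r \<equiv> r \<ge> 0 \<and> strict_mono_on {0..r} \<phi> \<and> (\<forall>d\<ge>r. \<phi> d = \<phi> r)"
  shows "\<exists>!r. reg r"
proof -
  have ex: "\<exists>d::nat. \<phi> (int d) = \<phi> (int d + 1)"
  proof (rule ccontr)
    assume "\<not> ?thesis"
    hence lt: "\<phi> (int d) < \<phi> (int d + 1)" for d using incr[of "int d"] by (simp add: order_less_le)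
    have "\<phi> (int d) \<ge> d" for d
    proof (induction d)
      case (Suc d) thus ?case using lt[of d] by (simp add: add.commute)
    qed simp
    from this[of "Suc B"] bound[of "int (Suc B)"] show False by simp
  qed
  define r where "r = (LEAST d::nat. \<phi> (int d) = \<phi> (int d + 1))"
  have r: "\<phi> (int r) = \<phi> (int r + 1)" unfolding r_def by (rule LeastI_ex[OF ex])
  have lt: "\<phi> d < \<phi> (d + 1)" if "0 \<le> d" "d < int r" for d
  proof -
    have "nat d < r" using that by simp
    hence "\<phi> (int (nat d)) \<noteq> \<phi> (int (nat d) + 1)" unfolding r_def by (rule not_less_Least)
    thus ?thesis using incr[of d] that by simp
  qed
  have strict: "\<phi> x < \<phi> y" if "0 \<le> x" "x < y" "y \<le> int r" for x y
  proof -
    have "x + 1 \<le> y" using that by simp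
    thus ?thesis using that(3)
    proof (induction y rule: int_ge_induct)
      case base thus ?case using lt[of x] that by simp
    next
      case (step y)
      thus ?case using lt[of y] that(1) by simp
    qed
  qed
  have flat: "\<phi> d = \<phi> (d + 1) \<and> \<phi> d = \<phi> (int r)" if "int r \<le> d" for d
    using that
  proof (induction d rule: int_ge_induct)
    case (step d) thus ?case using stable[of d] by (simp add: add.assoc)
  qed (use r in simp)
  have "reg (int r)"
    unfolding reg_def strict_mono_on_def
  proof (intro conjI allI impI)
    fix x y assume "x \<in> {0..int r} \<and> y \<in> {0..int r} \<and> x < y"
    thus "\<phi> x < \<phi> y" using strict[of x y] by simp
  next
    fix d assume "int r \<le> d"
    from flat[OF this] show "\<phi> d = \<phi> (int r)" by (rule conjunct2)
  qed simp
  moreover have "x = y" if "reg x" "reg y" for x y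
  proof (rule ccontr)
    have *: "\<not> u < v" if "reg u" "reg v" for u v
    proof
      assume "u < v"
      have u: "0 \<le> u" and const: "\<forall>d\<ge>u. \<phi> d = \<phi> u" using that(1) unfolding reg_def by blast+
      have mono_v: "strict_mono_on {0..v} \<phi>" using that(2) unfolding reg_def by blast
      have "u \<in> {0..v}" "v \<in> {0..v}" using u \<open>u < v\<close> by auto
      from strict_mono_onD[OF mono_v this \<open>u < v\<close>] have "\<phi> u < \<phi> v" .
      moreover have "\<phi> v = \<phi> u" using const[rule_format, OF less_imp_le[OF \<open>u < v\<close>]] .
      ultimately show False by (rule less_imp_neq[THEN notE, OF _ sym])
    qed
    assume "x \<noteq> y" thus False using *[OF that] *[OF that(2,1)] by auto
  qed
  ultimately show ?thesis by blast
qed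

context zero_dim_subscheme
begin

definition axis :: "nat \<Rightarrow> int \<Rightarrow> nat \<Rightarrow> int" where "axis i d = (\<lambda>k. if k = i then d else 0)"

text \<open>
  Exponents are nonnegative, so degree zero in a group excludes its variables. By this identification the
  Hilbert function of the projection to the \<open>i\<close>-th factor is that of \<open>X\<close> along the \<open>i\<close>-th axis.
\<close>

lemma factor_forms_eq: "i \<in> {1..q} \<Longrightarrow> factor_forms n i d = forms q n (axis i d)"
proof -
  assume i: "i \<in> {1..q}"
  have "(keys m \<subseteq> {i} \<times> {0..n i} \<and> (\<forall>v. v \<notin> {} \<longrightarrow> lookup m v \<ge> 0) \<and> gdeg n m i = d)
    \<longleftrightarrow> m \<in> exps q n {} (axis i d)" for m
  proof
    assume *: "keys m \<subseteq> {i} \<times> {0..n i} \<and> (\<forall>v. v \<notin> {} \<longrightarrow> lookup m v \<ge> 0) \<and> gdeg n m i = d"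
    have "lookup m (k, j) = 0" if "k \<noteq> i" for k j
    proof -
      have "(k, j) \<notin> keys m" using * that by auto
      thus ?thesis by (simp add: in_keys_iff)
    qed
    hence "gdeg n m k = 0" if "k \<noteq> i" for k using that by (simp add: gdeg_def)
    moreover have "keys m \<subseteq> vars q n" using * i by (auto simp: vars_def)
    ultimately show "m \<in> exps q n {} (axis i d)" using * unfolding exps_def axis_def by auto
  next
    assume m: "m \<in> exps q n {} (axis i d)"
    have nn: "lookup m v \<ge> 0" for v using m unfolding exps_def by blast
    have "keys m \<subseteq> {i} \<times> {0..n i}"
    proof
      fix v assume v: "v \<in> keys m"
      hence "v \<in> vars q n" using m unfolding exps_def by blast
      then obtain k j where kj: "v = (k, j)" "k \<in> {1..q}" "j \<in> {0..n k}" by (auto simp: vars_def)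
      have "k = i"
      proof (rule ccontr)
        assume "k \<noteq> i"
        hence "gdeg n m k = 0" using m kj(2) unfolding exps_def axis_def by auto
        hence "lookup m (k, j) = 0"
          using nn kj(3) sum_nonneg_eq_0_iff[of "{0..n k}" "\<lambda>j. lookup m (k, j)"] by (simp add: gdeg_def)
        thus False using v kj(1) by (simp add: in_keys_iff)
      qed
      thus "v \<in> {i} \<times> {0..n i}" using kj by auto
    qed
    moreover have "gdeg n m i = d" using m i unfolding exps_def axis_def by auto
    ultimately show "keys m \<subseteq> {i} \<times> {0..n i} \<and> (\<forall>v. v \<notin> {} \<longrightarrow> lookup m v \<ge> 0) \<and> gdeg n m i = d"
      using nn by blast
  qed
  thus ?thesis
    unfolding factor_forms_def factor_ring_def laurent_ring_def forms_eq_lforms lforms_def gdeg_def[symmetric]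
    by blast
qed

lemma projection_hilbert_fun_eq: "i \<in> {1..q} \<Longrightarrow> projection_hilbert_fun q n X i d = rk (G (axis i d))"
proof -
  assume i: "i \<in> {1..q}"
  have "projection_ideal q n X i \<inter> factor_forms n i d = ideal_of q n X \<inter> factor_forms n i d"
    by (auto simp: projection_ideal_def factor_forms_def)
  hence "projection_hilbert_fun q n X i d = hilbert_fun q n X (axis i d)"
    by (simp add: projection_hilbert_fun_def hilbert_fun_def factor_forms_eq[OF i])
  thus ?thesis by (simp only: hilbert_fun_eq_rk)
qed

lemma axis_Suc: "axis i (d + 1) = axis i d + udeg i"
  by (auto simp: axis_def udeg_def fun_eq_iff)

abbreviation rem :: "nat \<Rightarrow> int" where "rem i \<equiv> regularity_multiindex q n X i"

lemma regularity_multiindex_properties: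
  assumes i: "i \<in> {1..q}"
  shows "0 \<le> rem i" "rk (G (axis i (rem i))) = rk (G (axis i (rem i) + udeg i))"
proof -
  let ?\<phi> = "\<lambda>d. rk (G (axis i d))"
  have "projection_hilbert_fun q n X i = ?\<phi>" by (rule ext) (rule projection_hilbert_fun_eq[OF i])
  moreover have "\<exists>!r. r \<ge> 0 \<and> strict_mono_on {0..r} ?\<phi> \<and> (\<forall>d\<ge>r. ?\<phi> d = ?\<phi> r)"
  proof (rule stabilization_index_exists[where B = "rk chart_prod"])
    show "?\<phi> d \<le> ?\<phi> (d + 1)" for d unfolding axis_Suc by (rule rk_G_mono[OF i])
    show "?\<phi> d \<le> rk chart_prod" for d by (rule rk_G_bounded)
    fix d :: int assume d: "0 \<le> d" and eq: "?\<phi> d = ?\<phi> (d + 1)"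
    have "rk (G (axis i d + udeg i)) = rk (G (axis i d + udeg i + udeg i))"
    proof (rule rk_G_stable[OF _ _ i])
      show "\<forall>k\<in>{1..q}. 0 \<le> axis i d k" using d by (simp add: axis_def)
      show "\<forall>k\<in>{1..q}. 0 \<le> udeg i k" by (simp add: udeg_def)
      show "rk (G (axis i d)) = rk (G (axis i d + udeg i))" using eq unfolding axis_Suc .
    qed
    moreover have "axis i (d + 2) = axis i d + udeg i + udeg i" by (auto simp: axis_def udeg_def fun_eq_iff)
    ultimately show "?\<phi> (d + 1) = ?\<phi> (d + 2)" unfolding axis_Suc by simp
  qed
  ultimately have r: "rem i \<ge> 0 \<and> strict_mono_on {0..rem i} ?\<phi> \<and> (\<forall>d\<ge>rem i. ?\<phi> d = ?\<phi> (rem i))"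
    unfolding regularity_multiindex_def by (simp only:) (rule theI')
  show "0 \<le> rem i" using r by blast
  have "rem i \<le> rem i + 1" by simp
  with r have "?\<phi> (rem i + 1) = ?\<phi> (rem i)" by blast
  thus "rk (G (axis i (rem i))) = rk (G (axis i (rem i) + udeg i))" unfolding axis_Suc by (rule sym)
qed

lemma rk_G_step:
  assumes i: "i \<in> {1..q}" and a: "\<forall>k\<in>{1..q}. 0 \<le> a k" and ai: "rem i \<le> a i"
  shows "rk (G a) = rk (G (a + udeg i))"
proof -
  have "rk (G (axis i (rem i) + (a - axis i (rem i)))) = rk (G (axis i (rem i) + (a - axis i (rem i)) + udeg i))"
  proof (rule rk_G_stable[OF _ _ i regularity_multiindex_properties(2)[OF i]])
    show "\<forall>k\<in>{1..q}. 0 \<le> axis i (rem i) k" using regularity_multiindex_properties(1)[OF i] by (simp add: axis_def)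
    show "\<forall>k\<in>{1..q}. 0 \<le> (a - axis i (rem i)) k" using a ai by (simp add: axis_def)
  qed
  thus ?thesis by simp
qed

text \<open>
  Going from \<open>min a rem\<close> to \<open>a\<close> increases only components that have already reached \<open>rem\<close>, and such
  a step does not change the rank.
\<close>

lemma rk_G_min:
  assumes a: "\<And>i. i \<in> {1..q} \<Longrightarrow> 0 \<le> a i"
  shows "rk (G a) = rk (G (\<lambda>i. min (a i) (rem i)))"
proof -
  let ?b = "\<lambda>i. min (a i) (rem i)"
  have b: "\<forall>k\<in>{1..q}. 0 \<le> ?b k" using a regularity_multiindex_properties(1) by simp
  have "(\<forall>i\<in>{1..q}. c i > 0 \<longrightarrow> rem i \<le> ?b i) \<longrightarrow> rk (G (?b + c)) = rk (G ?b)"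
    if "\<forall>i\<in>{1..q}. 0 \<le> c i" for c
    using that
  proof (induction c rule: multidegree_induct)
    case (cong c c')
    have eq: "G (?b + c) = G (?b + c')" by (rule G_cong) (use cong(1) in simp)
    show ?case
    proof
      assume "\<forall>i\<in>{1..q}. c' i > 0 \<longrightarrow> rem i \<le> ?b i"
      hence "\<forall>i\<in>{1..q}. c i > 0 \<longrightarrow> rem i \<le> ?b i" using cong(1) by metis
      from cong(2)[rule_format, OF this[rule_format]]
      show "rk (G (?b + c')) = rk (G ?b)" unfolding eq .
    qed
  next
    case zero thus ?case by (simp add: zero_fun_def[symmetric])
  next
    case (step c i)
    show ?case
    proof
      assume *: "\<forall>k\<in>{1..q}. (c + udeg i) k > 0 \<longrightarrow> rem k \<le> ?b k"
      have "(c + udeg i) i > 0" using step(1,2) by (simp add: udeg_def add_nonneg_pos)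
      hence "rem i \<le> (?b + c) i" using * step(1,2) by fastforce
      hence "rk (G (?b + c)) = rk (G (?b + c + udeg i))"
        using step(1) b by (intro rk_G_step[OF step(2)]) auto
      moreover have "\<forall>k\<in>{1..q}. c k > 0 \<longrightarrow> rem k \<le> ?b k"
      proof (intro ballI impI)
        fix k assume k: "k \<in> {1..q}" "c k > 0"
        hence "(c + udeg i) k > 0" by (auto simp: udeg_def)
        thus "rem k \<le> ?b k" using * k(1) by blast
      qed
      with step(3) have "rk (G (?b + c)) = rk (G ?b)" by blast
      ultimately show "rk (G (?b + (c + udeg i))) = rk (G ?b)" by (simp only: add.assoc)
    qed
  qed
  from this[of "a - ?b"] have "rk (G (?b + (a - ?b))) = rk (G ?b)" by auto
  thus ?thesis by simp
qed

lemma rk_G_mono_add: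
  assumes "\<forall>i\<in>{1..q}. 0 \<le> c i" shows "rk (G a) \<le> rk (G (a + c))"
  using assms
proof (induction c rule: multidegree_induct)
  case (cong c c')
  have eq: "G (a + c) = G (a + c')" by (rule G_cong) (use cong(1) in simp)
  show ?case using cong(2) unfolding eq .
next
  case zero
  have "a + (\<lambda>_. 0) = a" by (simp add: fun_eq_iff)
  thus ?case by simp
next
  case (step c i)
  thus ?case using rk_G_mono[OF step(2), of "a + c"] by (simp only: add.assoc[symmetric])
qed

lemma rk_G_rem: "rk (G rem) = scheme_length q n X"
proof (rule antisym)
  show "rk (G rem) \<le> scheme_length q n X"
    unfolding scheme_length_eq_rk using regularity_multiindex_properties(1) by (intro rk_G_le_compat) blast
  obtain A where A: "A \<ge> 0" "rk compat \<le> rk (G (\<lambda>_. A))" using rk_compat_le by blast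
  let ?b = "\<lambda>i. min A (rem i)"
  have "rk (G (\<lambda>_. A)) = rk (G ?b)" using A(1) by (intro rk_G_min)
  also have "\<dots> \<le> rk (G (?b + (rem - ?b)))" by (intro rk_G_mono_add) simp
  finally show "scheme_length q n X \<le> rk (G rem)" using A(2) by (simp add: scheme_length_eq_rk)
qed

lemma scheme_length_pos: "scheme_length q n X \<ge> 1"
proof -
  have "rk (G (\<lambda>_. 0)) \<le> rk (G ((\<lambda>_. 0) + rem))"
    using regularity_multiindex_properties(1) by (intro rk_G_mono_add) blast
  moreover have "(\<lambda>_. 0) + rem = rem" by (simp add: fun_eq_iff)
  ultimately show ?thesis using rk_G_zero rk_G_rem by simp
qed

lemma total_hilbert_fun_eq: "total_hilbert_fun q n X d = (\<Sum>a\<in>compositions q d. rk (G a))"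
  unfolding total_hilbert_fun_def hilbert_fun_eq_rk
proof (rule sum.mono_neutral_left[OF finite_compositions])
  show "{a \<in> multidegrees q. (\<Sum>i=1..q. a i) = d \<and> rk (G a) \<noteq> 0} \<subseteq> compositions q d"
    using rk_G_negative by (force simp: compositions_def not_less)
  show "\<forall>a\<in>compositions q d - {a \<in> multidegrees q. (\<Sum>i=1..q. a i) = d \<and> rk (G a) \<noteq> 0}. rk (G a) = 0"
    by (auto simp: compositions_def)
qed

text \<open>
  The Hilbert function vanishes in negative total degrees, whereas a nonzero polynomial has only
  finitely many roots. So the set of integers from which on the two agree is bounded below, and its least element
  is at most \<open>|rem X|\<close>.
\<close>

theorem hilbert_polynomial_and_regularity:
  assumes q: "q \<ge> 1"
  shows "regularity_index q n X \<le> (\<Sum>i=1..q. rem i) \<and>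
         degree (hilbert_poly q n X) = q - 1 \<and>
         lead_coeff (hilbert_poly q n X) = of_nat (scheme_length q n X) / fact (q - 1)"
proof -
  have q': "Suc (q - 1) = q" using q by simp
  let ?r = "\<Sum>i=1..q. rem i" and ?H = "total_hilbert_fun q n X"
  have "\<exists>P :: rat poly. degree P \<le> q - 1 \<and> coeff P (q - 1) = of_nat (rk (G rem)) / fact (q - 1) \<and>
    (\<forall>d \<ge> (\<Sum>i=1..Suc (q - 1). rem i). of_nat (\<Sum>a\<in>compositions (Suc (q - 1)) d. rk (G a)) = poly P (of_int d))"
  proof (rule sum_compositions_polynomial)
    show "0 \<le> rem i" if "i \<in> {1..Suc (q - 1)}" for i
      using that unfolding q' by (rule regularity_multiindex_properties(1))
    show "rk (G a) = rk (G b)" if "\<And>i. i \<in> {1..Suc (q - 1)} \<Longrightarrow> a i = b i" for a b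
      by (rule arg_cong[OF G_cong[OF that[unfolded q']]])
    show "rk (G a) = rk (G (\<lambda>i. min (a i) (rem i)))" if "\<And>i. i \<in> {1..Suc (q - 1)} \<Longrightarrow> 0 \<le> a i" for a
      by (rule rk_G_min[OF that[unfolded q']])
  qed
  then obtain P :: "rat poly" where P: "degree P \<le> q - 1"
    "coeff P (q - 1) = of_nat (scheme_length q n X) / fact (q - 1)"
    "\<And>d. d \<ge> ?r \<Longrightarrow> of_nat (?H d) = poly P (of_int d)"
    unfolding q' rk_G_rem total_hilbert_fun_eq[symmetric] by blast
  have hp: "hilbert_poly q n X = P"
    unfolding hilbert_poly_def
  proof (rule the_equality)
    show "\<exists>d0. \<forall>d\<ge>d0. of_nat (?H d) = poly P (of_int d)" using P(3) by blast
    fix Q :: "rat poly" assume "\<exists>d0. \<forall>d\<ge>d0. of_nat (?H d) = poly Q (of_int d)"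
    then obtain d0 where d0: "\<And>d. d \<ge> d0 \<Longrightarrow> of_nat (?H d) = poly Q (of_int d)" by blast
    show "Q = P" by (rule poly_eq_if_eventually[of "max d0 ?r"]) (simp add: d0[symmetric] P(3)[symmetric])
  qed
  have c0: "coeff P (q - 1) \<noteq> 0" using P(2) scheme_length_pos by simp
  hence deg: "degree P = q - 1" using P(1) le_degree[OF c0] by simp
  have "P \<noteq> 0" using c0 by auto
  hence "finite {x. poly P x = 0}" by (rule poly_roots_finite)
  have "\<exists>M<0. poly P (of_int M) \<noteq> 0"
  proof (rule ccontr)
    assume "\<not> ?thesis"
    hence "(of_int :: int \<Rightarrow> rat) ` {..<0} \<subseteq> {x. poly P x = 0}" by auto
    hence "finite ((of_int :: int \<Rightarrow> rat) ` {..<0})" using \<open>finite {x. poly P x = 0}\<close> by (rule finite_subset)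
    hence "finite {..<0::int}" by (rule finite_imageD) (auto simp: inj_on_def)
    thus False by (simp add: infinite_Iio)
  qed
  then obtain M where M: "M < 0" "poly P (of_int M) \<noteq> 0" by blast
  have "?H M = 0" using M(1) by (simp add: total_hilbert_fun_eq compositions_neg)
  have "regularity_index q n X \<le> ?r"
    unfolding regularity_index_def hp
  proof (rule Least_int_le[where M = M])
    show "\<forall>d\<ge>?r. of_nat (?H d) = poly P (of_int d)" using P(3) by blast
    fix y assume "\<forall>d\<ge>y. of_nat (?H d) = poly P (of_int d)"
    thus "M \<le> y" using \<open>?H M = 0\<close> M(2) by (metis linear of_nat_0)
  qed
  thus ?thesis using P(2) by (simp add: hp deg)
qed

end

theorem corollary4p7:
  fixes q :: nat and n :: "nat \<Rightarrow> nat" and X :: "'k::field ideal_sheaf"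
  assumes "q \<ge> 1" and "\<forall>i\<in>{1..q}. n i \<ge> 1"
    and "closed_subscheme q n X" and "zero_dimensional q n X"
  shows "regularity_index q n X \<le> (\<Sum>i=1..q. regularity_multiindex q n X i) \<and>
         degree (hilbert_poly q n X) = q - 1 \<and>
         lead_coeff (hilbert_poly q n X) = of_nat (scheme_length q n X) / fact (q - 1)"
proof -
  interpret zero_dim_subscheme q n X by unfold_locales (rule assms)+
  show ?thesis by (rule hilbert_polynomial_and_regularity[OF assms(1)])
qed

end
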